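(* Let $c = 2^{-13}$. There exists $n_0 \in \mathbb{N}$ such that for every integer $n \geq n_0$ the following holds. If $M_n$ is drawn uniformly at random from the set of all symmetric $n\times n$ matrices with entries in $\{-1,1\}$, then \[ \mathbb{P}\big(\det(M_n) = 0\big) \leq \exp\left(-c\sqrt{n\log n}\right). \]
   Context: The determinant is taken over the reals (equivalently, the integers). $\log$ denotes the natural logarithm. *)

theory Defs
  imports "HOL-Probability.Probability_Mass_Function" "Jordan_Normal_Form.Determinant"
begin

definition sym_sign_mats :: "nat \<Rightarrow> real mat set" where
  "sym_sign_mats n =
     {A \<in> carrier_mat n n. transpose_mat A = A \<and> (\<forall>i<n. \<forall>j<n. A $$ (i, j) \<in> {-1, 1})}"

(* pmf_of_set is only meaningful on finite nonempty sets. *)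

lemma finite_sym_sign_mats: "finite (sym_sign_mats n)"
proof (rule finite_subset)
  show "sym_sign_mats n \<subseteq>
      (\<lambda>f. mat n n f) ` (({..<n} \<times> {..<n}) \<rightarrow>\<^sub>E {-1, 1 :: real})"
  proof
    fix A assume A: "A \<in> sym_sign_mats n"
    let ?f = "restrict (\<lambda>p. A $$ p) ({..<n} \<times> {..<n})"
    have "A = mat n n ?f"
      using A by (intro eq_matI) (auto simp: sym_sign_mats_def)
    moreover have "?f \<in> ({..<n} \<times> {..<n}) \<rightarrow>\<^sub>E {-1, 1 :: real}"
      using A by (auto simp: sym_sign_mats_def)
    ultimately show "A \<in> (\<lambda>f. mat n n f) ` (({..<n} \<times> {..<n}) \<rightarrow>\<^sub>E {-1, 1 :: real})"
      by blast
  qed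
  show "finite ((\<lambda>f. mat n n f) ` (({..<n} \<times> {..<n}) \<rightarrow>\<^sub>E {-1, 1 :: real}))"
    by (intro finite_imageI finite_PiE) auto
qed

lemma sym_sign_mats_nonempty: "sym_sign_mats n \<noteq> {}"
proof -
  have "mat n n (\<lambda>_. 1) \<in> sym_sign_mats n"
    by (auto simp: sym_sign_mats_def intro!: eq_matI)
  then show ?thesis by blast
qed

end

theory Submission
  imports Defs "HOL-Number_Theory.Cong" "HOL-Real_Asymp.Real_Asymp"
begin

text \<open>Fix an odd prime \<open>p\<close> with \<open>log p\<close> of order \<open>sqrt (n log n)\<close>. A singular sign matrix has a nonzero
integer kernel vector, and after division by the gcd of its entries that vector is nonzero modulo \<open>p\<close>; so
it suffices to bound the probability that the symmetric matrix \<open>M\<close> is singular modulo \<open>p\<close>. Everything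
rests on the small-ball quantity \<open>lazy_prob J z 0\<close>: the probability that the lazy walk with steps \<open>z i\<close>
(\<open>i \<in> J\<close>), each taken with sign \<open>+\<close> or \<open>-\<close> with probability \<open>1/8\<close> each and skipped otherwise, ends at 0
modulo \<open>p\<close>. It dominates the probability that the unlazy signed sum takes any prescribed value
(\<open>rprob_walk_le_lazy_prob\<close>).

The central claim (\<open>rprob_structured_sol\<close>) is that for a fixed right-hand side \<open>w\<close> the system \<open>M z = w\<close> hardly ever
has a nonzero solution \<open>z\<close> that is structured, meaning \<open>lazy_prob {l..<m} z 0 \<ge> 2 / p\<close>. It is a union bound over
\<open>z\<close>, and the point is to count the structured vectors economically. Choose greedily a set \<open>T\<close> of
coordinates such that each new one lowers \<open>lazy_prob T z 0\<close> by a factor \<open>7/8\<close>; this stops after \<open>O(log p)\<close>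
coordinates, and then each other coordinate lies in the set \<open>nbrs T z\<close> of values that are about as likely
for the walk as 0, a set with at most \<open>2 / lazy_prob T z 0\<close> elements which depends only on the coordinates in \<open>T\<close>
(\<open>container\<close>). Since a row of \<open>M\<close> meets its condition with probability at most \<open>lazy_prob T z 0\<close>, this alone
makes every row break even up to a constant factor. To win, take \<open>k\<close> disjoint such sets, \<open>k\<close> a small power of
\<open>n\<close>. Let \<open>S\<close> be their union. By the inequality of arithmetic and geometric means \<open>lazy_prob S z 0\<close> is at most the
return probability of a walk that uses the steps of a single one of the sets \<open>k\<close> times
(\<open>lazy_prob_UN_le_power\<close>), and a \<open>k\<close>-fold repeated walk spreads out: its return probability is smaller by a power of
\<open>k\<close> (\<open>repeated_walk_spreads\<close>). So each row outside \<open>S\<close> gains a power of \<open>n\<close>, in total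
\<open>n ^ (- c n)\<close>, and this pays for the free choice of \<open>O(log p)\<close> coordinates, which costs
\<open>exp (O((log p)^2))\<close>. This balance is what fixes the size of \<open>p\<close>. Vectors of small support, for which the \<open>k\<close>
sets cannot be found, are rare enough already with a single container (\<open>sparse_solutions\<close>).

Granted this, build \<open>M\<close> by adding one row and column at a time. If \<open>M\<close> is singular, then either some
bordering step in the second half fails to shrink a nontrivial kernel, or the last step creates a kernel from
a nonsingular minor (\<open>singular_cases\<close>). In the first case the new column is orthogonal to a kernel vector,
which has probability at most \<open>2 / p\<close> unless that vector is structured (\<open>rprob_stuck\<close>). The second case is
a quadratic equation in the new column. Squaring its probability decouples it: after two independent choices
of the first \<open>l\<close> entries of the column, the difference of the two solutions solves \<open>M z = w\<close> with \<open>w\<close> known, and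
the remaining entries have to satisfy a linear equation with coefficients \<open>z\<close> (\<open>rprob_border\<close>). The
resulting square root is the only essential loss, so the final bound is about \<open>p ^ (- 1/2)\<close>.\<close>

section \<open>Averaging over random signs\<close>

definition signs :: "'a set \<Rightarrow> 'a set \<Rightarrow> ('a \<Rightarrow> int) \<Rightarrow> 'a \<Rightarrow> int" where
  "signs A S r = (\<lambda>i. if i \<in> A then (if i \<in> S then 1 else - 1) else r i)"

text \<open>The coordinates in \<open>A\<close> are resampled and the others keep their values from the base point \<open>r\<close>. So an
average is again a function of the base point, and conditioning is an iterated average.\<close>
definition ravg :: "'a set \<Rightarrow> (('a \<Rightarrow> int) \<Rightarrow> real) \<Rightarrow> ('a \<Rightarrow> int) \<Rightarrow> real" where
  "ravg A F r = (\<Sum>S\<in>Pow A. F (signs A S r)) / 2 ^ card A"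

abbreviation rprob :: "'a set \<Rightarrow> (('a \<Rightarrow> int) \<Rightarrow> bool) \<Rightarrow> ('a \<Rightarrow> int) \<Rightarrow> real" where
  "rprob A E \<equiv> ravg A (\<lambda>r. of_bool (E r))"

definition ignores :: "'a set \<Rightarrow> (('a \<Rightarrow> int) \<Rightarrow> 'b) \<Rightarrow> bool" where
  "ignores A F \<longleftrightarrow> (\<forall>r r'. (\<forall>i. i \<notin> A \<longrightarrow> r i = r' i) \<longrightarrow> F r = F r')"

lemma signs_outside [simp]: "i \<notin> A \<Longrightarrow> signs A S r i = r i"
  by (simp add: signs_def)

lemma ignoresD: "ignores A F \<Longrightarrow> (\<And>i. i \<notin> A \<Longrightarrow> r i = r' i) \<Longrightarrow> F r = F r'"
  unfolding ignores_def by blast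

lemma ignores_signs: "ignores A F \<Longrightarrow> D \<subseteq> A \<Longrightarrow> F (signs D S r) = F r"
  by (rule ignoresD) (auto simp: signs_def)

lemma ravg_empty [simp]: "ravg {} F r = F r"
  by (simp add: ravg_def signs_def)

lemma ravg_insert:
  assumes "finite A" "a \<notin> A"
  shows "ravg (insert a A) F r = (ravg A F (r(a := 1)) + ravg A F (r(a := - 1))) / 2"
proof -
  have inj: "inj_on (insert a) (Pow A)"
    using assms by (auto simp: inj_on_def)
  have "Pow A \<inter> insert a ` Pow A = {}"
    using assms by auto
  then have "(\<Sum>S\<in>Pow (insert a A). F (signs (insert a A) S r))
      = (\<Sum>S\<in>Pow A. F (signs (insert a A) S r)) + (\<Sum>S\<in>insert a ` Pow A. F (signs (insert a A) S r))"
    using assms unfolding Pow_insert by (intro sum.union_disjoint) auto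
  also have "(\<Sum>S\<in>insert a ` Pow A. F (signs (insert a A) S r))
      = (\<Sum>S\<in>Pow A. F (signs (insert a A) (insert a S) r))"
    using inj by (subst sum.reindex) auto
  also have "\<dots> = (\<Sum>S\<in>Pow A. F (signs A S (r(a := 1))))"
    using assms by (intro sum.cong refl arg_cong[of _ _ F]) (auto simp: signs_def)
  also have "(\<Sum>S\<in>Pow A. F (signs (insert a A) S r)) = (\<Sum>S\<in>Pow A. F (signs A S (r(a := - 1))))"
    using assms by (intro sum.cong refl arg_cong[of _ _ F] ext) (auto simp: signs_def)
  finally show ?thesis
    using assms by (simp add: ravg_def field_simps fun_upd_def)
qed

lemma ravg_Un:
  assumes "finite A" "finite B" "A \<inter> B = {}"
  shows "ravg (A \<union> B) F r = ravg A (ravg B F) r"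
  using assms
proof (induction A arbitrary: r rule: finite_induct)
  case empty
  then show ?case by simp
next
  case (insert a A)
  then show ?case by (simp add: ravg_insert)
qed

lemma ravg_mono:
  assumes "\<And>S. S \<subseteq> A \<Longrightarrow> F (signs A S r) \<le> G (signs A S r)"
  shows "ravg A F r \<le> ravg A G r"
  unfolding ravg_def using assms by (intro divide_right_mono sum_mono) auto

lemma ravg_cong:
  assumes "\<And>S. S \<subseteq> A \<Longrightarrow> F (signs A S r) = G (signs A S r)"
  shows "ravg A F r = ravg A G r"
  unfolding ravg_def using assms by (auto intro!: sum.cong)

lemma ravg_eq_const:
  assumes "finite A" "\<And>S. S \<subseteq> A \<Longrightarrow> F (signs A S r) = c"
  shows "ravg A F r = c"
proof -
  have "(\<Sum>S\<in>Pow A. F (signs A S r)) = (\<Sum>S\<in>Pow A. c)"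
    using assms by (intro sum.cong) auto
  then show ?thesis using assms by (simp add: ravg_def card_Pow)
qed

lemma ravg_const [simp]: "finite A \<Longrightarrow> ravg A (\<lambda>r. c) r = c"
  by (rule ravg_eq_const) auto

lemma ravg_sum: "ravg A (\<lambda>r. \<Sum>y\<in>Y. F y r) r = (\<Sum>y\<in>Y. ravg A (F y) r)"
  unfolding ravg_def by (subst sum.swap) (simp add: sum_divide_distrib)

lemma ravg_add: "ravg A (\<lambda>r. F r + G r) r = ravg A F r + ravg A G r"
  unfolding ravg_def by (simp add: sum.distrib add_divide_distrib)

lemma ravg_cmult: "ravg A (\<lambda>r. c * F r) r = c * ravg A F r"
  unfolding ravg_def by (simp add: sum_distrib_left)

lemma ravg_bounds:
  assumes "finite A" "\<And>r. 0 \<le> F r" "\<And>r. F r \<le> 1"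
  shows "0 \<le> ravg A F r" "ravg A F r \<le> 1"
proof -
  show "0 \<le> ravg A F r" unfolding ravg_def using assms by (simp add: sum_nonneg)
  have "ravg A F r \<le> ravg A (\<lambda>_. 1) r" using assms by (intro ravg_mono) auto
  then show "ravg A F r \<le> 1" using assms by simp
qed

lemma rprob_nonneg: "0 \<le> rprob A E r"
  by (simp add: ravg_def sum_nonneg)

lemma rprob_le_1: "finite A \<Longrightarrow> rprob A E r \<le> 1"
  by (rule ravg_bounds) auto

lemma rprob_mono: "(\<And>r. E r \<Longrightarrow> E' r) \<Longrightarrow> rprob A E r \<le> rprob A E' r"
  by (rule ravg_mono) auto

lemma rprob_disj: "rprob A (\<lambda>r. E r \<or> E' r) r \<le> rprob A E r + rprob A E' r"
proof -
  have "rprob A (\<lambda>r. E r \<or> E' r) r \<le> ravg A (\<lambda>r. of_bool (E r) + of_bool (E' r)) r"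
    by (rule ravg_mono) auto
  then show ?thesis by (simp add: ravg_add)
qed

lemma rprob_union:
  assumes "finite Y" "\<And>r. E r \<Longrightarrow> \<exists>y\<in>Y. E' y r"
  shows "rprob A E r \<le> (\<Sum>y\<in>Y. rprob A (E' y) r)"
proof -
  have "of_bool (E r) \<le> (\<Sum>y\<in>Y. of_bool (E' y r) :: real)" for r
  proof (cases "E r")
    case True
    then obtain y where "y \<in> Y" "E' y r" using assms by blast
    then have "of_bool (E' y r) \<le> (\<Sum>y\<in>Y. of_bool (E' y r) :: real)"
      using assms by (intro member_le_sum) auto
    with \<open>E' y r\<close> show ?thesis by simp
  qed (simp add: sum_nonneg)
  then have "rprob A E r \<le> ravg A (\<lambda>r. \<Sum>y\<in>Y. of_bool (E' y r)) r"
    by (intro ravg_mono)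
  then show ?thesis by (simp add: ravg_sum)
qed

lemma ravg_split:
  assumes "finite U" "D \<subseteq> U"
  shows "ravg U F r = ravg (U - D) (ravg D F) r"
  using ravg_Un[of "U - D" D F r] assms by (simp add: finite_subset Un_absorb2 Int_commute)

text \<open>Conditioning on the coordinates outside \<open>D\<close> decides \<open>G\<close>; where \<open>G\<close> holds, the remaining randomness makes
\<open>E\<close> unlikely.\<close>
lemma rprob_conj_le:
  assumes "finite U" "D \<subseteq> U" "ignores D G" and q: "\<And>r. G r \<Longrightarrow> rprob D E r \<le> q"
  shows "rprob U (\<lambda>r. G r \<and> E r) r \<le> q * rprob U G r"
proof -
  have fD: "finite D" using assms finite_subset by blast
  have "rprob D (\<lambda>r. G r \<and> E r) r \<le> q * rprob D G r" for r
  proof (cases "G r")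
    case True
    have "rprob D (\<lambda>r. G r \<and> E r) r \<le> rprob D E r" by (rule rprob_mono) simp
    also have "\<dots> \<le> q" by (rule q[OF True])
    also have "q = q * rprob D G r"
      using True assms fD by (subst ravg_eq_const[of D _ _ 1]) (auto simp: ignores_signs)
    finally show ?thesis .
  next
    case False
    then have "rprob D (\<lambda>r. G r \<and> E r) r = 0" "rprob D G r = 0"
      using assms fD by (auto intro!: ravg_eq_const simp: ignores_signs)
    then show ?thesis by simp
  qed
  then have "ravg (U - D) (rprob D (\<lambda>r. G r \<and> E r)) r \<le> ravg (U - D) (\<lambda>r. q * rprob D G r) r"
    by (intro ravg_mono)
  then show ?thesis using assms by (simp add: ravg_split[of U D] ravg_cmult)
qed

text \<open>The Cauchy-Schwarz inequality, used for decoupling in \<open>rprob_border\<close>.\<close>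
lemma ravg_square_le:
  assumes "finite A"
  shows "(ravg A F r)\<^sup>2 \<le> ravg A (\<lambda>r. (F r)\<^sup>2) r"
proof -
  have "(\<Sum>S\<in>Pow A. F (signs A S r))\<^sup>2 \<le> (\<Sum>S\<in>Pow A. (F (signs A S r))\<^sup>2) * card (Pow A)"
    by (rule sum_squared_le_sum_of_squares)
  then show ?thesis
    using assms by (simp add: ravg_def power_divide card_Pow divide_simps power2_eq_square mult.commute)
qed

lemma ignores_mono: "ignores A F \<Longrightarrow> D \<subseteq> A \<Longrightarrow> ignores D F"
  unfolding ignores_def by (meson subset_iff)

lemma ignores_conj:
  assumes "ignores D E" "ignores D E'"
  shows "ignores D (\<lambda>r. E r \<and> E' r)"
  unfolding ignores_def
proof (intro allI impI)
  fix r r' :: "'a \<Rightarrow> int" assume "\<forall>i. i \<notin> D \<longrightarrow> r i = r' i"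
  then have "E r = E r'" "E' r = E' r'"
    using ignoresD[OF assms(1), of r r'] ignoresD[OF assms(2), of r r'] by simp_all
  then show "(E r \<and> E' r) = (E r' \<and> E' r')" by simp
qed

lemma rprob_union_bound:
  assumes "finite Y" "\<And>r. E r \<Longrightarrow> \<exists>y\<in>Y. E' y r" "\<And>y. y \<in> Y \<Longrightarrow> rprob A (E' y) r \<le> K"
  shows "rprob A E r \<le> real (card Y) * K"
proof -
  have "rprob A E r \<le> (\<Sum>y\<in>Y. rprob A (E' y) r)"
    by (rule rprob_union) (use assms in auto)
  also have "\<dots> \<le> real (card Y) * K"
    using assms(3) by (intro sum_bounded_above) auto
  finally show ?thesis .
qed

lemma rprob_ex_le:
  assumes "finite Z" "\<And>z. z \<in> Z \<Longrightarrow> P z \<Longrightarrow> rprob U (E z) r \<le> g" "card Z \<le> (c::real)" "c * g \<le> Q" "0 \<le> g"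
  shows "rprob U (\<lambda>r. \<exists>z\<in>Z. P z \<and> E z r) r \<le> Q"
proof -
  have "rprob U (\<lambda>r. \<exists>z\<in>Z. P z \<and> E z r) r \<le> real (card {z \<in> Z. P z}) * g"
    by (rule rprob_union_bound[where E' = E]) (use assms in auto)
  also have "\<dots> \<le> real (card Z) * g"
    using assms by (intro mult_right_mono) (auto intro: card_mono)
  also have "\<dots> \<le> c * g" using assms by (intro mult_right_mono)
  finally show ?thesis using assms by simp
qed

section \<open>The lazy walk modulo a prime\<close>

text \<open>The characteristic function of a signed sum. Averaging \<open>cos (x + y)\<close> and \<open>cos (x - y)\<close> gives
\<open>cos x * cos y\<close>, so real cosines suffice; the phase \<open>b\<close> carries the part of the sum that is not averaged.\<close>
lemma ravg_cos:
  fixes z :: "'b \<Rightarrow> int" and t b :: real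
  assumes "finite C" "inj_on e C"
  shows "ravg (e ` C) (\<lambda>r. cos (t * of_int (\<Sum>j\<in>C. r (e j) * z j) + b)) r
    = cos b * (\<Prod>j\<in>C. cos (t * of_int (z j)))"
  using assms
proof (induction C arbitrary: r rule: finite_induct)
  case empty
  then show ?case by simp
next
  case (insert j C)
  let ?F = "\<lambda>r. cos (t * of_int (\<Sum>j\<in>insert j C. r (e j) * z j) + b)"
  have ej: "e j \<notin> e ` C" and fin: "finite (e ` C)" and inj: "inj_on e C"
    using insert.hyps insert.prems by auto
  have avg: "ravg {e j} ?F = (\<lambda>r. cos (t * of_int (z j)) * cos (t * of_int (\<Sum>j\<in>C. r (e j) * z j) + b))"
  proof
    fix r
    have sum: "(\<Sum>i\<in>insert j C. (r(e j := s)) (e i) * z i) = s * z j + (\<Sum>i\<in>C. r (e i) * z i)" for s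
    proof -
      have "(\<Sum>i\<in>C. (r(e j := s)) (e i) * z i) = (\<Sum>i\<in>C. r (e i) * z i)"
        using ej by (intro sum.cong) (auto simp: image_iff)
      then show ?thesis using insert.hyps by simp
    qed
    have "ravg {e j} ?F r = (?F (r(e j := 1)) + ?F (r(e j := - 1))) / 2"
      using ravg_insert[of "{}" "e j" ?F r] by (simp del: fun_upd_apply sum.insert)
    also have "\<dots> = (cos (t * of_int (z j) + (t * of_int (\<Sum>i\<in>C. r (e i) * z i) + b))
        + cos (- (t * of_int (z j)) + (t * of_int (\<Sum>i\<in>C. r (e i) * z i) + b))) / 2"
      unfolding sum by (simp only: of_int_add of_int_mult of_int_1 of_int_minus ring_distribs mult_minus_left mult_1_left add.assoc mult_minus_right)
    also have "\<dots> = cos (t * of_int (z j)) * cos (t * of_int (\<Sum>j\<in>C. r (e j) * z j) + b)"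
      by (simp only: cos_add cos_minus sin_minus) simp
    finally show "ravg {e j} ?F r = cos (t * of_int (z j)) * cos (t * of_int (\<Sum>j\<in>C. r (e j) * z j) + b)" .
  qed
  have "ravg (e ` C \<union> {e j}) ?F r
     = ravg (e ` C) (\<lambda>r. cos (t * of_int (z j)) * cos (t * of_int (\<Sum>j\<in>C. r (e j) * z j) + b)) r"
  proof -
    have "finite {e j}" "e ` C \<inter> {e j} = {}" using ej by auto
    from ravg_Un[OF fin this, of ?F r] show ?thesis unfolding avg .
  qed
  also have "\<dots> = cos (t * of_int (z j)) * (cos b * (\<Prod>j\<in>C. cos (t * of_int (z j))))"
    unfolding ravg_cmult insert.IH[OF inj] ..
  also have "\<dots> = cos b * (\<Prod>j\<in>insert j C. cos (t * of_int (z j)))"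
    using insert.hyps by simp
  also have "e ` C \<union> {e j} = e ` insert j C" by auto
  finally show ?case .
qed

locale odd_prime =
  fixes p :: nat
  assumes prime_p: "prime p" and p_gt_2: "2 < p"
begin

definition cos_mod :: "int \<Rightarrow> real" where
  "cos_mod x = cos (2 * pi * of_int x / p)"

text \<open>The characteristic function of the lazy walk: a step is skipped with probability \<open>3/4\<close>. The laziness makes every factor
positive, so that the most likely position is 0.\<close>
definition lazy_fourier :: "'a set \<Rightarrow> ('a \<Rightarrow> int) \<Rightarrow> int \<Rightarrow> real" where
  "lazy_fourier T v \<xi> = (\<Prod>i\<in>T. 3 / 4 + cos_mod (\<xi> * v i) / 4)"

text \<open>The probability that the lazy walk with steps \<open>v i\<close>, \<open>i \<in> T\<close>, is at \<open>x\<close> modulo \<open>p\<close>, written by Fourier inversion.\<close>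
definition lazy_prob :: "'a set \<Rightarrow> ('a \<Rightarrow> int) \<Rightarrow> int \<Rightarrow> real" where
  "lazy_prob T v x = (\<Sum>\<xi>\<in>{0..<int p}. lazy_fourier T v \<xi> * cos_mod (\<xi> * x)) / p"

lemma p_pos: "0 < p" using p_gt_2 by simp

lemma prime_int_p: "prime (int p)" using prime_p by simp

lemma sum_residues_reindex:
  fixes F :: "int \<Rightarrow> real"
  assumes per: "\<And>x. F (x mod int p) = F x"
    and inj: "\<And>x y. [g x = g y] (mod int p) \<Longrightarrow> [x = y] (mod int p)"
  shows "(\<Sum>\<xi>\<in>{0..<int p}. F (g \<xi>)) = (\<Sum>\<xi>\<in>{0..<int p}. F \<xi>)"
proof -
  let ?h = "\<lambda>\<xi>. g \<xi> mod int p"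
  have inj': "inj_on ?h {0..<int p}"
  proof (rule inj_onI)
    fix x y assume xy: "x \<in> {0..<int p}" "y \<in> {0..<int p}" "?h x = ?h y"
    then have "[x = y] (mod int p)" by (intro inj[of x y]) (simp add: cong_def)
    then show "x = y" using xy by (simp add: cong_def)
  qed
  moreover have "?h ` {0..<int p} \<subseteq> {0..<int p}" using p_pos by auto
  ultimately have "?h ` {0..<int p} = {0..<int p}" by (intro endo_inj_surj) auto
  then have "(\<Sum>\<xi>\<in>{0..<int p}. F \<xi>) = (\<Sum>\<xi>\<in>?h ` {0..<int p}. F \<xi>)" by simp
  also have "\<dots> = (\<Sum>\<xi>\<in>{0..<int p}. F (?h \<xi>))" by (simp add: sum.reindex[OF inj'])
  finally show ?thesis by (simp add: per)
qed

lemma cos_mod_cong: "[x = y] (mod int p) \<Longrightarrow> cos_mod x = cos_mod y"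
proof -
  assume "[x = y] (mod int p)"
  then obtain k where "y = x + int p * k" by (auto simp: cong_iff_lin)
  then have k: "x = y + int p * (- k)" by simp
  have "2 * pi * of_int x / p = 2 * pi * of_int y / p + of_int (- k) * (2 * pi)"
    using p_pos unfolding k by (simp add: field_simps)
  moreover have "cos (a + of_int (- k) * (2 * pi)) = cos a" for a
    using cos.plus_of_int[of a "- k"] by (simp add: mult.commute mult.left_commute)
  ultimately show "cos_mod x = cos_mod y" by (simp only: cos_mod_def)
qed

lemma cos_mod_0 [simp]: "cos_mod 0 = 1" by (simp add: cos_mod_def)
lemma cos_mod_le_1: "cos_mod x \<le> 1" by (simp add: cos_mod_def)
lemma cos_mod_ge: "- 1 \<le> cos_mod x" by (simp add: cos_mod_def)
lemma cos_mod_minus: "cos_mod (- x) = cos_mod x" by (simp add: cos_mod_def)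
lemma cos_mod_mult: "cos_mod x * cos_mod y = (cos_mod (x + y) + cos_mod (x - y)) / 2"
  by (simp add: cos_mod_def cos_times_cos ring_distribs add_divide_distrib diff_divide_distrib)

lemma cos_mod_eq_1_iff: "cos_mod x = 1 \<longleftrightarrow> int p dvd x"
proof
  assume "cos_mod x = 1"
  then obtain n :: int where "2 * pi * of_int x / p = of_int n * 2 * pi"
    by (auto simp: cos_mod_def cos_one_2pi_int)
  then have "real_of_int x = real_of_int (n * int p)"
    using p_pos by (simp add: field_simps)
  then have "x = n * int p" by (simp only: of_int_eq_iff)
  then show "int p dvd x" by simp
next
  assume "int p dvd x"
  then have "cos_mod x = cos_mod 0" by (intro cos_mod_cong) (simp add: cong_0_iff)
  then show "cos_mod x = 1" by simp
qed

lemma not_dvd_mult_inj: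
  "\<not> int p dvd a \<Longrightarrow> [x * a = y * a] (mod int p) \<Longrightarrow> [x = y] (mod int p)"
  using prime_int_p by (metis cong_mult_rcancel coprime_commute prime_imp_coprime)

text \<open>Shifting the summation variable by 1 in both directions shows that the sum is unchanged when multiplied by
\<open>cos_mod x\<close>, and \<open>cos_mod x\<close> differs from 1 unless \<open>p\<close> divides \<open>x\<close>.\<close>
lemma sum_cos_mod: "(\<Sum>\<xi>\<in>{0..<int p}. cos_mod (\<xi> * x)) = (if int p dvd x then p else 0)"
proof (cases "int p dvd x")
  case True
  then have "cos_mod (\<xi> * x) = 1" for \<xi> by (simp add: cos_mod_eq_1_iff)
  then show ?thesis using True by simp
next
  case False
  let ?S = "\<Sum>\<xi>\<in>{0..<int p}. cos_mod (\<xi> * x)"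
  have "cos_mod (\<xi> mod int p * x) = cos_mod (\<xi> * x)" for \<xi>
    by (rule cos_mod_cong) (simp add: cong_def mod_mult_left_eq)
  then have shift: "(\<Sum>\<xi>\<in>{0..<int p}. cos_mod ((\<xi> + a) * x)) = ?S" for a
    using sum_residues_reindex[of "\<lambda>\<xi>. cos_mod (\<xi> * x)" "\<lambda>\<xi>. \<xi> + a"]
    by (simp add: cong_add_rcancel)
  \<comment> \<open>the product formula turns the factor \<open>cos_mod x\<close> into shifts of \<open>\<xi>\<close>\<close>
  have "?S * cos_mod x = (\<Sum>\<xi>\<in>{0..<int p}. (cos_mod ((\<xi> + 1) * x) + cos_mod ((\<xi> + (- 1)) * x)) / 2)"
    by (simp add: sum_distrib_right cos_mod_mult ring_distribs)
  also have "\<dots> = ?S"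
    unfolding sum_divide_distrib[symmetric] sum.distrib shift by simp
  finally have "?S * (cos_mod x - 1) = 0" by (simp add: algebra_simps)
  moreover have "cos_mod x \<noteq> 1" using False by (simp add: cos_mod_eq_1_iff)
  ultimately show ?thesis using False by simp
qed

lemma lazy_fourier_term_bounds: "0 \<le> 3 / 4 + cos_mod x / 4" "3 / 4 + cos_mod x / 4 \<le> 1"
  using cos_mod_le_1[of x] cos_mod_ge[of x] by auto

lemma lazy_fourier_nonneg: "0 \<le> lazy_fourier T v \<xi>"
  unfolding lazy_fourier_def by (intro prod_nonneg) (auto simp: lazy_fourier_term_bounds)

lemma lazy_fourier_le_1: "lazy_fourier T v \<xi> \<le> 1"
  unfolding lazy_fourier_def by (intro prod_le_1) (auto simp: lazy_fourier_term_bounds)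

lemma lazy_fourier_zero [simp]: "lazy_fourier T v 0 = 1"
  by (simp add: lazy_fourier_def)

lemma lazy_fourier_cong: "[\<xi> = \<eta>] (mod int p) \<Longrightarrow> lazy_fourier T v \<xi> = lazy_fourier T v \<eta>"
proof -
  assume "[\<xi> = \<eta>] (mod int p)"
  then have "cos_mod (\<xi> * v i) = cos_mod (\<eta> * v i)" for i by (intro cos_mod_cong cong_scalar_right)
  then show ?thesis by (simp add: lazy_fourier_def)
qed

lemma lazy_fourier_vec_cong:
  assumes "\<And>i. i \<in> T \<Longrightarrow> [v i = v' i] (mod int p)"
  shows "lazy_fourier T v \<xi> = lazy_fourier T v' \<xi>"
proof -
  have "cos_mod (\<xi> * v i) = cos_mod (\<xi> * v' i)" if "i \<in> T" for i
    using assms[OF that] by (intro cos_mod_cong cong_scalar_left)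
  then show ?thesis by (simp add: lazy_fourier_def)
qed

lemma lazy_prob_vec_cong:
  assumes "\<And>i. i \<in> T \<Longrightarrow> [v i = v' i] (mod int p)"
  shows "lazy_prob T v x = lazy_prob T v' x"
proof -
  have "lazy_fourier T v \<xi> = lazy_fourier T v' \<xi>" for \<xi>
    by (rule lazy_fourier_vec_cong) (rule assms)
  then show ?thesis by (simp add: lazy_prob_def)
qed

lemma lazy_prob_0: "lazy_prob T v 0 = (\<Sum>\<xi>\<in>{0..<int p}. lazy_fourier T v \<xi>) / p"
  by (simp add: lazy_prob_def)

lemma lazy_prob_empty: "lazy_prob {} v x = of_bool (int p dvd x)"
  using p_pos by (simp add: lazy_prob_def lazy_fourier_def sum_cos_mod)

lemma lazy_prob_insert:
  assumes "finite T" "i \<notin> T"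
  shows "lazy_prob (insert i T) v x = 3 / 4 * lazy_prob T v x + (lazy_prob T v (x + v i) + lazy_prob T v (x - v i)) / 8"
proof -
  have "lazy_fourier (insert i T) v \<xi> * cos_mod (\<xi> * x) = 3 / 4 * (lazy_fourier T v \<xi> * cos_mod (\<xi> * x))
      + (lazy_fourier T v \<xi> * cos_mod (\<xi> * (x + v i)) + lazy_fourier T v \<xi> * cos_mod (\<xi> * (x - v i))) / 8" for \<xi>
  proof -
    have "lazy_fourier (insert i T) v \<xi> * cos_mod (\<xi> * x)
        = lazy_fourier T v \<xi> * (3 / 4 * cos_mod (\<xi> * x) + (cos_mod (\<xi> * x) * cos_mod (\<xi> * v i)) / 4)"
      using assms by (simp add: lazy_fourier_def algebra_simps)
    then show ?thesis
      unfolding cos_mod_mult by (simp add: algebra_simps)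
  qed
  then have "(\<Sum>\<xi>\<in>{0..<int p}. lazy_fourier (insert i T) v \<xi> * cos_mod (\<xi> * x)) = 3 / 4 * (\<Sum>\<xi>\<in>{0..<int p}. lazy_fourier T v \<xi> * cos_mod (\<xi> * x))
      + ((\<Sum>\<xi>\<in>{0..<int p}. lazy_fourier T v \<xi> * cos_mod (\<xi> * (x + v i))) + (\<Sum>\<xi>\<in>{0..<int p}. lazy_fourier T v \<xi> * cos_mod (\<xi> * (x - v i)))) / 8"
    by (simp add: sum.distrib sum_distrib_left flip: sum_divide_distrib)
  then show ?thesis
    unfolding lazy_prob_def by (simp add: add_divide_distrib)
qed

lemma lazy_prob_insert_0:
  assumes "finite T" "i \<notin> T"
  shows "lazy_prob (insert i T) v 0 = 3 / 4 * lazy_prob T v 0 + lazy_prob T v (v i) / 4"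
proof -
  have "lazy_prob T v (0 - v i) = lazy_prob T v (v i)"
    using cos_mod_minus by (simp add: lazy_prob_def)
  then show ?thesis using lazy_prob_insert[OF assms, of v 0] by simp
qed

lemma lazy_prob_nonneg:
  assumes "finite T" shows "0 \<le> lazy_prob T v x"
  using assms
proof (induction T arbitrary: x rule: finite_induct)
  case empty
  then show ?case by (simp add: lazy_prob_empty)
next
  case (insert i T)
  then show ?case by (simp add: lazy_prob_insert)
qed

lemma sum_lazy_prob: "(\<Sum>x\<in>{0..<int p}. lazy_prob T v x) = 1"
proof -
  have "(\<Sum>x\<in>{0..<int p}. lazy_prob T v x) = (\<Sum>\<xi>\<in>{0..<int p}. lazy_fourier T v \<xi> * (\<Sum>x\<in>{0..<int p}. cos_mod (x * \<xi>))) / p"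
    unfolding lazy_prob_def sum_divide_distrib[symmetric]
    by (subst sum.swap) (simp add: sum_distrib_left mult.commute)
  also have "\<dots> = (\<Sum>\<xi>\<in>{0..<int p}. if \<xi> = 0 then real p else 0) / real p"
  proof -
    have "lazy_fourier T v \<xi> * (\<Sum>x\<in>{0..<int p}. cos_mod (x * \<xi>)) = (if \<xi> = 0 then real p else 0)"
      if "\<xi> \<in> {0..<int p}" for \<xi>
    proof (cases "\<xi> = 0")
      case False
      then have "\<not> int p dvd \<xi>" using that zdvd_not_zless[of \<xi> "int p"] by simp
      then show ?thesis using False by (simp add: sum_cos_mod)
    qed simp
    then show ?thesis by simp
  qed
  finally show ?thesis using p_pos by simp
qed

lemma lazy_prob_0_pos: "0 < lazy_prob T v 0"
proof -
  have "lazy_fourier T v 0 \<le> (\<Sum>\<xi>\<in>{0..<int p}. lazy_fourier T v \<xi>)"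
    using p_pos by (intro member_le_sum) (auto simp: lazy_fourier_nonneg)
  then have "0 < (\<Sum>\<xi>\<in>{0..<int p}. lazy_fourier T v \<xi>)" by simp
  then show ?thesis using p_pos by (simp add: lazy_prob_0)
qed

lemma lazy_prob_0_le_1: "lazy_prob T v 0 \<le> 1"
proof -
  have "(\<Sum>\<xi>\<in>{0..<int p}. lazy_fourier T v \<xi>) \<le> (\<Sum>\<xi>\<in>{0..<int p}. 1)"
    by (intro sum_mono lazy_fourier_le_1)
  then show ?thesis using p_pos by (simp add: lazy_prob_0 divide_simps)
qed

lemma lazy_prob_0_antimono:
  assumes "finite T" "S \<subseteq> T" shows "lazy_prob T v 0 \<le> lazy_prob S v 0"
proof -
  have "lazy_fourier T v \<xi> \<le> lazy_fourier S v \<xi>" for \<xi>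
  proof -
    have "lazy_fourier T v \<xi> = lazy_fourier S v \<xi> * lazy_fourier (T - S) v \<xi>"
      unfolding lazy_fourier_def
      by (subst prod.subset_diff[OF assms(2,1)]) (rule mult.commute)
    also have "\<dots> \<le> lazy_fourier S v \<xi>"
      by (rule mult_left_le[OF lazy_fourier_le_1 lazy_fourier_nonneg])
    finally show ?thesis .
  qed
  then show ?thesis unfolding lazy_prob_0 by (intro divide_right_mono sum_mono) auto
qed

text \<open>The values that, as an additional step, would lower the return probability only slightly.\<close>
definition nbrs :: "'a set \<Rightarrow> ('a \<Rightarrow> int) \<Rightarrow> int set" where
  "nbrs T v = {x \<in> {0..<int p}. lazy_prob T v 0 / 2 \<le> lazy_prob T v x}"

lemma nbrs_subset: "nbrs T v \<subseteq> {0..<int p}" by (auto simp: nbrs_def)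

lemma finite_nbrs: "finite (nbrs T v)"
  by (rule finite_subset[OF nbrs_subset]) simp

text \<open>The probabilities \<open>lazy_prob T v x\<close> add up to 1, and each neighbour takes at least \<open>lazy_prob T v 0 / 2\<close> of this.\<close>
lemma card_nbrs:
  assumes "finite T" shows "card (nbrs T v) \<le> 2 / lazy_prob T v 0"
proof -
  have "card (nbrs T v) * (lazy_prob T v 0 / 2) = (\<Sum>x\<in>nbrs T v. lazy_prob T v 0 / 2)" by simp
  also have "\<dots> \<le> (\<Sum>x\<in>nbrs T v. lazy_prob T v x)" by (intro sum_mono) (simp add: nbrs_def)
  also have "\<dots> \<le> (\<Sum>x\<in>{0..<int p}. lazy_prob T v x)"
    using assms by (intro sum_mono2) (auto simp: nbrs_def lazy_prob_nonneg)
  finally show ?thesis using lazy_prob_0_pos[of T v] by (simp add: sum_lazy_prob field_simps)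
qed

lemma nbrs_cong:
  assumes "\<And>i. i \<in> T \<Longrightarrow> v i = v' i"
  shows "nbrs T v = nbrs T v'"
proof -
  have "lazy_prob T v x = lazy_prob T v' x" for x using assms by (intro lazy_prob_vec_cong) auto
  then show ?thesis by (simp add: nbrs_def)
qed

text \<open>Take \<open>T\<close> of maximal size among the sets on which every coordinate has paid a factor \<open>7/8\<close>. A further
coordinate outside \<open>nbrs T v\<close> would pay this factor as well, because an added step moves the walk away with
probability \<open>1/4\<close> and is then at most half as likely to hit 0.\<close>
lemma container:
  assumes "finite R" and v: "\<And>i. i \<in> R \<Longrightarrow> v i \<in> {0..<int p}"
  obtains T where "T \<subseteq> R" "lazy_prob T v 0 \<le> (7 / 8) ^ card T" "\<And>i. i \<in> R - T \<Longrightarrow> v i \<in> nbrs T v"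
    "(\<exists>i\<in>R. v i \<noteq> 0) \<longrightarrow> (\<exists>i\<in>T. v i \<noteq> 0)"
proof -
  define P where "P T \<longleftrightarrow> T \<subseteq> R \<and> lazy_prob T v 0 \<le> (7 / 8) ^ card T" for T
  have "P {}" by (simp add: P_def lazy_prob_empty)
  moreover have "\<forall>T. P T \<longrightarrow> card T < Suc (card R)"
    using assms(1) by (auto simp: P_def less_Suc_eq_le intro: card_mono)
  ultimately obtain T where PT: "P T" and max: "\<And>T'. P T' \<Longrightarrow> card T' \<le> card T"
    using ex_has_greatest_nat[of P "{}" card "Suc (card R)"] by auto
  have T: "T \<subseteq> R" "lazy_prob T v 0 \<le> (7 / 8) ^ card T"
    using PT by (auto simp: P_def)
  have fT: "finite T" using T assms finite_subset by blast
  have nb: "v i \<in> nbrs T v" if i: "i \<in> R - T" for i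
  proof (rule ccontr)
    assume "v i \<notin> nbrs T v"
    then have "lazy_prob T v (v i) < lazy_prob T v 0 / 2" using v[of i] i by (auto simp: nbrs_def)
    then have "lazy_prob (insert i T) v 0 \<le> 7 / 8 * lazy_prob T v 0"
      using i fT by (simp add: lazy_prob_insert_0)
    also have "\<dots> \<le> 7 / 8 * (7 / 8) ^ card T" using T by simp
    finally have "P (insert i T)" using T i fT by (simp add: P_def)
    from max[OF this] show False using i fT by simp
  qed
  have "\<exists>i\<in>T. v i \<noteq> 0" if nz: "\<exists>i\<in>R. v i \<noteq> 0"
  proof (rule ccontr)
    assume zero: "\<not> (\<exists>i\<in>T. v i \<noteq> 0)"
    then have "lazy_fourier T v \<xi> = lazy_fourier {} v \<xi>" for \<xi> by (simp add: lazy_fourier_def)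
    then have lazy_prob: "lazy_prob T v x = of_bool (int p dvd x)" for x
      using lazy_prob_empty[of v x] by (simp add: lazy_prob_def)
    from nz obtain i where i: "i \<in> R" "v i \<noteq> 0" by blast
    with zero nb[of i] have "lazy_prob T v 0 / 2 \<le> lazy_prob T v (v i)" by (auto simp: nbrs_def)
    then have "int p dvd v i" by (cases "int p dvd v i") (auto simp: lazy_prob)
    then show False using v[OF i(1)] i(2) zdvd_not_zless[of "v i" "int p"] by auto
  qed
  with T nb show ?thesis using that by blast
qed

lemma of_bool_cong_eq: "of_bool [x = y] (mod int p) = (\<Sum>\<xi>\<in>{0..<int p}. cos_mod (\<xi> * (x - y))) / p"
  using p_pos by (simp add: sum_cos_mod cong_iff_dvd_diff)

lemma abs_cos_le_lazy: "\<bar>cos (t::real)\<bar> \<le> 3 / 4 + cos (2 * t) / 4"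
proof -
  have "(1 - \<bar>cos t\<bar>)\<^sup>2 \<ge> 0" by simp
  then have "2 * \<bar>cos t\<bar> \<le> 1 + (cos t)\<^sup>2" by (simp add: power2_eq_square algebra_simps)
  then show ?thesis by (simp add: cos_double_cos diff_divide_distrib)
qed

text \<open>Multiplication by 2 permutes the residues.\<close>
lemma sum_lazy_fourier_double: "(\<Sum>\<xi>\<in>{0..<int p}. lazy_fourier C z (\<xi> * 2)) = (\<Sum>\<xi>\<in>{0..<int p}. lazy_fourier C z \<xi>)"
proof (rule sum_residues_reindex)
  show "lazy_fourier C z (x mod int p) = lazy_fourier C z x" for x
    by (rule lazy_fourier_cong) (simp add: cong_def)
  have "\<not> int p dvd 2" using p_gt_2 zdvd_not_zless[of 2 "int p"] by simp
  then show "[x * 2 = y * 2] (mod int p) \<Longrightarrow> [x = y] (mod int p)" for x y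
    by (rule not_dvd_mult_inj)
qed

lemma lazy_prob_double: "lazy_prob C (\<lambda>j. z j * 2) 0 = lazy_prob C z 0"
proof -
  have "lazy_fourier C (\<lambda>j. z j * 2) \<xi> = lazy_fourier C z (\<xi> * 2)" for \<xi>
    by (simp add: lazy_fourier_def mult_ac)
  then show ?thesis by (simp add: lazy_prob_0 sum_lazy_fourier_double)
qed

text \<open>The probability is the average over \<open>\<xi>\<close> of a phase times a product of cosines. Bounding the phase by 1 and
each cosine by \<open>abs_cos_le_lazy\<close> gives the lazy characteristic function at \<open>2 * \<xi>\<close>, and doubling \<open>\<xi>\<close> does
not affect the average. The map \<open>e\<close> and the constant \<open>c\<close> allow the walk to be part of a matrix row.\<close>
lemma rprob_walk_le_lazy_prob:
  fixes z :: "'b \<Rightarrow> int"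
  assumes "finite C" "inj_on e C" "ignores (e ` C) c"
  shows "rprob (e ` C) (\<lambda>r. [(\<Sum>j\<in>C. r (e j) * z j) + c r = a] (mod int p)) r \<le> lazy_prob C z 0"
proof -
  let ?S = "\<lambda>r. \<Sum>j\<in>C. r (e j) * z j"
  let ?t = "\<lambda>\<xi>. 2 * pi * real_of_int \<xi> / p"
  have "rprob (e ` C) (\<lambda>r. [?S r + c r = a] (mod int p)) r
      = ravg (e ` C) (\<lambda>s. \<Sum>\<xi>\<in>{0..<int p}. 1 / p * cos (?t \<xi> * of_int (?S s) + ?t \<xi> * of_int (c r - a))) r"
  proof (rule ravg_cong)
    fix D assume "D \<subseteq> e ` C"
    have cos_mod: "cos_mod (\<xi> * (s + u - a)) = cos (?t \<xi> * of_int s + ?t \<xi> * of_int (u - a))" for \<xi> s u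
    proof -
      have "2 * pi * real_of_int (\<xi> * (s + u - a)) / p = ?t \<xi> * of_int s + ?t \<xi> * of_int (u - a)"
        using p_pos by (simp add: field_simps)
      then show ?thesis by (simp only: cos_mod_def)
    qed
    have c: "c (signs (e ` C) D r) = c r" using assms(3) by (rule ignores_signs) simp
    show "of_bool [?S (signs (e ` C) D r) + c (signs (e ` C) D r) = a] (mod int p)
      = (\<Sum>\<xi>\<in>{0..<int p}. 1 / p * cos (?t \<xi> * of_int (?S (signs (e ` C) D r)) + ?t \<xi> * of_int (c r - a)))"
      unfolding c of_bool_cong_eq cos_mod sum_divide_distrib by simp
  qed
  also have "\<dots> = (\<Sum>\<xi>\<in>{0..<int p}. 1 / p * (cos (?t \<xi> * of_int (c r - a)) * (\<Prod>j\<in>C. cos (?t \<xi> * of_int (z j)))))"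
    unfolding ravg_sum ravg_cmult ravg_cos[OF assms(1,2)] ..
  also have "\<dots> \<le> (\<Sum>\<xi>\<in>{0..<int p}. 1 / p * lazy_fourier C z (\<xi> * 2))"
  proof (intro sum_mono mult_left_mono)
    fix \<xi>
    let ?u = "cos (?t \<xi> * of_int (c r - a))"
    have "?u * (\<Prod>j\<in>C. cos (?t \<xi> * of_int (z j))) \<le> \<bar>?u\<bar> * (\<Prod>j\<in>C. \<bar>cos (?t \<xi> * of_int (z j))\<bar>)"
      using abs_ge_self[of "?u * (\<Prod>j\<in>C. cos (?t \<xi> * of_int (z j)))"]
      by (simp only: abs_mult abs_prod)
    also have "\<dots> \<le> 1 * (\<Prod>j\<in>C. \<bar>cos (?t \<xi> * of_int (z j))\<bar>)"
      by (intro mult_right_mono prod_nonneg) auto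
    also have "\<dots> \<le> 1 * lazy_fourier C z (\<xi> * 2)"
      unfolding lazy_fourier_def
    proof (intro mult_left_mono prod_mono conjI)
      fix j
      have "cos_mod (\<xi> * 2 * z j) = cos (2 * (?t \<xi> * of_int (z j)))"
        by (simp add: cos_mod_def mult_ac)
      then show "\<bar>cos (?t \<xi> * of_int (z j))\<bar> \<le> 3 / 4 + cos_mod (\<xi> * 2 * z j) / 4"
        using abs_cos_le_lazy by presburger
    qed auto
    finally show "?u * (\<Prod>j\<in>C. cos (?t \<xi> * of_int (z j))) \<le> lazy_fourier C z (\<xi> * 2)" by simp
  qed auto
  finally show ?thesis
    by (simp add: lazy_prob_0 sum_divide_distrib[symmetric] sum_lazy_fourier_double)
qed

end

section \<open>A Halasz-type inequality\<close>

context odd_prime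
begin

text \<open>A weak form of the Cauchy-Davenport theorem. If the difference set \<open>D\<close> of \<open>A\<close> had fewer than \<open>3/2 * card A\<close>
elements, then any two reflected translates of \<open>A\<close> would share more than half of their elements. So each \<open>d \<in> D\<close>
would be a difference \<open>c' - c\<close> for more than half of all \<open>c \<in> A\<close>, and for \<open>d, e \<in> D\<close> a common \<open>c\<close> would show
\<open>d - e \<in> D\<close>. A set that is closed under subtraction and contains a nonzero residue is everything.\<close>
lemma difference_growth:
  assumes A: "A \<subseteq> {0..<int p}" "2 \<le> card A"
    and B: "B \<subseteq> {0..<int p}" "B \<noteq> {0..<int p}"
    and AB: "\<And>a b. a \<in> A \<Longrightarrow> b \<in> A \<Longrightarrow> (a - b) mod int p \<in> B"
  shows "3 * card A \<le> 2 * card B"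
proof (rule ccontr)
  assume small: "\<not> 3 * card A \<le> 2 * card B"
  have fA: "finite A" and fB: "finite B"
    using A B by (auto intro: finite_subset)
  define D where "D = (\<lambda>(a, b). (a - b) mod int p) ` (A \<times> A)"
  have DI: "(a - b) mod int p \<in> D" if "a \<in> A" "b \<in> A" for a b
    using that by (auto simp: D_def)
  have DB: "D \<subseteq> B" using AB by (auto simp: D_def)
  \<comment> \<open>the translates \<open>a - A\<close> and \<open>b - A\<close> both lie in \<open>B\<close>, hence overlap in more than half of \<open>A\<close>\<close>
  have big: "card A < 2 * card {c \<in> A. (c + d) mod int p \<in> A}" if dD: "d \<in> D" for d
  proof -
    obtain b a where ab: "b \<in> A" "a \<in> A" "d = (b - a) mod int p"
      using dD by (auto simp: D_def)
    let ?G = "\<lambda>a c. (a - c) mod int p"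
    have inj: "inj_on (?G a) A" for a
    proof (rule inj_onI)
      fix x y assume xy: "x \<in> A" "y \<in> A" "(a - x) mod int p = (a - y) mod int p"
      then have "(a - (a - x)) mod int p = (a - (a - y)) mod int p" by (metis mod_diff_right_eq)
      then show "x = y" using xy A by (auto simp: mod_pos_pos_trivial subset_iff)
    qed
    have card: "card (?G a ` A) = card A" for a by (rule card_image[OF inj])
    have "card (?G a ` A \<union> ?G b ` A) \<le> card B"
      using ab AB fB by (intro card_mono) auto
    then have "2 * card A \<le> card B + card (?G a ` A \<inter> ?G b ` A)"
      using card_Un_Int[of "?G a ` A" "?G b ` A"] fA card[of a] card[of b] by simp
    moreover have "card (?G a ` A \<inter> ?G b ` A) \<le> card (?G a ` {c \<in> A. (c + d) mod int p \<in> A})"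
    proof (intro card_mono subsetI)
      fix x assume "x \<in> ?G a ` A \<inter> ?G b ` A"
      then obtain c c' where c: "c \<in> A" "c' \<in> A" "x = (a - c) mod int p" "x = (b - c') mod int p" by auto
      have "(c + d) mod int p = (b - (a - c) mod int p) mod int p"
        unfolding ab by (simp add: mod_simps algebra_simps)
      also have "\<dots> = (b - (b - c') mod int p) mod int p" using c by simp
      also have "\<dots> = c' mod int p" by (simp add: mod_simps)
      also have "\<dots> = c'" using c A by (auto simp: subset_iff)
      finally show "x \<in> ?G a ` {c \<in> A. (c + d) mod int p \<in> A}" using c by auto
    qed (use fA in auto)
    moreover have "card (?G a ` {c \<in> A. (c + d) mod int p \<in> A}) \<le> card {c \<in> A. (c + d) mod int p \<in> A}"
      using fA by (intro card_image_le) auto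
    ultimately show ?thesis using small by linarith
  qed
  have closed: "(d - e) mod int p \<in> D" if "d \<in> D" "e \<in> D" for d e
  proof -
    let ?X = "{c \<in> A. (c + d) mod int p \<in> A}" and ?Y = "{c \<in> A. (c + e) mod int p \<in> A}"
    have "?X \<inter> ?Y \<noteq> {}"
    proof
      assume "?X \<inter> ?Y = {}"
      then have "card ?X + card ?Y = card (?X \<union> ?Y)" using fA by (intro card_Un_disjoint[symmetric]) auto
      also have "\<dots> \<le> card A" using fA by (intro card_mono) auto
      finally show False using big[OF that(1)] big[OF that(2)] by linarith
    qed
    then obtain c where "(c + d) mod int p \<in> A" "(c + e) mod int p \<in> A" by auto
    from DI[OF this] show ?thesis by (simp add: mod_simps)
  qed
  obtain a b where ab: "a \<in> A" "b \<in> A" "a \<noteq> b"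
  proof -
    have "\<not> card A \<le> Suc 0" using A(2) by simp
    then show ?thesis using that fA by (auto simp: card_le_Suc0_iff_eq)
  qed
  define d where "d = (a - b) mod int p"
  have "d \<in> D" using ab by (auto simp: d_def intro: DI)
  have zero: "0 \<in> D" using DI[OF ab(1) ab(1)] by simp
  have add: "(x + y) mod int p \<in> D" if "x \<in> D" "y \<in> D" for x y
    using closed[OF that(1) closed[OF zero that(2)]] by (simp add: mod_simps)
  have mult: "(int j * d) mod int p \<in> D" for j
  proof (induction j)
    case 0
    then show ?case using zero by simp
  next
    case (Suc j)
    from add[OF this \<open>d \<in> D\<close>] show ?case by (simp add: mod_simps algebra_simps)
  qed
  have "\<not> int p dvd d"
  proof
    assume "int p dvd d"
    then have "a mod int p = b mod int p" by (simp add: d_def mod_eq_dvd_iff dvd_mod_iff)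
    then show False using ab A by (auto simp: subset_iff)
  qed
  then have "coprime d (int p)" using prime_int_p by (metis coprime_commute prime_imp_coprime)
  then obtain u where u: "[d * u = 1] (mod int p)" using cong_solve_coprime_int by blast
  have "{0..<int p} \<subseteq> D"
  proof
    fix x assume x: "x \<in> {0..<int p}"
    let ?j = "nat ((x * u) mod int p)"
    have "int ?j * d mod int p = x * (d * u) mod int p"
      using p_pos by (simp add: mod_simps mult_ac)
    also have "\<dots> = x * 1 mod int p" using u unfolding cong_def by (metis mod_mult_right_eq)
    also have "\<dots> = x" using x by simp
    finally show "x \<in> D" using mult[of ?j] by simp
  qed
  then show False using DB B by blast
qed

text \<open>Up to constants, \<open>- ln (lazy_fourier T v \<xi>)\<close>. Unlike the logarithm it has a clean quasi-triangle inequality,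
\<open>defect_diff\<close>.\<close>
definition defect :: "'a set \<Rightarrow> ('a \<Rightarrow> int) \<Rightarrow> int \<Rightarrow> real" where
  "defect T v \<xi> = (\<Sum>i\<in>T. 1 - cos_mod (\<xi> * v i))"

lemma defect_cong: "[\<xi> = \<eta>] (mod int p) \<Longrightarrow> defect T v \<xi> = defect T v \<eta>"
proof -
  assume "[\<xi> = \<eta>] (mod int p)"
  then have "cos_mod (\<xi> * v i) = cos_mod (\<eta> * v i)" for i by (intro cos_mod_cong cong_scalar_right)
  then show ?thesis by (simp add: defect_def)
qed

lemma one_minus_cos_diff: "1 - cos (a - b) \<le> 2 * (1 - cos a) + 2 * (1 - cos (b::real))"
proof -
  have half: "1 - cos x = 2 * (sin (x / 2))\<^sup>2" for x :: real
    using cos_double_sin[of "x / 2"] by simp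
  let ?x = "a / 2" and ?y = "b / 2"
  have "(sin ((a - b) / 2))\<^sup>2 = (sin ?x * cos ?y - cos ?x * sin ?y)\<^sup>2"
    by (simp add: diff_divide_distrib sin_diff)
  also have "\<dots> \<le> 2 * ((sin ?x)\<^sup>2 * (cos ?y)\<^sup>2) + 2 * ((cos ?x)\<^sup>2 * (sin ?y)\<^sup>2)"
    using zero_le_power2[of "sin ?x * cos ?y + cos ?x * sin ?y"]
    by (simp add: power2_eq_square algebra_simps)
  also have "\<dots> \<le> 2 * ((sin ?x)\<^sup>2 * 1) + 2 * (1 * (sin ?y)\<^sup>2)"
    by (intro add_mono mult_left_mono mult_right_mono) (auto simp: abs_square_le_1)
  finally show ?thesis unfolding half by simp
qed

lemma defect_diff: "defect T v (\<xi> - \<eta>) \<le> 2 * defect T v \<xi> + 2 * defect T v \<eta>"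
  unfolding defect_def sum_distrib_left sum.distrib[symmetric]
proof (rule sum_mono)
  fix i
  have "cos_mod ((\<xi> - \<eta>) * v i) = cos (2 * pi * of_int (\<xi> * v i) / p - 2 * pi * of_int (\<eta> * v i) / p)"
    by (simp add: cos_mod_def left_diff_distrib right_diff_distrib diff_divide_distrib)
  then show "1 - cos_mod ((\<xi> - \<eta>) * v i) \<le> 2 * (1 - cos_mod (\<xi> * v i)) + 2 * (1 - cos_mod (\<eta> * v i))"
    using one_minus_cos_diff by (simp only: cos_mod_def)
qed

definition small_defect :: "'a set \<Rightarrow> ('a \<Rightarrow> int) \<Rightarrow> real \<Rightarrow> int set" where
  "small_defect T v h = {\<xi> \<in> {0..<int p}. defect T v \<xi> \<le> h}"

lemma small_defect_subset: "small_defect T v h \<subseteq> {0..<int p}"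
  by (auto simp: small_defect_def)

lemma finite_small_defect: "finite (small_defect T v h)"
  by (rule finite_subset[OF small_defect_subset]) simp

text \<open>The average of \<open>defect T v\<close> over all residues is the number of nonzero steps, so it is at least 1.\<close>
lemma small_defect_proper:
  assumes "finite T" "i \<in> T" "\<not> int p dvd v i" "h < 1"
  shows "small_defect T v h \<noteq> {0..<int p}"
proof
  assume eq: "small_defect T v h = {0..<int p}"
  have "(\<Sum>\<xi>\<in>{0..<int p}. defect T v \<xi>) \<le> (\<Sum>\<xi>\<in>{0..<int p}. h)"
  proof (rule sum_mono)
    fix \<xi> assume "\<xi> \<in> {0..<int p}"
    then have "\<xi> \<in> small_defect T v h" unfolding eq .
    then show "defect T v \<xi> \<le> h" by (simp add: small_defect_def)
  qed
  also have "\<dots> < p" using p_pos assms by simp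
  also have "real p = (\<Sum>\<xi>\<in>{0..<int p}. 1 - cos_mod (\<xi> * v i))"
    using assms by (simp add: sum_subtractf sum_cos_mod)
  also have "\<dots> \<le> (\<Sum>\<xi>\<in>{0..<int p}. defect T v \<xi>)"
    unfolding defect_def using assms by (intro sum_mono member_le_sum) (auto simp: cos_mod_le_1)
  finally show False by simp
qed

text \<open>By \<open>defect_diff\<close> differences of points at level \<open>h\<close> lie at level \<open>4 * h\<close>; iterate \<open>difference_growth\<close>, which
applies as long as the level stays below 1.\<close>
lemma small_defect_growth:
  assumes "finite T" "i \<in> T" "\<not> int p dvd v i" "2 \<le> card (small_defect T v h)" "0 \<le> h" "4 ^ j * h < 1"
  shows "3 ^ j * card (small_defect T v h) \<le> 2 ^ j * card (small_defect T v (4 ^ j * h))"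
  using assms(6)
proof (induction j)
  case 0
  then show ?case by simp
next
  case (Suc j)
  let ?A = "small_defect T v (4 ^ j * h)" and ?B = "small_defect T v (4 ^ Suc j * h)"
  have le: "h \<le> 4 ^ j * h" "4 ^ j * h \<le> 4 ^ Suc j * h"
    using assms(5) by (auto intro: mult_right_mono simp: mult_le_cancel_right1)
  have "small_defect T v h \<subseteq> ?A" using le by (auto simp: small_defect_def)
  then have two: "2 \<le> card ?A"
    using assms(4) card_mono[OF finite_small_defect] le_trans by blast
  have "3 * card ?A \<le> 2 * card ?B"
  proof (rule difference_growth)
    show "?B \<noteq> {0..<int p}" using Suc.prems by (rule small_defect_proper[of T i v, OF assms(1-3)])
    fix a b assume "a \<in> ?A" "b \<in> ?A"
    then have "defect T v (a - b) \<le> 4 ^ Suc j * h"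
      using defect_diff[of T v a b] by (auto simp: small_defect_def)
    moreover have "defect T v ((a - b) mod int p) = defect T v (a - b)"
      by (rule defect_cong) (simp add: cong_def)
    ultimately show "(a - b) mod int p \<in> ?B" using p_pos by (auto simp: small_defect_def)
  qed (use two small_defect_subset in auto)
  then have "2 ^ j * (3 * card ?A) \<le> 2 ^ j * (2 * card ?B)" by (rule mult_le_mono2)
  moreover have "3 ^ j * card (small_defect T v h) \<le> 2 ^ j * card ?A"
    using Suc le by (intro Suc.IH) simp
  ultimately have "3 * (3 ^ j * card (small_defect T v h)) \<le> 2 ^ j * (2 * card ?B)"
    by linarith
  then show ?case by (simp add: mult_ac)
qed

lemma lazy_fourier_le_exp: "lazy_fourier T v \<xi> \<le> exp (- defect T v \<xi> / 4)"
proof (cases "finite T")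
  case True
  have "lazy_fourier T v \<xi> \<le> (\<Prod>i\<in>T. exp (- (1 - cos_mod (\<xi> * v i)) / 4))"
    unfolding lazy_fourier_def
  proof (intro prod_mono conjI)
    fix i
    have "1 + (- (1 - cos_mod (\<xi> * v i)) / 4) \<le> exp (- (1 - cos_mod (\<xi> * v i)) / 4)" by (rule exp_ge_add_one_self)
    then show "3 / 4 + cos_mod (\<xi> * v i) / 4 \<le> exp (- (1 - cos_mod (\<xi> * v i)) / 4)" by (simp add: field_simps)
  qed (rule lazy_fourier_term_bounds)
  also have "\<dots> = exp (- defect T v \<xi> / 4)"
    unfolding exp_sum[OF True, symmetric] defect_def sum_divide_distrib[symmetric] sum_negf ..
  finally show ?thesis .
qed (simp add: lazy_fourier_def defect_def)

lemma lazy_fourier_ge: "finite T \<Longrightarrow> 1 - defect T v \<xi> / 4 \<le> lazy_fourier T v \<xi>"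
proof (induction T rule: finite_induct)
  case empty
  then show ?case by (simp add: lazy_fourier_def defect_def)
next
  case (insert i T)
  let ?c = "(1 - cos_mod (\<xi> * v i)) / 4"
  have "0 \<le> ?c" by (simp add: cos_mod_le_1)
  then have "lazy_fourier T v \<xi> * ?c \<le> 1 * ?c"
    by (intro mult_right_mono lazy_fourier_le_1)
  moreover have "lazy_fourier (insert i T) v \<xi> = lazy_fourier T v \<xi> - lazy_fourier T v \<xi> * ?c"
    using insert.hyps by (simp add: lazy_fourier_def algebra_simps diff_divide_distrib)
  moreover have "defect (insert i T) v \<xi> / 4 = defect T v \<xi> / 4 + ?c"
    using insert.hyps by (simp add: defect_def add_divide_distrib)
  ultimately show ?case using insert.IH by linarith
qed

text \<open>The left-hand side is the return probability of the walk that takes each step \<open>k = 1 + 8 * j * 4 ^ j\<close> times.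
Frequencies of defect above \<open>h = 1 / (2 * 4 ^ j)\<close> contribute little to it, since there the \<open>k - 1\<close> extra factors are
together at most \<open>exp (- j)\<close>; this is how \<open>k\<close> is chosen. The frequencies below \<open>h\<close> are few by
\<open>small_defect_growth\<close>, compared with those of defect at most \<open>1 / 2\<close>, where \<open>lazy_fourier T v\<close> is at least \<open>7/8\<close>. The term
\<open>1 / p\<close> comes from the frequency 0 alone.\<close>
lemma repeated_walk_spreads:
  fixes j :: nat
  assumes "finite T" "i \<in> T" "\<not> int p dvd v i"
  shows "(\<Sum>\<xi>\<in>{0..<int p}. lazy_fourier T v \<xi> ^ (1 + 8 * j * 4 ^ j)) / p \<le> 1 / p + 3 * (2 / 3) ^ j * lazy_prob T v 0"
proof -
  define k where "k = 8 * j * 4 ^ j"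
  define h :: real where "h = 1 / (2 * 4 ^ j)"
  let ?f = "lazy_fourier T v" and ?Z = "{0..<int p}" and ?L = "small_defect T v h"
  let ?S = "\<Sum>\<xi>\<in>?Z. ?f \<xi>"
  have h0: "0 \<le> h" and h4: "4 ^ j * h = 1 / 2" by (auto simp: h_def)
  have half: "card (small_defect T v (1 / 2)) * (7 / 8) \<le> ?S"
  proof -
    have "card (small_defect T v (1 / 2)) * (7 / 8) = (\<Sum>\<xi>\<in>small_defect T v (1 / 2). 7 / 8)" by simp
    also have "\<dots> \<le> (\<Sum>\<xi>\<in>small_defect T v (1 / 2). ?f \<xi>)"
    proof (rule sum_mono)
      fix \<xi> assume "\<xi> \<in> small_defect T v (1 / 2)"
      then have "defect T v \<xi> \<le> 1 / 2" by (simp add: small_defect_def)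
      then show "7 / 8 \<le> ?f \<xi>" using lazy_fourier_ge[OF assms(1), of v \<xi>] by linarith
    qed
    also have "\<dots> \<le> ?S" using small_defect_subset by (intro sum_mono2) (auto simp: lazy_fourier_nonneg)
    finally show ?thesis .
  qed
  have S0: "0 \<le> ?S" by (intro sum_nonneg lazy_fourier_nonneg)
  \<comment> \<open>few frequencies of small defect; the summand 1 covers the case that 0 is the only one\<close>
  have near: "card ?L \<le> 1 + (2 / 3) ^ j * (8 / 7 * ?S)"
  proof (cases "2 \<le> card ?L")
    case True
    have "3 ^ j * card ?L \<le> 2 ^ j * card (small_defect T v (4 ^ j * h))"
      using h4 by (intro small_defect_growth[of T i v, OF assms True h0]) simp
    then have "real (3 ^ j * card ?L) \<le> real (2 ^ j * card (small_defect T v (1 / 2)))"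
      unfolding h4 by (simp only: of_nat_le_iff)
    then have "card ?L \<le> (2 / 3) ^ j * card (small_defect T v (1 / 2))"
      by (simp add: power_divide field_simps)
    also have "\<dots> \<le> (2 / 3) ^ j * (8 / 7 * ?S)"
      using half by (intro mult_left_mono) auto
    finally show ?thesis by simp
  next
    case False
    moreover have "0 \<le> (2 / 3) ^ j * (8 / 7 * ?S)" using S0 by simp
    ultimately show ?thesis by linarith
  qed
  \<comment> \<open>\<open>8 * j * 4 ^ j\<close> factors, each at most \<open>exp (- h / 4)\<close>, multiply to \<open>exp (- j)\<close>\<close>
  have far: "?f \<xi> ^ (1 + k) \<le> (2 / 3) ^ j * ?f \<xi>" if "\<xi> \<in> ?Z - ?L" for \<xi>
  proof -
    have "h \<le> defect T v \<xi>" using that by (auto simp: small_defect_def)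
    then have "?f \<xi> \<le> exp (- h / 4)"
      using lazy_fourier_le_exp[of T v \<xi>] by (rule_tac order_trans) auto
    then have "?f \<xi> ^ k \<le> exp (- h / 4) ^ k" by (intro power_mono lazy_fourier_nonneg)
    also have "\<dots> = exp (- real j)"
      by (simp add: exp_of_nat_mult[symmetric] k_def h_def)
    also have "\<dots> = exp (- 1) ^ j" by (simp add: exp_of_nat_mult[symmetric])
    also have "\<dots> \<le> (2 / 3) ^ j"
    proof (rule power_mono)
      have "2 \<le> exp (1::real)" using exp_ge_add_one_self[of 1] by simp
      then show "exp (- 1) \<le> (2 / 3 :: real)" by (simp add: exp_minus field_simps)
    qed simp
    finally have "?f \<xi> ^ k * ?f \<xi> \<le> (2 / 3) ^ j * ?f \<xi>"
      by (intro mult_right_mono lazy_fourier_nonneg)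
    then show ?thesis by (simp add: mult.commute)
  qed
  have "(\<Sum>\<xi>\<in>?Z. ?f \<xi> ^ (1 + k)) = (\<Sum>\<xi>\<in>?Z - ?L. ?f \<xi> ^ (1 + k)) + (\<Sum>\<xi>\<in>?L. ?f \<xi> ^ (1 + k))"
    using small_defect_subset by (intro sum.subset_diff) auto
  also have "\<dots> \<le> (\<Sum>\<xi>\<in>?Z - ?L. (2 / 3) ^ j * ?f \<xi>) + (\<Sum>\<xi>\<in>?L. 1)"
    using far by (intro add_mono sum_mono power_le_one lazy_fourier_nonneg lazy_fourier_le_1)
  also have "(\<Sum>\<xi>\<in>?Z - ?L. (2 / 3) ^ j * ?f \<xi>) \<le> (\<Sum>\<xi>\<in>?Z. (2 / 3) ^ j * ?f \<xi>)"
    by (intro sum_mono2) (auto simp: lazy_fourier_nonneg)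
  also have "(\<Sum>\<xi>\<in>?Z. (2 / 3) ^ j * ?f \<xi>) = (2 / 3) ^ j * ?S" by (simp add: sum_distrib_left)
  finally have "(\<Sum>\<xi>\<in>?Z. ?f \<xi> ^ (1 + k)) \<le> (2 / 3) ^ j * ?S + card ?L" by simp
  also have "\<dots> \<le> 1 + 3 * ((2 / 3) ^ j * ?S)"
  proof -
    have "0 \<le> (2 / 3) ^ j * ?S" using S0 by simp
    moreover have "(2 / 3) ^ j * (8 / 7 * ?S) = 8 / 7 * ((2 / 3) ^ j * ?S)" by (rule mult.left_commute)
    ultimately show ?thesis using near by linarith
  qed
  finally have "(\<Sum>\<xi>\<in>?Z. ?f \<xi> ^ (1 + k)) / p \<le> (1 + 3 * ((2 / 3) ^ j * ?S)) / p"
    by (intro divide_right_mono) auto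
  then show ?thesis by (simp add: k_def lazy_prob_0 add_divide_distrib)
qed

end

section \<open>Rows of a random symmetric matrix, and disjoint unions of walks\<close>

text \<open>The matrix is read off its upper triangle, the only coordinates that are random.\<close>
definition entry :: "(nat \<times> nat \<Rightarrow> int) \<Rightarrow> nat \<Rightarrow> nat \<Rightarrow> int" where
  "entry r i j = r (min i j, max i j)"

definition rowsum :: "(nat \<times> nat \<Rightarrow> int) \<Rightarrow> nat \<Rightarrow> (nat \<Rightarrow> int) \<Rightarrow> nat \<Rightarrow> int" where
  "rowsum r m z i = (\<Sum>j<m. entry r i j * z j)"

text \<open>The coordinates behind the block of the matrix with rows \<open>A\<close> and columns \<open>C\<close>.\<close>
definition edges :: "nat set \<Rightarrow> nat set \<Rightarrow> (nat \<times> nat) set" where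
  "edges A C = (\<lambda>(i, j). (min i j, max i j)) ` (A \<times> C)"

definition pairs :: "nat \<Rightarrow> (nat \<times> nat) set" where
  "pairs n = {(i, j). i \<le> j \<and> j < n}"

lemma finite_pairs: "finite (pairs n)"
  by (rule finite_subset[of _ "{..<n} \<times> {..<n}"]) (auto simp: pairs_def)

lemma pairs_mono: "m \<le> n \<Longrightarrow> pairs m \<subseteq> pairs n"
  by (auto simp: pairs_def)

lemma edges_pairs: "A \<subseteq> {..<m} \<Longrightarrow> C \<subseteq> {..<m} \<Longrightarrow> edges A C \<subseteq> pairs m"
  by (auto simp: edges_def pairs_def subset_iff)

lemma min_max_eq_iff:
  "(min i j, max i j) = (min k l, max k l) \<longleftrightarrow> (i = k \<and> j = l) \<or> (i = l \<and> j = (k::nat))"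
  by (auto simp: min_def max_def)

lemma in_edges_iff: "(min i j, max i j) \<in> edges A C \<longleftrightarrow> i \<in> A \<and> j \<in> C \<or> j \<in> A \<and> i \<in> C"
  by (auto simp: edges_def image_iff Bex_def simp del: prod.inject simp: min_max_eq_iff)

lemma ignores_row:
  assumes "\<And>j. j < m \<Longrightarrow> (min i j, max i j) \<notin> D"
  shows "ignores D (\<lambda>r. rowsum r m z i)"
  using assms by (auto simp: ignores_def rowsum_def entry_def intro!: sum.cong)

lemma ignores_rows:
  assumes "\<And>i j. i \<in> A \<Longrightarrow> j < m \<Longrightarrow> (min i j, max i j) \<notin> D"
  shows "ignores D (\<lambda>r. \<forall>i\<in>A. [rowsum r m z i = w i] (mod q))"
  unfolding ignores_def
proof (intro allI impI ball_cong refl)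
  fix r r' :: "nat \<times> nat \<Rightarrow> int" and i
  assume "\<forall>x. x \<notin> D \<longrightarrow> r x = r' x" and "i \<in> A"
  then have "rowsum r m z i = rowsum r' m z i"
    using ignoresD[OF ignores_row[of m i D z]] assms by blast
  then show "[rowsum r m z i = w i] (mod q) \<longleftrightarrow> [rowsum r' m z i = w i] (mod q)" by simp
qed

context odd_prime
begin

text \<open>The columns \<open>C\<close> are disjoint from the rows \<open>A\<close>, so the symmetric matrix has independent entries in this
block and no entry of it reappears in another row of \<open>A\<close>. Resampling the block one row at a time gives one small-ball
factor per row.\<close>
lemma rprob_rows:
  assumes "finite U" "A \<subseteq> {..<m}" "C \<subseteq> {..<m}" "A \<inter> C = {}" "edges A C \<subseteq> U" "ignores (edges A C) G"
  shows "rprob U (\<lambda>r. G r \<and> (\<forall>i\<in>A. [rowsum r m z i = w i] (mod int p))) r \<le> lazy_prob C z 0 ^ card A * rprob U G r"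
proof -
  have fA: "finite A" and fC: "finite C" using assms finite_subset by blast+
  from fA assms(2,4,5,6) show ?thesis
  proof (induction A rule: finite_induct)
    case empty
    then show ?case by simp
  next
    case (insert i A)
    let ?e = "\<lambda>j. (min i j, max i j)"
    let ?E = "\<lambda>r. [rowsum r m z i = w i] (mod int p)"
    let ?G = "\<lambda>r. G r \<and> (\<forall>i\<in>A. [rowsum r m z i = w i] (mod int p))"
    have sub: "?e ` C \<subseteq> edges (insert i A) C" "edges A C \<subseteq> edges (insert i A) C"
      by (auto simp: edges_def)
    have iC: "i \<notin> C" and AC: "A \<inter> C = {}" using insert.prems by auto
    have ign: "ignores (?e ` C) ?G"
    proof -
      have "ignores (?e ` C) G" by (rule ignores_mono[OF insert.prems(4) sub(1)])
      moreover have "ignores (?e ` C) (\<lambda>r. \<forall>k\<in>A. [rowsum r m z k = w k] (mod int p))"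
      proof (rule ignores_rows)
        fix k j assume k: "k \<in> A"
        show "(min k j, max k j) \<notin> ?e ` C"
        proof
          assume "(min k j, max k j) \<in> ?e ` C"
          then obtain l where "l \<in> C" "(min k j, max k j) = (min i l, max i l)" by blast
          then show False using k AC insert.hyps unfolding min_max_eq_iff by auto
        qed
      qed
      ultimately show ?thesis by (rule ignores_conj)
    qed
    \<comment> \<open>row \<open>i\<close> is a walk with steps indexed by \<open>C\<close>, shifted by its entries outside \<open>C\<close>\<close>
    have step: "rprob (?e ` C) ?E r \<le> lazy_prob C z 0" for r
    proof -
      let ?c = "\<lambda>r. \<Sum>j\<in>{..<m} - C. entry r i j * z j"
      have "rowsum r m z i = (\<Sum>j\<in>C. r (?e j) * z j) + ?c r" for r
        using sum.subset_diff[OF assms(3), of "\<lambda>j. entry r i j * z j"] by (simp add: rowsum_def entry_def)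
      moreover have "inj_on ?e C"
        unfolding inj_on_def min_max_eq_iff by auto
      moreover have "ignores (?e ` C) ?c"
        unfolding ignores_def
      proof (intro allI impI sum.cong refl)
        fix r r' :: "nat \<times> nat \<Rightarrow> int" and j
        assume eq: "\<forall>x. x \<notin> ?e ` C \<longrightarrow> r x = r' x" and j: "j \<in> {..<m} - C"
        have "?e j \<notin> ?e ` C"
        proof
          assume "?e j \<in> ?e ` C"
          then obtain l where "l \<in> C" "(min i j, max i j) = (min i l, max i l)" by blast
          then show False using iC j unfolding min_max_eq_iff by auto
        qed
        then show "entry r i j * z j = entry r' i j * z j" using eq by (simp add: entry_def)
      qed
      ultimately show ?thesis using rprob_walk_le_lazy_prob[OF fC, of ?e ?c z "w i" r] by simp
    qed
    have "rprob U (\<lambda>r. ?G r \<and> ?E r) r \<le> lazy_prob C z 0 * rprob U ?G r"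
      by (rule rprob_conj_le[OF assms(1) _ ign step]) (use insert.prems sub in auto)
    also have "\<dots> \<le> lazy_prob C z 0 * (lazy_prob C z 0 ^ card A * rprob U G r)"
    proof (intro mult_left_mono insert.IH)
      show "A \<subseteq> {..<m}" using insert.prems by auto
      show "A \<inter> C = {}" by (rule AC)
      show "edges A C \<subseteq> U" using insert.prems sub by auto
      show "ignores (edges A C) G" by (rule ignores_mono[OF insert.prems(4) sub(2)])
    qed (use lazy_prob_0_pos[of C z] in simp)
    finally show ?case
      using insert.hyps by (simp add: ball_simps conj_ac mult_ac cong: conj_cong)
  qed
qed

lemma rprob_rows':
  assumes "finite U" "A \<subseteq> {..<m}" "C \<subseteq> {..<m}" "A \<inter> C = {}" "pairs m \<subseteq> U"
  shows "rprob U (\<lambda>r. \<forall>i\<in>A. [rowsum r m z i = w i] (mod int p)) r \<le> lazy_prob C z 0 ^ card A"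
proof -
  have "edges A C \<subseteq> U" using assms edges_pairs by blast
  moreover have "ignores (edges A C) (\<lambda>_. True)" by (simp add: ignores_def)
  ultimately show ?thesis
    using rprob_rows[OF assms(1-4), of "\<lambda>_. True"] assms(1) by simp
qed

text \<open>At each frequency the characteristic function of the union is the product of those of the parts, which the inequality of
arithmetic and geometric means bounds by the average of their powers. Some part is at least as good as the average.\<close>
lemma lazy_prob_UN_le_power:
  assumes "finite K" "K \<noteq> {}" "\<And>s. s \<in> K \<Longrightarrow> finite (T s)" "disjoint_family_on T K"
  obtains s where "s \<in> K" "lazy_prob (\<Union>s\<in>K. T s) v 0 \<le> (\<Sum>\<xi>\<in>{0..<int p}. lazy_fourier (T s) v \<xi> ^ card K) / p"
proof -
  let ?k = "card K"
  let ?M = "\<lambda>s. (\<Sum>\<xi>\<in>{0..<int p}. lazy_fourier (T s) v \<xi> ^ ?k) / p"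
  let ?U = "\<Union>s\<in>K. T s"
  have k: "0 < ?k" using assms by (simp add: card_gt_0_iff)
  have amgm: "lazy_fourier ?U v \<xi> \<le> (\<Sum>s\<in>K. lazy_fourier (T s) v \<xi> ^ ?k / ?k)" for \<xi>
  proof -
    have "lazy_fourier ?U v \<xi> = (\<Prod>s\<in>K. lazy_fourier (T s) v \<xi>)"
      unfolding lazy_fourier_def using assms
      by (intro prod.UNION_disjoint) (auto simp: disjoint_family_on_def)
    also have "\<dots> = (\<Prod>s\<in>K. lazy_fourier (T s) v \<xi> ^ ?k) powr (1 / ?k)"
    proof -
      have "a = (a ^ ?k) powr (1 / ?k)" if "0 \<le> a" for a :: real
      proof (cases "a = 0")
        case False
        then have "(a ^ ?k) powr (1 / ?k) = (a powr ?k) powr (1 / ?k)" using that by (simp add: powr_realpow)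
        then show ?thesis using False that k by (simp add: powr_powr)
      qed (use k in simp)
      from this[of "\<Prod>s\<in>K. lazy_fourier (T s) v \<xi>"] show ?thesis
        by (simp add: prod_nonneg lazy_fourier_nonneg prod_power_distrib)
    qed
    also have "\<dots> \<le> (\<Sum>s\<in>K. lazy_fourier (T s) v \<xi> ^ ?k / ?k)"
      using assms by (intro arith_geom_mean) (auto simp: lazy_fourier_nonneg)
    finally show ?thesis .
  qed
  have "\<exists>s\<in>K. lazy_prob ?U v 0 \<le> ?M s"
  proof (rule ccontr)
    assume "\<not> (\<exists>s\<in>K. lazy_prob ?U v 0 \<le> ?M s)"
    then have less: "?M s < lazy_prob ?U v 0" if "s \<in> K" for s
      using that by auto
    have "lazy_prob ?U v 0 \<le> (\<Sum>\<xi>\<in>{0..<int p}. \<Sum>s\<in>K. lazy_fourier (T s) v \<xi> ^ ?k / ?k) / p"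
      unfolding lazy_prob_0 by (intro divide_right_mono sum_mono amgm) auto
    also have "\<dots> = (\<Sum>s\<in>K. ?M s) / ?k"
      by (subst sum.swap) (simp add: sum_divide_distrib mult.commute)
    also have "\<dots> < (\<Sum>s\<in>K. lazy_prob ?U v 0) / ?k"
      using less assms k by (intro divide_strict_right_mono sum_strict_mono) auto
    also have "\<dots> = lazy_prob ?U v 0" using k by simp
    finally show False by simp
  qed
  then show ?thesis using that by blast
qed

text \<open>The bound \<open>2 / p\<close> absorbs the term \<open>1 / p\<close> of \<open>repeated_walk_spreads\<close>; this is the reason for the threshold in the
definition of structured vectors.\<close>
lemma concentrated_union:
  fixes j :: nat
  defines "k \<equiv> 1 + 8 * j * 4 ^ j"
  assumes fin: "\<And>s. s < k \<Longrightarrow> finite (T s)" and disj: "disjoint_family_on T {..<k}"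
    and nz: "\<And>s. s < k \<Longrightarrow> \<exists>i\<in>T s. \<not> int p dvd v i"
    and conc: "2 / p \<le> lazy_prob (\<Union>s<k. T s) v 0"
  obtains s where "s < k" "lazy_prob (\<Union>s<k. T s) v 0 \<le> 6 * (2 / 3) ^ j * lazy_prob (T s) v 0"
proof -
  have "{..<k} \<noteq> {}" by (auto simp: k_def lessThan_empty_iff)
  then obtain s where s: "s < k" "lazy_prob (\<Union>s<k. T s) v 0 \<le> (\<Sum>\<xi>\<in>{0..<int p}. lazy_fourier (T s) v \<xi> ^ k) / p"
    using lazy_prob_UN_le_power[of "{..<k}" T v] fin disj by auto
  obtain i where i: "i \<in> T s" "\<not> int p dvd v i" using nz s by blast
  from repeated_walk_spreads[of "T s" i v j, OF fin[OF s(1)] i]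
  have "(\<Sum>\<xi>\<in>{0..<int p}. lazy_fourier (T s) v \<xi> ^ k) / p \<le> 1 / p + 3 * (2 / 3) ^ j * lazy_prob (T s) v 0"
    by (simp only: k_def)
  then have "lazy_prob (\<Union>s<k. T s) v 0 \<le> 6 * (2 / 3) ^ j * lazy_prob (T s) v 0"
  proof -
    assume "(\<Sum>\<xi>\<in>{0..<int p}. lazy_fourier (T s) v \<xi> ^ k) / p \<le> 1 / p + 3 * (2 / 3) ^ j * lazy_prob (T s) v 0"
    moreover have "2 / real p = 2 * (1 / real p)" by simp
    ultimately show ?thesis using s(2) conc by linarith
  qed
  with s(1) show ?thesis by (rule that)
qed

end

section \<open>Structured solutions are unlikely\<close>

text \<open>A set of at most \<open>s\<close> elements is the range of a list of length \<open>s\<close>, with \<open>m\<close> as a filler.\<close>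
lemma card_small_subsets: "card {V. V \<subseteq> {..<m} \<and> card V \<le> s} \<le> (m + 1) ^ s"
proof -
  let ?F = "PiE {..<s} (\<lambda>_. {..m})"
  have "{V. V \<subseteq> {..<m} \<and> card V \<le> s} \<subseteq> (\<lambda>f. f ` {..<s} \<inter> {..<m}) ` ?F"
  proof
    fix V assume "V \<in> {V. V \<subseteq> {..<m} \<and> card V \<le> s}"
    then have V: "V \<subseteq> {..<m}" "card V \<le> s" by auto
    then have "finite V" using finite_subset by blast
    then obtain h where h: "bij_betw h {0..<card V} V" using ex_bij_betw_nat_finite by blast
    let ?f = "\<lambda>i\<in>{..<s}. if i < card V then h i else m"
    have hV: "h ` {0..<card V} = V" using h by (simp add: bij_betw_def)
    have eq: "?f ` {..<s} \<inter> {..<m} = V"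
    proof
      show "?f ` {..<s} \<inter> {..<m} \<subseteq> V" using hV by (auto split: if_splits)
      show "V \<subseteq> ?f ` {..<s} \<inter> {..<m}"
      proof
        fix x assume x: "x \<in> V"
        then obtain i where "i < card V" "x = h i" using hV by (metis atLeastLessThan_iff imageE)
        then show "x \<in> ?f ` {..<s} \<inter> {..<m}" using V x by (auto intro!: image_eqI[of _ _ i])
      qed
    qed
    have mem: "?f \<in> ?F"
    proof -
      have "h i \<le> m" if "i < card V" for i
      proof -
        have "h i \<in> V" using that hV by auto
        then show ?thesis using V by auto
      qed
      then show ?thesis by auto
    qed
    show "V \<in> (\<lambda>f. f ` {..<s} \<inter> {..<m}) ` ?F"
      by (rule image_eqI[where x = ?f]) (simp_all only: eq mem)
  qed
  then have "card {V. V \<subseteq> {..<m} \<and> card V \<le> s} \<le> card ((\<lambda>f. f ` {..<s} \<inter> {..<m}) ` ?F)"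
    by (intro card_mono) (auto intro: finite_PiE)
  also have "\<dots> \<le> card ?F" by (intro card_image_le finite_PiE) auto
  also have "\<dots> = (m + 1) ^ s" by (simp add: card_PiE)
  finally show ?thesis .
qed

context odd_prime
begin

definition residue_vecs :: "nat \<Rightarrow> (nat \<Rightarrow> int) set" where
  "residue_vecs m = PiE {..<m} (\<lambda>_. {0..<int p})"

lemma finite_residue_vecs: "finite (residue_vecs m)"
  by (simp add: residue_vecs_def finite_PiE)

lemma lazy_prob_cong_on: "(\<And>i. i \<in> T \<Longrightarrow> v i = v' i) \<Longrightarrow> lazy_prob T v x = lazy_prob T v' x"
  by (rule lazy_prob_vec_cong) simp

lemma one_le_two_div_lazy_prob: "1 \<le> 2 / lazy_prob T v 0"
  using lazy_prob_0_pos[of T v] lazy_prob_0_le_1[of T v] by (simp add: le_divide_eq)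

text \<open>Given the values on \<open>T\<close>, there are at most \<open>(2 / L) ^ s\<close> vectors, where \<open>L = lazy_prob T z 0\<close>, and each meets the
\<open>m - card T\<close> row conditions outside \<open>T\<close> with probability \<open>L\<close> per row. Since \<open>L \<le> (7/8) ^ card T\<close>,
the surplus of rows beats the \<open>p ^ card T\<close> choices on \<open>T\<close>, whatever the size of \<open>T\<close>.\<close>
lemma sparse_fixed_support:
  assumes U: "finite U" "pairs m \<subseteq> U"
    and T: "T \<subseteq> V" "V \<subseteq> {..<m}" "T \<noteq> {}" "card V \<le> s" "2 * s \<le> m"
    and p_small: "p * (7 / 8) ^ (m - 2 * s) \<le> (1 :: real)"
  shows "rprob U (\<lambda>r. \<exists>z\<in>residue_vecs m. (\<forall>i<m. i \<notin> V \<longrightarrow> z i = 0) \<and> lazy_prob T z 0 \<le> (7 / 8) ^ card T \<and>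
      (\<forall>i\<in>V - T. z i \<in> nbrs T z) \<and> (\<forall>i<m. [rowsum r m z i = w i] (mod int p))) r
    \<le> 2 ^ s * (p * (7 / 8) ^ (m - 2 * s))"
proof -
  let ?Y = "PiE T (\<lambda>_. {0..<int p})"
  let ?C = "\<lambda>y. PiE {..<m} (\<lambda>i. if i \<in> T then {y i} else if i \<in> V then nbrs T y else {0})"
  let ?E = "\<lambda>y r. \<exists>z\<in>?C y. lazy_prob T y 0 \<le> (7 / 8) ^ card T \<and> (\<forall>i\<in>{..<m} - T. [rowsum r m z i = w i] (mod int p))"
  let ?K = "2 ^ s * ((7 / 8 :: real) ^ (m - 2 * s)) ^ card T"
  have fV: "finite V" by (rule finite_subset[OF T(2)]) simp
  have fT: "finite T" by (rule finite_subset[OF T(1) fV])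
  have tm: "T \<subseteq> {..<m}" using T by auto
  have ts: "card T \<le> s" using card_mono[OF fV T(1)] T(4) by simp
  have "rprob U (\<lambda>r. \<exists>z\<in>residue_vecs m. (\<forall>i<m. i \<notin> V \<longrightarrow> z i = 0) \<and> lazy_prob T z 0 \<le> (7 / 8) ^ card T \<and>
      (\<forall>i\<in>V - T. z i \<in> nbrs T z) \<and> (\<forall>i<m. [rowsum r m z i = w i] (mod int p))) r \<le> real (card ?Y) * ?K"
  proof (rule rprob_union_bound[where E' = ?E])
    show "finite ?Y" using fT by (intro finite_PiE) auto
    fix r
    assume "\<exists>z\<in>residue_vecs m. (\<forall>i<m. i \<notin> V \<longrightarrow> z i = 0) \<and> lazy_prob T z 0 \<le> (7 / 8) ^ card T \<and>
      (\<forall>i\<in>V - T. z i \<in> nbrs T z) \<and> (\<forall>i<m. [rowsum r m z i = w i] (mod int p))"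
    then obtain z where z: "z \<in> residue_vecs m" "\<forall>i<m. i \<notin> V \<longrightarrow> z i = 0" "lazy_prob T z 0 \<le> (7 / 8) ^ card T"
      "\<forall>i\<in>V - T. z i \<in> nbrs T z" "\<forall>i<m. [rowsum r m z i = w i] (mod int p)" by blast
    let ?y = "restrict z T"
    have nb: "nbrs T ?y = nbrs T z" by (rule nbrs_cong) simp
    have lzy: "lazy_prob T ?y 0 = lazy_prob T z 0" by (rule lazy_prob_cong_on) simp
    have "?y \<in> ?Y" using z(1) tm by (auto simp: residue_vecs_def PiE_iff)
    moreover have "z \<in> ?C ?y" using z(1,2,4) unfolding nb by (auto simp: residue_vecs_def PiE_iff)
    ultimately show "\<exists>y\<in>?Y. ?E y r" using z(3,5) lzy by (intro bexI[of _ ?y] bexI[of _ z]) auto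
  next
    fix y assume y: "y \<in> ?Y"
    let ?L = "lazy_prob T y 0"
    show "rprob U (?E y) r \<le> ?K"
    proof (cases "?L \<le> (7 / 8) ^ card T")
      case False
      then show ?thesis by (simp add: ravg_const[OF U(1)])
    next
      case True
      show ?thesis
      proof (rule rprob_ex_le[where c = "(2 / ?L) ^ s" and g = "?L ^ (m - card T)"])
        show "finite (?C y)" by (intro finite_PiE) (auto simp: finite_nbrs)
        show "0 \<le> ?L ^ (m - card T)" using lazy_prob_0_pos[of T y] by simp
      next
        fix z assume z: "z \<in> ?C y"
        have "lazy_prob T z 0 = ?L"
        proof (rule lazy_prob_cong_on)
          fix i assume i: "i \<in> T"
          then have "i \<in> {..<m}" using tm by auto
          from PiE_mem[OF z this] i show "z i = y i" by simp
        qed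
        then show "rprob U (\<lambda>r. \<forall>i\<in>{..<m} - T. [rowsum r m z i = w i] (mod int p)) r \<le> ?L ^ (m - card T)"
          using rprob_rows'[OF U(1), of "{..<m} - T" m T z w r] tm U(2) fT
          by (simp add: card_Diff_subset Int_commute)
      next
        have "real (card (?C y)) = (\<Prod>i<m. real (card (if i \<in> T then {y i} else if i \<in> V then nbrs T y else {0})))"
          by (simp add: card_PiE)
        also have "\<dots> = (\<Prod>i\<in>V - T. real (card (nbrs T y)))"
          using T(2) by (intro prod.mono_neutral_cong_right) auto
        also have "\<dots> = real (card (nbrs T y)) ^ card (V - T)" by simp
        also have "\<dots> \<le> (2 / ?L) ^ card (V - T)"
          using card_nbrs[OF fT] by (intro power_mono) auto
        also have "\<dots> \<le> (2 / ?L) ^ s"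
          using T(4) card_mono[OF fV, of "V - T"] by (intro power_increasing one_le_two_div_lazy_prob) auto
        finally show "real (card (?C y)) \<le> (2 / ?L) ^ s" .
      next
        have L0: "0 < ?L" by (rule lazy_prob_0_pos)
        \<comment> \<open>at most \<open>s\<close> neighbour factors cancel against as many rows\<close>
        have "(2 / ?L) ^ s * ?L ^ (m - card T) = 2 ^ s * ?L ^ (m - card T - s)"
        proof -
          have "?L ^ (m - card T) = ?L ^ s * ?L ^ (m - card T - s)"
            using T(5) ts by (simp add: power_add[symmetric])
          then show ?thesis using L0 by (simp add: power_divide)
        qed
        also have "\<dots> \<le> 2 ^ s * ?L ^ (m - 2 * s)"
        proof (intro mult_left_mono power_decreasing lazy_prob_0_le_1)
          show "m - 2 * s \<le> m - card T - s" using ts by linarith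
        qed (use L0 in auto)
        also have "\<dots> \<le> 2 ^ s * ((7 / 8) ^ card T) ^ (m - 2 * s)"
          using True L0 by (intro mult_left_mono power_mono) auto
        also have "\<dots> = ?K" by (simp add: power_mult[symmetric] mult.commute)
        finally show "(2 / ?L) ^ s * ?L ^ (m - card T) \<le> ?K" .
      qed
    qed
  qed
  also have "real (card ?Y) * ?K = 2 ^ s * (p * (7 / 8) ^ (m - 2 * s)) ^ card T"
    using fT by (simp add: card_PiE power_mult_distrib)
  also have "\<dots> \<le> 2 ^ s * (p * (7 / 8) ^ (m - 2 * s)) ^ 1"
    using p_small fT T(3) by (intro mult_left_mono power_decreasing) (auto simp: Suc_le_eq card_gt_0_iff)
  finally show ?thesis by simp
qed

text \<open>The factor \<open>4 ^ s\<close> collects \<open>2 ^ s\<close> choices of the container inside the support and \<open>2 ^ s\<close> from the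
neighbour sets.\<close>
lemma sparse_solutions:
  assumes U: "finite U" "pairs m \<subseteq> U"
    and s: "2 * s \<le> m"
    and p_small: "p * (7 / 8) ^ (m - 2 * s) \<le> (1 :: real)"
  shows "rprob U (\<lambda>r. \<exists>z\<in>residue_vecs m. (\<exists>i<m. z i \<noteq> 0) \<and> card {i. i < m \<and> z i \<noteq> 0} \<le> s \<and>
      (\<forall>i<m. [rowsum r m z i = w i] (mod int p))) r
    \<le> (4 * (real m + 1)) ^ s * (p * (7 / 8) ^ (m - 2 * s))"
proof -
  let ?rows = "\<lambda>r z. \<forall>i<m. [rowsum r m z i = w i] (mod int p)"
  let ?F = "\<lambda>V T r. \<exists>z\<in>residue_vecs m. (\<forall>i<m. i \<notin> V \<longrightarrow> z i = 0) \<and> lazy_prob T z 0 \<le> (7 / 8) ^ card T \<and>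
      (\<forall>i\<in>V - T. z i \<in> nbrs T z) \<and> ?rows r z"
  let ?Vs = "{V. V \<subseteq> {..<m} \<and> card V \<le> s}"
  let ?Q = "2 ^ s * (p * (7 / 8) ^ (m - 2 * s)) :: real"
  have fVs: "finite ?Vs" by simp
  have "rprob U (\<lambda>r. \<exists>z\<in>residue_vecs m. (\<exists>i<m. z i \<noteq> 0) \<and> card {i. i < m \<and> z i \<noteq> 0} \<le> s \<and> ?rows r z) r
      \<le> real (card ?Vs) * (2 ^ s * ?Q)"
  proof (rule rprob_union_bound[where E' = "\<lambda>V r. \<exists>T\<in>Pow V - {{}}. ?F V T r"])
    fix r
    assume "\<exists>z\<in>residue_vecs m. (\<exists>i<m. z i \<noteq> 0) \<and> card {i. i < m \<and> z i \<noteq> 0} \<le> s \<and> ?rows r z"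
    then obtain z where z: "z \<in> residue_vecs m" "\<exists>i<m. z i \<noteq> 0" "card {i. i < m \<and> z i \<noteq> 0} \<le> s" "?rows r z"
      by blast
    let ?V = "{i. i < m \<and> z i \<noteq> 0}"
    have mem: "z i \<in> {0..<int p}" if "i \<in> ?V" for i
      using z(1) that by (auto simp: residue_vecs_def PiE_iff)
    obtain T where T: "T \<subseteq> ?V" "lazy_prob T z 0 \<le> (7 / 8) ^ card T" "\<And>i. i \<in> ?V - T \<Longrightarrow> z i \<in> nbrs T z"
      "(\<exists>i\<in>?V. z i \<noteq> 0) \<longrightarrow> (\<exists>i\<in>T. z i \<noteq> 0)"
      using container[of ?V z] mem by auto
    have "T \<noteq> {}" using T(4) z(2) by auto
    then have "T \<in> Pow ?V - {{}}" using T(1) by blast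
    moreover have "?F ?V T r"
      by (rule bexI[OF _ z(1)]) (use T z(4) in auto)
    moreover have "?V \<in> ?Vs" using z(3) by auto
    ultimately show "\<exists>V\<in>?Vs. \<exists>T\<in>Pow V - {{}}. ?F V T r" by blast
  next
    fix V assume V: "V \<in> ?Vs"
    then have fV: "finite V" by (auto intro: finite_subset)
    have "rprob U (\<lambda>r. \<exists>T\<in>Pow V - {{}}. ?F V T r) r \<le> real (card (Pow V - {{}})) * ?Q"
    proof (rule rprob_union_bound[where E' = "?F V"])
      show "finite (Pow V - {{}})" using fV by simp
      fix T assume T: "T \<in> Pow V - {{}}"
      show "rprob U (?F V T) r \<le> ?Q"
        by (rule sparse_fixed_support[OF U _ _ _ _ s p_small]) (use T V in auto)
    qed
    also have "\<dots> \<le> 2 ^ s * ?Q"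
    proof (rule mult_right_mono)
      have "card (Pow V - {{}}) \<le> card (Pow V)" using fV by (intro card_mono) auto
      also have "\<dots> \<le> 2 ^ s" using V fV by (simp add: card_Pow)
      finally show "real (card (Pow V - {{}})) \<le> 2 ^ s" by (metis of_nat_le_iff of_nat_numeral of_nat_power)
    qed simp
    finally show "rprob U (\<lambda>r. \<exists>T\<in>Pow V - {{}}. ?F V T r) r \<le> 2 ^ s * ?Q" .
  qed (rule fVs)
  also have "\<dots> \<le> (real m + 1) ^ s * (2 ^ s * ?Q)"
  proof (rule mult_right_mono)
    have "real (card ?Vs) \<le> real ((m + 1) ^ s)" by (simp only: of_nat_le_iff card_small_subsets)
    then show "real (card ?Vs) \<le> (real m + 1) ^ s" by (simp add: add.commute)
  qed simp
  also have "\<dots> = (4 * (real m + 1)) ^ s * (p * (7 / 8) ^ (m - 2 * s))"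
  proof -
    have "(4::real) ^ s = 2 ^ s * 2 ^ s" by (simp add: power_mult_distrib[symmetric])
    then show ?thesis unfolding power_mult_distrib by (simp only: mult_ac)
  qed
  finally show ?thesis .
qed

text \<open>Apply \<open>container\<close> again and again to what is left of \<open>J\<close>. As long as nonzero entries remain, the next set
contains one of them; no set has more than \<open>D\<close> elements, because its return probability is at least \<open>2 / p\<close>.\<close>
lemma disjoint_containers:
  assumes J: "finite J" "\<And>i. i \<in> J \<Longrightarrow> z i \<in> {0..<int p}"
    and D: "p \<le> (8 / 7 :: real) ^ D" and conc: "2 / p \<le> lazy_prob J z 0"
    and supp: "k * D \<le> card {i \<in> J. z i \<noteq> 0}"
  shows "\<exists>T. \<forall>s<k. T s \<subseteq> J - (\<Union>r<s. T r) \<and> card (T s) \<le> D \<and> (\<exists>i\<in>T s. z i \<noteq> 0) \<and>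
    (\<forall>i\<in>J - (\<Union>r\<le>s. T r). z i \<in> nbrs (T s) z)"
  using supp
proof (induction k)
  case 0
  then show ?case by simp
next
  case (Suc k)
  let ?P = "\<lambda>T s. T s \<subseteq> J - (\<Union>r<s. T r) \<and> card (T s) \<le> D \<and> (\<exists>i\<in>T s. z i \<noteq> 0) \<and>
    (\<forall>i\<in>J - (\<Union>r\<le>s. T r). z i \<in> nbrs (T s) z)"
  have "k * D \<le> card {i \<in> J. z i \<noteq> 0}" using Suc.prems by simp
  then have "\<exists>T. \<forall>s<k. ?P T s" by (rule Suc.IH)
  then obtain T where T': "\<forall>s<k. ?P T s" by (rule exE)
  have T: "?P T s" if s: "s < k" for s
    by (rule mp[OF spec[where x = s, OF T'] s])
  let ?S = "\<Union>r<k. T r"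
  have "D \<noteq> 0"
  proof
    assume "D = 0"
    then show False using D p_gt_2 by simp
  qed
  have "card ?S \<le> (\<Sum>r<k. card (T r))" by (intro card_UN_le) simp
  also have "\<dots> \<le> (\<Sum>r<k. D)" using T by (intro sum_mono) auto
  finally have "card ?S < card {i \<in> J. z i \<noteq> 0}" using Suc.prems \<open>D \<noteq> 0\<close> by simp
  moreover have "finite ?S"
  proof -
    have "?S \<subseteq> J" using T by blast
    then show ?thesis using J(1) by (rule finite_subset)
  qed
  ultimately have "\<not> {i \<in> J. z i \<noteq> 0} \<subseteq> ?S" using card_mono leD by blast
  then have ne: "\<exists>i\<in>J - ?S. z i \<noteq> 0" by auto
  obtain R where R: "R \<subseteq> J - ?S" "lazy_prob R z 0 \<le> (7 / 8) ^ card R" "\<And>i. i \<in> J - ?S - R \<Longrightarrow> z i \<in> nbrs R z"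
      "(\<exists>i\<in>J - ?S. z i \<noteq> 0) \<longrightarrow> (\<exists>i\<in>R. z i \<noteq> 0)"
    using container[of "J - ?S" z] J by auto
  have "card R \<le> D"
  proof (rule ccontr)
    assume "\<not> card R \<le> D"
    then have "(7 / 8 :: real) ^ card R \<le> (7 / 8) ^ D" by (intro power_decreasing) auto
    also have "\<dots> = 1 / (8 / 7) ^ D" by (simp add: power_divide)
    also have "\<dots> \<le> 1 / p" using D p_pos by (intro divide_left_mono) auto
    also have "\<dots> < 2 / p" using p_pos by (simp add: divide_strict_right_mono)
    also have "\<dots> \<le> lazy_prob J z 0" by (rule conc)
    also have "\<dots> \<le> lazy_prob R z 0" using R(1) by (intro lazy_prob_0_antimono[OF J(1)]) blast
    finally show False using R(2) by simp
  qed
  \<comment> \<open>append the new container to the sequence\<close>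
  let ?T = "\<lambda>s. if s < k then T s else R"
  have un: "(\<Union>r<s. ?T r) = (\<Union>r<s. T r)" if "s \<le> k" for s using that by (intro SUP_cong) auto
  have PT: "?P ?T s" if "s < Suc k" for s
  proof (cases "s < k")
    case True
    have "(\<Union>r\<le>s. ?T r) = (\<Union>r\<le>s. T r)" using True by (intro SUP_cong) auto
    then show ?thesis using T[OF True] un[of s] True by simp
  next
    case False
    then have s: "s = k" using that by simp
    have "(\<Union>r\<le>k. ?T r) = ?S \<union> R"
      unfolding lessThan_Suc_atMost[symmetric] lessThan_Suc using un[of k] by auto
    then show ?thesis using R ne \<open>card R \<le> D\<close> un[of k] unfolding s by auto
  qed
  show ?case
    by (rule exI[where x = ?T], intro allI impI) (rule PT)
qed

text \<open>What the union bound has to know about a concentrated vector: \<open>Q\<close> is the part for which \<open>concentrated_union\<close> gains, and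
it is a container for everything outside \<open>S\<close>. The coordinates in \<open>S\<close> are too many to be chosen freely; the first
container \<open>P\<close> takes care of them, without gain.\<close>
lemma structured_vector:
  fixes j :: nat
  defines "k \<equiv> 1 + 8 * j * 4 ^ j"
  assumes J: "finite J" "\<And>i. i \<in> J \<Longrightarrow> z i \<in> {0..<int p}"
    and D: "p \<le> (8 / 7 :: real) ^ D" and conc: "2 / p \<le> lazy_prob J z 0"
    and supp: "k * D \<le> card {i \<in> J. z i \<noteq> 0}"
  obtains S P Q where "P \<subseteq> S" "Q \<subseteq> S" "S \<subseteq> J" "card P \<le> D" "card Q \<le> D" "card S \<le> k * D"
    "\<forall>i\<in>S - P. z i \<in> nbrs P z" "\<forall>i\<in>J - S. z i \<in> nbrs Q z"
    "lazy_prob S z 0 \<le> 6 * (2 / 3) ^ j * lazy_prob Q z 0"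
proof -
  from disjoint_containers[OF J D conc supp]
  obtain T where T': "\<forall>s<k. T s \<subseteq> J - (\<Union>r<s. T r) \<and> card (T s) \<le> D \<and> (\<exists>i\<in>T s. z i \<noteq> 0) \<and>
    (\<forall>i\<in>J - (\<Union>r\<le>s. T r). z i \<in> nbrs (T s) z)" by (rule exE)
  have T: "T s \<subseteq> J - (\<Union>r<s. T r) \<and> card (T s) \<le> D \<and> (\<exists>i\<in>T s. z i \<noteq> 0) \<and>
    (\<forall>i\<in>J - (\<Union>r\<le>s. T r). z i \<in> nbrs (T s) z)" if s: "s < k" for s
    by (rule mp[OF spec[where x = s, OF T'] s])
  let ?S = "\<Union>s<k. T s"
  have k0: "0 < k" by (simp add: k_def)
  have SJ: "?S \<subseteq> J" using T by blast
  have fT: "finite (T s)" if "s < k" for s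
    using SJ that by (intro finite_subset[OF _ J(1)]) auto
  have disj: "disjoint_family_on T {..<k}"
    unfolding disjoint_family_on_def
  proof (intro ballI impI)
    fix a b assume ab: "a \<in> {..<k}" "b \<in> {..<k}" "a \<noteq> b"
    have aux: "T a \<inter> T b = {}" if "a < b" "b < k" for a b
      using T[OF that(2)] that(1) by blast
    show "T a \<inter> T b = {}"
    proof (cases "a < b")
      case True
      then show ?thesis using aux[of a b] ab by simp
    next
      case False
      then show ?thesis using aux[of b a] ab by auto
    qed
  qed
  have nz: "\<exists>i\<in>T s. \<not> int p dvd z i" if s: "s < k" for s
  proof -
    obtain i where i: "i \<in> T s" "z i \<noteq> 0" using T[OF s] by blast
    moreover have "i \<in> J" using i SJ s by blast
    ultimately have "\<not> int p dvd z i" using J(2)[of i] zdvd_not_zless[of "z i" "int p"] by auto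
    with i show ?thesis by blast
  qed
  have "2 / p \<le> lazy_prob ?S z 0"
    using conc lazy_prob_0_antimono[OF J(1) SJ, of z] by simp
  then obtain s where s: "s < k" "lazy_prob ?S z 0 \<le> 6 * (2 / 3) ^ j * lazy_prob (T s) z 0"
    using concentrated_union[of j T z, folded k_def, OF fT disj nz] by blast
  show ?thesis
  proof (rule that[of "T 0" ?S "T s"])
    show "T 0 \<subseteq> ?S" using k0 by blast
    show "T s \<subseteq> ?S" using s by blast
    show "?S \<subseteq> J" by (rule SJ)
    show "card (T 0) \<le> D" "card (T s) \<le> D" using T[OF k0] T[OF s(1)] by auto
    have "card ?S \<le> (\<Sum>r<k. card (T r))" by (intro card_UN_le) simp
    also have "\<dots> \<le> (\<Sum>r<k. D)" using T by (intro sum_mono) auto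
    finally show "card ?S \<le> k * D" by simp
    show "\<forall>i\<in>?S - T 0. z i \<in> nbrs (T 0) z"
      using T[OF k0] SJ by auto
    show "\<forall>i\<in>J - ?S. z i \<in> nbrs (T s) z"
    proof
      fix i assume i: "i \<in> J - ?S"
      have "i \<notin> (\<Union>r\<le>s. T r)" using i s(1) by auto
      then show "z i \<in> nbrs (T s) z" using T[OF s(1)] i by blast
    qed
    show "lazy_prob ?S z 0 \<le> 6 * (2 / 3) ^ j * lazy_prob (T s) z 0" by (rule s(2))
  qed
qed

text \<open>Choose \<open>z\<close> freely on the first \<open>l\<close> coordinates, on \<open>P\<close> and on \<open>Q\<close>; this costs \<open>p ^ (l + 2 * D)\<close>. A coordinate in
\<open>S - P\<close> has at most \<open>2 / lazy_prob P z 0\<close> values and its row holds with probability \<open>lazy_prob P z 0\<close> (using the columns \<open>P\<close>). A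
coordinate outside \<open>S\<close> has at most \<open>2 / lazy_prob Q z 0\<close> values and its row holds with probability
\<open>lazy_prob S z 0 \<le> 6 * (2 / 3) ^ j * lazy_prob Q z 0\<close> (using the columns \<open>S\<close>). The gain is the factor
\<open>12 * (2 / 3) ^ j\<close> for each of the latter.\<close>
lemma dense_fixed_structure:
  fixes j :: nat
  assumes U: "finite U" "pairs m \<subseteq> U"
    and sub: "P \<subseteq> S" "Q \<subseteq> S" "S \<subseteq> {l..<m}" and card: "card P \<le> D" "card Q \<le> D" "card S \<le> N"
    and small: "12 * (2 / 3) ^ j \<le> (1 :: real)" and lm: "l \<le> m"
  shows "rprob U (\<lambda>r. \<exists>z\<in>residue_vecs m. (\<forall>i\<in>S - P. z i \<in> nbrs P z) \<and> (\<forall>i\<in>{l..<m} - S. z i \<in> nbrs Q z) \<and>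
      lazy_prob S z 0 \<le> 6 * (2 / 3) ^ j * lazy_prob Q z 0 \<and> (\<forall>i<m. [rowsum r m z i = w i] (mod int p))) r
    \<le> p ^ (l + 2 * D) * (2 ^ m * (12 * (2 / 3) ^ j) ^ (m - l - N))"
proof -
  let ?I = "{..<l}" and ?J = "{l..<m}"
  let ?K = "?I \<union> P \<union> Q"
  let ?q = "12 * (2 / 3) ^ j :: real"
  let ?Y = "PiE ?K (\<lambda>_. {0..<int p})"
  let ?C = "\<lambda>y. PiE {..<m} (\<lambda>i. if i \<in> ?K then {y i} else if i \<in> S then nbrs P y else nbrs Q y)"
  let ?conc = "\<lambda>z. lazy_prob S z 0 \<le> 6 * (2 / 3) ^ j * lazy_prob Q z 0"
  let ?rows = "\<lambda>r z. (\<forall>i\<in>?J - S. [rowsum r m z i = w i] (mod int p)) \<and> (\<forall>i\<in>S - P. [rowsum r m z i = w i] (mod int p))"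
  let ?Q = "2 ^ m * ?q ^ (m - l - N)"
  have fS: "finite S" by (rule finite_subset[OF sub(3)]) simp
  have fP: "finite P" "finite Q" using sub fS by (auto intro: finite_subset)
  have Sm: "S \<subseteq> {..<m}" and Km: "?K \<subseteq> {..<m}" using sub lm by auto
  have main: "rprob U (\<lambda>r. \<exists>z\<in>residue_vecs m. (\<forall>i\<in>S - P. z i \<in> nbrs P z) \<and> (\<forall>i\<in>?J - S. z i \<in> nbrs Q z) \<and>
      ?conc z \<and> (\<forall>i<m. [rowsum r m z i = w i] (mod int p))) r \<le> real (card ?Y) * ?Q"
  proof (rule rprob_union_bound[where E' = "\<lambda>y r. \<exists>z\<in>?C y. ?conc z \<and> ?rows r z"])
    show "finite ?Y" using fP by (intro finite_PiE) auto
    fix r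
    assume "\<exists>z\<in>residue_vecs m. (\<forall>i\<in>S - P. z i \<in> nbrs P z) \<and> (\<forall>i\<in>?J - S. z i \<in> nbrs Q z) \<and>
      ?conc z \<and> (\<forall>i<m. [rowsum r m z i = w i] (mod int p))"
    then obtain z where z: "z \<in> residue_vecs m" "\<forall>i\<in>S - P. z i \<in> nbrs P z" "\<forall>i\<in>?J - S. z i \<in> nbrs Q z"
      "?conc z" "\<forall>i<m. [rowsum r m z i = w i] (mod int p)" by blast
    let ?y = "restrict z ?K"
    have nb: "nbrs P ?y = nbrs P z" "nbrs Q ?y = nbrs Q z" by (auto intro!: nbrs_cong)
    have "?y \<in> ?Y" using z(1) Km by (auto simp: residue_vecs_def PiE_iff)
    moreover have "z \<in> ?C ?y" using z(1,2,3) unfolding nb by (auto simp: residue_vecs_def PiE_iff)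
    moreover have "?rows r z" using z(5) Sm by auto
    ultimately show "\<exists>y\<in>?Y. \<exists>z\<in>?C y. ?conc z \<and> ?rows r z" using z(4) by blast
  next
    fix y assume y: "y \<in> ?Y"
    let ?A = "lazy_prob P y 0" and ?B = "lazy_prob Q y 0"
    let ?a = "card (S - P)" and ?b = "card (?J - S)"
    have pos: "0 < ?A" "0 < ?B" by (rule lazy_prob_0_pos)+
    show "rprob U (\<lambda>r. \<exists>z\<in>?C y. ?conc z \<and> ?rows r z) r \<le> ?Q"
    proof (rule rprob_ex_le[where c = "(2 / ?A) ^ ?a * (2 / ?B) ^ ?b" and g = "?A ^ ?a * (6 * (2 / 3) ^ j * ?B) ^ ?b"])
      show "finite (?C y)" by (intro finite_PiE) (auto simp: finite_nbrs)
      show "0 \<le> ?A ^ ?a * (6 * (2 / 3) ^ j * ?B) ^ ?b" using pos by simp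
    next
      fix z assume z: "z \<in> ?C y" and conc: "?conc z"
      have zy: "z i = y i" if "i \<in> ?K" for i
      proof -
        have "i \<in> {..<m}" using that Km by blast
        from PiE_mem[OF z this] that show ?thesis by simp
      qed
      have A: "lazy_prob P z 0 = ?A" and B: "lazy_prob Q z 0 = ?B" using zy by (auto intro!: lazy_prob_cong_on)
      show "rprob U (\<lambda>r. ?rows r z) r \<le> ?A ^ ?a * (6 * (2 / 3) ^ j * ?B) ^ ?b"
      proof -
        \<comment> \<open>the rows in \<open>S - P\<close> go first: their fresh entries lie inside \<open>S\<close> and do not meet the other rows\<close>
        have "rprob U (\<lambda>r. ?rows r z) r
            \<le> lazy_prob P z 0 ^ ?a * rprob U (\<lambda>r. \<forall>i\<in>?J - S. [rowsum r m z i = w i] (mod int p)) r"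
        proof (rule rprob_rows[OF U(1)])
          show "S - P \<subseteq> {..<m}" "P \<subseteq> {..<m}" "(S - P) \<inter> P = {}" using Sm sub by auto
          then show "edges (S - P) P \<subseteq> U" using edges_pairs U(2) by blast
          show "ignores (edges (S - P) P) (\<lambda>r. \<forall>i\<in>?J - S. [rowsum r m z i = w i] (mod int p))"
            by (rule ignores_rows) (use sub(1) in \<open>auto simp: in_edges_iff\<close>)
        qed
        also have "\<dots> \<le> lazy_prob P z 0 ^ ?a * lazy_prob S z 0 ^ ?b"
        proof (intro mult_left_mono rprob_rows'[OF U(1) _ _ _ U(2)])
          show "0 \<le> lazy_prob P z 0 ^ ?a" using lazy_prob_0_pos[of P z] by simp
        qed (use Sm in auto)
        also have "\<dots> \<le> lazy_prob P z 0 ^ ?a * (6 * (2 / 3) ^ j * ?B) ^ ?b"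
        proof (intro mult_left_mono power_mono)
          show "0 \<le> lazy_prob P z 0 ^ ?a" using lazy_prob_0_pos[of P z] by simp
          show "0 \<le> lazy_prob S z 0" using lazy_prob_0_pos[of S z] by simp
          show "lazy_prob S z 0 \<le> 6 * (2 / 3) ^ j * ?B" using conc B by simp
        qed
        finally show ?thesis using A by simp
      qed
    next
      have "real (card (?C y)) = (\<Prod>i<m. real (card (if i \<in> ?K then {y i} else if i \<in> S then nbrs P y else nbrs Q y)))"
        by (simp add: card_PiE)
      also have "\<dots> \<le> (\<Prod>i<m. if i \<in> S - P then 2 / ?A else if i \<in> ?J - S then 2 / ?B else 1)"
      proof (rule prod_mono, intro conjI)
        fix i assume i: "i \<in> {..<m}"
        show "real (card (if i \<in> ?K then {y i} else if i \<in> S then nbrs P y else nbrs Q y))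
          \<le> (if i \<in> S - P then 2 / ?A else if i \<in> ?J - S then 2 / ?B else 1)"
          using i sub card_nbrs[OF fP(1), of y] card_nbrs[OF fP(2), of y] one_le_two_div_lazy_prob[of P y] one_le_two_div_lazy_prob[of Q y]
          by auto
      qed simp
      also have "\<dots> = (\<Prod>i\<in>(S - P) \<union> (?J - S). if i \<in> S - P then 2 / ?A else 2 / ?B)"
        using Sm lm by (intro prod.mono_neutral_cong_right) auto
      also have "\<dots> = (\<Prod>i\<in>S - P. if i \<in> S - P then 2 / ?A else 2 / ?B) * (\<Prod>i\<in>?J - S. if i \<in> S - P then 2 / ?A else 2 / ?B)"
        using fS by (intro prod.union_disjoint) auto
      also have "\<dots> = (2 / ?A) ^ ?a * (2 / ?B) ^ ?b"
      proof -
        have "(\<Prod>i\<in>S - P. if i \<in> S - P then 2 / ?A else 2 / ?B) = (\<Prod>i\<in>S - P. 2 / ?A)"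
          by (rule prod.cong) auto
        moreover have "(\<Prod>i\<in>?J - S. if i \<in> S - P then 2 / ?A else 2 / ?B) = (\<Prod>i\<in>?J - S. 2 / ?B)"
          by (rule prod.cong) auto
        ultimately show ?thesis by simp
      qed
      finally show "real (card (?C y)) \<le> (2 / ?A) ^ ?a * (2 / ?B) ^ ?b" .
    next
      have "(2 / ?A) ^ ?a * (2 / ?B) ^ ?b * (?A ^ ?a * (6 * (2 / 3) ^ j * ?B) ^ ?b)
          = ((2 / ?A) ^ ?a * ?A ^ ?a) * ((2 / ?B) ^ ?b * (6 * (2 / 3) ^ j * ?B) ^ ?b)"
        by (simp only: mult_ac)
      also have "\<dots> = 2 ^ ?a * ?q ^ ?b"
        unfolding power_mult_distrib[symmetric] using pos by simp
      also have "\<dots> \<le> 2 ^ m * ?q ^ (m - l - N)"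
      proof (rule mult_mono)
        have "card (S - P) \<le> card {..<m}" using Sm by (intro card_mono) auto
        then show "(2 :: real) ^ ?a \<le> 2 ^ m" by (intro power_increasing) auto
        have "card (?J - S) = (m - l) - card S" using sub(3) fS by (simp add: card_Diff_subset)
        then have "m - l - N \<le> ?b" using card(3) by simp
        then show "?q ^ ?b \<le> ?q ^ (m - l - N)" by (intro power_decreasing small) auto
      qed auto
      finally show "(2 / ?A) ^ ?a * (2 / ?B) ^ ?b * (?A ^ ?a * (6 * (2 / 3) ^ j * ?B) ^ ?b) \<le> ?Q" .
    qed
  qed
  have "card ?K \<le> l + 2 * D"
    using card_Un_le[of "?I \<union> P" Q] card_Un_le[of ?I P] card by simp
  then have "real p ^ card ?K \<le> real p ^ (l + 2 * D)"
    using p_pos by (intro power_increasing) auto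
  then have "real (card ?Y) \<le> real p ^ (l + 2 * D)"
    using fP by (simp add: card_PiE)
  then have "real (card ?Y) * ?Q \<le> real p ^ (l + 2 * D) * ?Q"
    by (intro mult_right_mono) auto
  with main show ?thesis by (simp only: of_nat_power) 
qed

text \<open>Summing over \<open>S\<close>, \<open>P\<close> and \<open>Q\<close> costs \<open>(2 ^ m) ^ 3\<close>, which is negligible against a power of \<open>n\<close> per row.\<close>
lemma dense_solutions:
  fixes j :: nat
  defines "k \<equiv> 1 + 8 * j * 4 ^ j"
  assumes U: "finite U" "pairs m \<subseteq> U"
    and D: "p \<le> (8 / 7 :: real) ^ D"
    and small: "12 * (2 / 3) ^ j \<le> (1 :: real)" and lm: "l \<le> m"
  shows "rprob U (\<lambda>r. \<exists>z\<in>residue_vecs m. k * D \<le> card {i \<in> {l..<m}. z i \<noteq> 0} \<and> 2 / p \<le> lazy_prob {l..<m} z 0 \<and>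
      (\<forall>i<m. [rowsum r m z i = w i] (mod int p))) r
    \<le> 8 ^ m * (p ^ (l + 2 * D) * (2 ^ m * (12 * (2 / 3) ^ j) ^ (m - l - k * D)))"
proof -
  let ?J = "{l..<m}"
  let ?rows = "\<lambda>r z. \<forall>i<m. [rowsum r m z i = w i] (mod int p)"
  let ?Y = "{(S, P, Q). P \<subseteq> S \<and> Q \<subseteq> S \<and> S \<subseteq> ?J \<and> card P \<le> D \<and> card Q \<le> D \<and> card S \<le> k * D}"
  let ?E = "\<lambda>(S, P, Q) r. \<exists>z\<in>residue_vecs m. (\<forall>i\<in>S - P. z i \<in> nbrs P z) \<and> (\<forall>i\<in>?J - S. z i \<in> nbrs Q z) \<and>
      lazy_prob S z 0 \<le> 6 * (2 / 3) ^ j * lazy_prob Q z 0 \<and> ?rows r z"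
  let ?Q = "real p ^ (l + 2 * D) * (2 ^ m * (12 * (2 / 3) ^ j) ^ (m - l - k * D))"
  have sub: "?Y \<subseteq> Pow {..<m} \<times> Pow {..<m} \<times> Pow {..<m}" by auto
  have fin: "finite ?Y" by (rule finite_subset[OF sub]) simp
  have "rprob U (\<lambda>r. \<exists>z\<in>residue_vecs m. k * D \<le> card {i \<in> ?J. z i \<noteq> 0} \<and> 2 / p \<le> lazy_prob ?J z 0 \<and> ?rows r z) r \<le> real (card ?Y) * ?Q"
  proof (rule rprob_union_bound[where E' = ?E, OF fin])
    fix r
    assume "\<exists>z\<in>residue_vecs m. k * D \<le> card {i \<in> ?J. z i \<noteq> 0} \<and> 2 / p \<le> lazy_prob ?J z 0 \<and> ?rows r z"
    then obtain z where z: "z \<in> residue_vecs m" "k * D \<le> card {i \<in> ?J. z i \<noteq> 0}" "2 / p \<le> lazy_prob ?J z 0" "?rows r z"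
      by blast
    have mem: "z i \<in> {0..<int p}" if "i \<in> ?J" for i
      using z(1) that by (auto simp: residue_vecs_def PiE_iff)
    obtain S P Q where *: "P \<subseteq> S" "Q \<subseteq> S" "S \<subseteq> ?J" "card P \<le> D" "card Q \<le> D" "card S \<le> k * D"
        "\<forall>i\<in>S - P. z i \<in> nbrs P z" "\<forall>i\<in>?J - S. z i \<in> nbrs Q z"
        "lazy_prob S z 0 \<le> 6 * (2 / 3) ^ j * lazy_prob Q z 0"
      by (rule structured_vector[of ?J z D j, folded k_def, OF finite_atLeastLessThan mem D z(3) z(2)])
        (assumption, rule that)
    have "(S, P, Q) \<in> ?Y" using * by simp
    moreover have "?E (S, P, Q) r"
      unfolding prod.case by (rule bexI[OF _ z(1)]) (use * z(4) in blast)
    ultimately show "\<exists>y\<in>?Y. ?E y r" by blast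
  next
    fix y assume "y \<in> ?Y"
    then obtain S P Q where y: "y = (S, P, Q)" "P \<subseteq> S" "Q \<subseteq> S" "S \<subseteq> ?J" "card P \<le> D" "card Q \<le> D" "card S \<le> k * D"
      by auto
    show "rprob U (?E y) r \<le> ?Q"
      using dense_fixed_structure[OF U y(2-7) small lm, of w r] unfolding y(1) prod.case by simp
  qed
  also have "\<dots> \<le> 8 ^ m * ?Q"
  proof (rule mult_right_mono)
    have "card ?Y \<le> card (Pow {..<m} \<times> Pow {..<m} \<times> Pow {..<m})"
      by (intro card_mono sub) simp
    also have "\<dots> = 8 ^ m" by (simp add: card_cartesian_product card_Pow power_mult_distrib[symmetric])
    finally have "real (card ?Y) \<le> real (8 ^ m)" by (rule of_nat_mono)
    then show "real (card ?Y) \<le> 8 ^ m" by (simp only: of_nat_power of_nat_numeral)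
  qed simp
  finally show ?thesis by simp
qed

end

section \<open>Kernels of nested principal minors\<close>

lemma rowsum_symmetric: "(\<Sum>i<m. v i * rowsum r m u i) = (\<Sum>i<m. u i * rowsum r m v i)"
proof -
  have "(\<Sum>i<m. v i * rowsum r m u i) = (\<Sum>i<m. \<Sum>j<m. v i * (entry r i j * u j))"
    by (simp add: rowsum_def sum_distrib_left)
  also have "\<dots> = (\<Sum>j<m. \<Sum>i<m. v i * (entry r i j * u j))" by (rule sum.swap)
  also have "\<dots> = (\<Sum>j<m. \<Sum>i<m. u j * (entry r j i * v i))"
    by (intro sum.cong refl) (simp add: entry_def min.commute max.commute mult_ac)
  also have "\<dots> = (\<Sum>i<m. u i * rowsum r m v i)"
    by (simp add: rowsum_def sum_distrib_left)
  finally show ?thesis .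
qed

lemma rowsum_Suc: "i < m \<Longrightarrow> rowsum r (Suc m) z i = rowsum r m z i + r (i, m) * z m"
  by (simp add: rowsum_def entry_def)

lemma rowsum_last: "rowsum r (Suc m) z m = (\<Sum>j<m. r (j, m) * z j) + r (m, m) * z m"
  by (simp add: rowsum_def entry_def)

lemma rowsum_diff: "rowsum r m (\<lambda>j. u j - v j) i = rowsum r m u i - rowsum r m v i"
  by (simp add: rowsum_def right_diff_distrib sum_subtractf)

lemma rowsum_cmult: "rowsum r m (\<lambda>j. c * u j) i = c * rowsum r m u i"
  by (simp add: rowsum_def sum_distrib_left mult_ac)

lemma rowsum_mod_cong:
  "(\<And>j. j < m \<Longrightarrow> [u j = v j] (mod q)) \<Longrightarrow> [rowsum r m u i = rowsum r m v i] (mod q)"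
  unfolding rowsum_def by (intro cong_sum cong_scalar_left) auto

context odd_prime
begin

definition kernel :: "nat \<Rightarrow> (nat \<times> nat \<Rightarrow> int) \<Rightarrow> (nat \<Rightarrow> int) set" where
  "kernel m r = {z \<in> residue_vecs m. \<forall>i<m. [rowsum r m z i = 0] (mod int p)}"

definition singular :: "nat \<Rightarrow> (nat \<times> nat \<Rightarrow> int) \<Rightarrow> bool" where
  "singular m r \<longleftrightarrow> (\<exists>z\<in>kernel m r. \<exists>i<m. z i \<noteq> 0)"

text \<open>The first \<open>l\<close> coordinates are excluded from the concentration condition because the decoupling in \<open>rprob_border\<close>
spends the corresponding entries of the new column.\<close>
definition structured_sol :: "nat \<Rightarrow> nat \<Rightarrow> (nat \<Rightarrow> int) \<Rightarrow> (nat \<times> nat \<Rightarrow> int) \<Rightarrow> bool" where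
  "structured_sol l m w r \<longleftrightarrow> (\<exists>z\<in>residue_vecs m. (\<exists>i<m. z i \<noteq> 0) \<and> 2 / p \<le> lazy_prob {l..<m} z 0 \<and>
    (\<forall>i<m. [rowsum r m z i = w i] (mod int p)))"

definition reduce_vec :: "nat \<Rightarrow> (nat \<Rightarrow> int) \<Rightarrow> nat \<Rightarrow> int" where
  "reduce_vec m z = (\<lambda>i\<in>{..<m}. z i mod int p)"

lemma reduce_vec_in_residue_vecs: "reduce_vec m z \<in> residue_vecs m"
  using p_pos by (auto simp: reduce_vec_def residue_vecs_def)

lemma reduce_vec_cong: "i < m \<Longrightarrow> [reduce_vec m z i = z i] (mod int p)"
  by (simp add: reduce_vec_def cong_def)

lemma rowsum_reduce_vec: "[rowsum r m (reduce_vec m z) i = rowsum r m z i] (mod int p)"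
  by (rule rowsum_mod_cong) (rule reduce_vec_cong)

lemma residue_vecs_range: "z \<in> residue_vecs m \<Longrightarrow> i < m \<Longrightarrow> 0 \<le> z i \<and> z i < int p"
  by (auto simp: residue_vecs_def PiE_iff)

lemma residue_vecs_eqI:
  assumes "u \<in> residue_vecs m" "v \<in> residue_vecs m" "\<And>i. i < m \<Longrightarrow> [u i = v i] (mod int p)"
  shows "u = v"
proof (rule PiE_ext)
  show "u \<in> PiE {..<m} (\<lambda>_. {0..<int p})" "v \<in> PiE {..<m} (\<lambda>_. {0..<int p})"
    using assms by (auto simp: residue_vecs_def)
  fix i assume "i \<in> {..<m}"
  then show "u i = v i"
    using assms(3)[of i] residue_vecs_range[OF assms(1), of i] residue_vecs_range[OF assms(2), of i] by (simp add: cong_def)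
qed

lemma card_residue_vecs: "card (residue_vecs m) = p ^ m"
  by (simp add: residue_vecs_def card_PiE)

lemma finite_kernel: "finite (kernel m r)"
  unfolding kernel_def by (rule finite_subset[OF _ finite_residue_vecs[of m]]) auto

lemma singularI:
  assumes "\<And>i. i < m \<Longrightarrow> [rowsum r m z i = 0] (mod int p)" "i < m" "\<not> int p dvd z i"
  shows "singular m r"
proof -
  have "reduce_vec m z \<in> kernel m r"
    using assms(1) reduce_vec_in_residue_vecs cong_trans[OF rowsum_reduce_vec] by (auto simp: kernel_def)
  moreover have "reduce_vec m z i \<noteq> 0"
    using assms(2,3) by (simp add: reduce_vec_def dvd_eq_mod_eq_0)
  ultimately show ?thesis using assms(2) unfolding singular_def by blast
qed

lemma nonsingular_unique:
  assumes ns: "\<not> singular m r"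
    and "\<And>i. i < m \<Longrightarrow> [rowsum r m u i = rowsum r m v i] (mod int p)" and i: "i < m"
  shows "[u i = v i] (mod int p)"
proof (rule ccontr)
  assume "\<not> [u i = v i] (mod int p)"
  then have "\<not> int p dvd (u i - v i)" by (simp add: cong_iff_dvd_diff)
  moreover have "[rowsum r m (\<lambda>j. u j - v j) i = 0] (mod int p)" if "i < m" for i
    using assms(2)[OF that] by (simp add: rowsum_diff cong_diff_iff_cong_0)
  ultimately have "singular m r" using singularI[of m r "\<lambda>j. u j - v j" i] i by simp
  with ns show False by simp
qed

text \<open>If fewer than \<open>k * D\<close> coordinates beyond the first \<open>l\<close> are nonzero, the whole support has at most \<open>s\<close> elements, and
the solution is sparse.\<close>
lemma rprob_structured_sol:
  fixes j :: nat
  defines "k \<equiv> 1 + 8 * j * 4 ^ j"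
  assumes U: "finite U" "pairs m \<subseteq> U"
    and D: "p \<le> (8 / 7 :: real) ^ D"
    and small: "12 * (2 / 3) ^ j \<le> (1 :: real)" and lm: "l \<le> m"
    and s: "s = k * D + l" "2 * s \<le> m"
    and p_small: "p * (7 / 8) ^ (m - 2 * s) \<le> (1 :: real)"
  shows "rprob U (structured_sol l m w) r \<le> (4 * (real m + 1)) ^ s * (p * (7 / 8) ^ (m - 2 * s))
    + 8 ^ m * (p ^ (l + 2 * D) * (2 ^ m * (12 * (2 / 3) ^ j) ^ (m - s)))"
proof -
  let ?rows = "\<lambda>r z. \<forall>i<m. [rowsum r m z i = w i] (mod int p)"
  let ?S = "\<lambda>r. \<exists>z\<in>residue_vecs m. (\<exists>i<m. z i \<noteq> 0) \<and> card {i. i < m \<and> z i \<noteq> 0} \<le> s \<and> ?rows r z"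
  let ?D = "\<lambda>r. \<exists>z\<in>residue_vecs m. k * D \<le> card {i \<in> {l..<m}. z i \<noteq> 0} \<and> 2 / p \<le> lazy_prob {l..<m} z 0 \<and> ?rows r z"
  have "rprob U (structured_sol l m w) r \<le> rprob U (\<lambda>r. ?S r \<or> ?D r) r"
  proof (rule rprob_mono)
    fix r assume "structured_sol l m w r"
    then obtain z where z: "z \<in> residue_vecs m" "\<exists>i<m. z i \<noteq> 0" "2 / p \<le> lazy_prob {l..<m} z 0" "?rows r z"
      unfolding structured_sol_def by blast
    show "?S r \<or> ?D r"
    proof (cases "k * D \<le> card {i \<in> {l..<m}. z i \<noteq> 0}")
      case True
      then show ?thesis using z by blast
    next
      case False
      have "card {i. i < m \<and> z i \<noteq> 0} \<le> card ({..<l} \<union> {i \<in> {l..<m}. z i \<noteq> 0})"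
        by (intro card_mono) auto
      also have "\<dots> \<le> card {..<l} + card {i \<in> {l..<m}. z i \<noteq> 0}" by (rule card_Un_le)
      also have "\<dots> \<le> s" using False s(1) by simp
      finally show ?thesis using z by blast
    qed
  qed
  also have "\<dots> \<le> rprob U ?S r + rprob U ?D r" by (rule rprob_disj)
  also have "\<dots> \<le> (4 * (real m + 1)) ^ s * (p * (7 / 8) ^ (m - 2 * s))
    + 8 ^ m * (p ^ (l + 2 * D) * (2 ^ m * (12 * (2 / 3) ^ j) ^ (m - l - k * D)))"
    unfolding k_def
    by (intro add_mono sparse_solutions[OF U s(2) p_small] dense_solutions[OF U D small lm])
  also have "m - l - k * D = m - s" using s(1) by simp
  finally show ?thesis .
qed

text \<open>Pair the rows of the bordered system with \<open>v\<close>: by symmetry the old matrix drops out, and what remains is \<open>u m\<close> times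
the product of the new column with \<open>v\<close>.\<close>
lemma kernel_last_zero:
  assumes v: "v \<in> kernel m r" "\<not> [(\<Sum>i<m. r (i, m) * v i) = 0] (mod int p)" and u: "u \<in> kernel (Suc m) r"
  shows "u m = 0" "restrict u {..<m} \<in> kernel m r" "[(\<Sum>i<m. r (i, m) * u i) = 0] (mod int p)"
proof -
  have uv: "u \<in> residue_vecs (Suc m)" and urow: "\<And>i. i < Suc m \<Longrightarrow> [rowsum r (Suc m) u i = 0] (mod int p)"
    using u by (auto simp: kernel_def)
  have vrow: "\<And>i. i < m \<Longrightarrow> [rowsum r m v i = 0] (mod int p)" using v by (auto simp: kernel_def)
  have sum0: "[(\<Sum>i<m. f i * g i) = 0] (mod int p)" if "\<And>i. i < m \<Longrightarrow> [g i = 0] (mod int p)" for f g :: "nat \<Rightarrow> int"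
  proof -
    have "[(\<Sum>i<m. f i * g i) = (\<Sum>i<m. f i * 0)] (mod int p)"
      using that by (intro cong_sum cong_scalar_left) auto
    then show ?thesis by simp
  qed
  have a: "[(\<Sum>i<m. v i * rowsum r (Suc m) u i) = 0] (mod int p)"
    using urow by (intro sum0) simp
  have b: "(\<Sum>i<m. v i * rowsum r (Suc m) u i) = (\<Sum>i<m. u i * rowsum r m v i) + u m * (\<Sum>i<m. r (i, m) * v i)"
    unfolding rowsum_symmetric[where u = v and v = u]
    by (simp add: rowsum_Suc ring_distribs sum.distrib sum_distrib_left mult_ac)
  have c: "int p dvd (\<Sum>i<m. u i * rowsum r m v i)"
    unfolding cong_0_iff[symmetric] using vrow by (intro sum0)
  have "int p dvd u m * (\<Sum>i<m. r (i, m) * v i)"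
    using a unfolding b cong_0_iff dvd_add_right_iff[OF c] .
  then have "int p dvd u m"
    using v(2) prime_int_p by (simp add: prime_dvd_mult_iff cong_0_iff)
  then show um: "u m = 0"
    using residue_vecs_range[OF uv, of m] zdvd_not_zless[of "u m" "int p"] by (cases "0 < u m") auto
  have "rowsum r m (restrict u {..<m}) i = rowsum r (Suc m) u i" if "i < m" for i
    using that um by (simp add: rowsum_Suc) (simp add: rowsum_def)
  moreover have "restrict u {..<m} \<in> residue_vecs m"
    using uv by (auto simp: residue_vecs_def PiE_iff)
  ultimately show "restrict u {..<m} \<in> kernel m r"
    using urow by (simp add: kernel_def)
  show "[(\<Sum>i<m. r (i, m) * u i) = 0] (mod int p)"
    using urow[of m] um by (simp add: rowsum_last)
qed

text \<open>If the new column is not orthogonal to \<open>v\<close>, the new kernel is the part of the old one orthogonal to the column, and adding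
multiples of \<open>v\<close> gives \<open>p\<close> disjoint translates of it. Cardinalities serve as dimensions here.\<close>
lemma card_kernel_Suc_le:
  assumes v: "v \<in> kernel m r" "\<not> [(\<Sum>i<m. r (i, m) * v i) = 0] (mod int p)"
  shows "card (kernel (Suc m) r) * p \<le> card (kernel m r)"
proof -
  let ?phi = "\<lambda>(u, t). reduce_vec m (\<lambda>i. u i + t * v i)"
  let ?dot = "\<lambda>u. \<Sum>i<m. r (i, m) * u i"
  let ?A = "kernel (Suc m) r \<times> {0..<int p}"
  have vrow: "\<And>i. i < m \<Longrightarrow> [rowsum r m v i = 0] (mod int p)" using v by (auto simp: kernel_def)
  have "inj_on ?phi ?A"
  proof (rule inj_onI, clarify)
    fix u t u' t'
    assume u: "u \<in> kernel (Suc m) r" "u' \<in> kernel (Suc m) r" and t: "t \<in> {0..<int p}" "t' \<in> {0..<int p}"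
      and eq: "reduce_vec m (\<lambda>i. u i + t * v i) = reduce_vec m (\<lambda>i. u' i + t' * v i)"
    have c: "[u i + t * v i = u' i + t' * v i] (mod int p)" if "i < m" for i
      using fun_cong[OF eq, of i] that by (simp add: reduce_vec_def cong_def)
    have dots: "?dot (\<lambda>i. u i + t * v i) = ?dot u + t * ?dot v" for u t
      by (simp add: ring_distribs sum.distrib sum_distrib_left mult_ac)
    have "[?dot (\<lambda>i. u i + t * v i) = ?dot (\<lambda>i. u' i + t' * v i)] (mod int p)"
      using c by (intro cong_sum cong_scalar_left) auto
    then have "[?dot u + t * ?dot v = ?dot u' + t' * ?dot v] (mod int p)"
      unfolding dots .
    moreover have "[?dot u + t * ?dot v = 0 + t * ?dot v] (mod int p)"
      by (rule cong_add[OF kernel_last_zero(3)[OF v u(1)] cong_refl])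
    moreover have "[?dot u' + t' * ?dot v = 0 + t' * ?dot v] (mod int p)"
      by (rule cong_add[OF kernel_last_zero(3)[OF v u(2)] cong_refl])
    ultimately have "[0 + t * ?dot v = 0 + t' * ?dot v] (mod int p)"
      unfolding cong_def by simp
    then have "[t * ?dot v = t' * ?dot v] (mod int p)" by simp
    then have "[t = t'] (mod int p)"
      by (rule not_dvd_mult_inj[rotated]) (use v(2) in \<open>simp add: cong_0_iff\<close>)
    then have tt: "t = t'" using t by (simp add: cong_def)
    have "u = u'"
    proof (rule residue_vecs_eqI)
      show "u \<in> residue_vecs (Suc m)" "u' \<in> residue_vecs (Suc m)" using u by (auto simp: kernel_def)
      fix i assume "i < Suc m"
      then consider "i < m" | "i = m" by linarith
      then show "[u i = u' i] (mod int p)"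
      proof cases
        case 1
        then show ?thesis using c[of i] tt by (simp add: cong_add_rcancel)
      next
        case 2
        then show ?thesis using kernel_last_zero(1)[OF v u(1)] kernel_last_zero(1)[OF v u(2)] by simp
      qed
    qed
    with tt show "u = u' \<and> t = t'" by simp
  qed
  moreover have "?phi ` ?A \<subseteq> kernel m r"
  proof clarify
    fix u t assume u: "u \<in> kernel (Suc m) r"
    have "[rowsum r m (reduce_vec m (\<lambda>i. u i + t * v i)) i = 0] (mod int p)" if i: "i < m" for i
    proof -
      have "rowsum r m (\<lambda>i. u i + t * v i) i = rowsum r m (restrict u {..<m}) i + t * rowsum r m v i"
        by (simp add: rowsum_def ring_distribs sum.distrib sum_distrib_left mult_ac)
      moreover have "[rowsum r m (restrict u {..<m}) i + t * rowsum r m v i = 0 + t * 0] (mod int p)"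
        using kernel_last_zero(2)[OF v u] vrow[OF i] i by (intro cong_add cong_scalar_left) (auto simp: kernel_def)
      ultimately show ?thesis using cong_trans[OF rowsum_reduce_vec] by simp
    qed
    then show "reduce_vec m (\<lambda>i. u i + t * v i) \<in> kernel m r"
      using reduce_vec_in_residue_vecs by (simp add: kernel_def)
  qed
  ultimately have "card ?A \<le> card (kernel m r)"
    using finite_kernel by (intro card_inj_on_le)
  then show ?thesis by (simp add: card_cartesian_product)
qed

lemma card_kernel_Suc_nonsingular:
  assumes "\<not> singular m r" shows "card (kernel (Suc m) r) \<le> p"
proof -
  have "inj_on (\<lambda>u. u m) (kernel (Suc m) r)"
  proof (rule inj_onI)
    fix u v assume uv: "u \<in> kernel (Suc m) r" "v \<in> kernel (Suc m) r" "u m = v m"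
    have rows: "[rowsum r m u i = rowsum r m v i] (mod int p)" if i: "i < m" for i
    proof -
      have "[rowsum r (Suc m) u i = 0] (mod int p)" "[rowsum r (Suc m) v i = 0] (mod int p)"
        using uv i by (auto simp: kernel_def)
      then have "[rowsum r (Suc m) u i = rowsum r (Suc m) v i] (mod int p)"
        by (simp add: cong_def)
      then show ?thesis using i uv(3) by (simp add: rowsum_Suc cong_add_rcancel)
    qed
    show "u = v"
    proof (rule residue_vecs_eqI)
      show "u \<in> residue_vecs (Suc m)" "v \<in> residue_vecs (Suc m)" using uv by (auto simp: kernel_def)
      fix i assume "i < Suc m"
      then show "[u i = v i] (mod int p)"
        using nonsingular_unique[OF assms rows, of i] uv(3) by (cases "i = m") auto
    qed
  qed
  moreover have "(\<lambda>u. u m) ` kernel (Suc m) r \<subseteq> {0..<int p}"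
    using residue_vecs_range[of _ "Suc m" m] by (auto simp: kernel_def)
  ultimately have "card (kernel (Suc m) r) \<le> card {0..<int p}"
    by (intro card_inj_on_le) auto
  then show ?thesis by simp
qed

definition stuck :: "nat \<Rightarrow> (nat \<times> nat \<Rightarrow> int) \<Rightarrow> bool" where
  "stuck m r \<longleftrightarrow> singular m r \<and> (\<forall>v\<in>kernel m r. [(\<Sum>i<m. r (i, m) * v i) = 0] (mod int p))"

lemma two_le_card_kernel: "singular m r \<Longrightarrow> 2 \<le> card (kernel m r)"
proof -
  assume "singular m r"
  then obtain z i where z: "z \<in> kernel m r" "i < m" "z i \<noteq> 0" by (auto simp: singular_def)
  let ?o = "\<lambda>i\<in>{..<m}. 0 :: int"
  have "?o \<in> kernel m r" using p_pos by (auto simp: kernel_def residue_vecs_def rowsum_def)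
  moreover have "?o \<noteq> z" using z by (auto dest!: fun_cong[of _ _ i])
  ultimately have "{?o, z} \<subseteq> kernel m r" "card {?o, z} = 2"
    using z(1) by auto
  then show ?thesis using card_mono[OF finite_kernel, of "{?o, z}" m r] by simp
qed

text \<open>If no step from \<open>n div 2\<close> on is stuck and the last minor is singular, the kernel gains a factor \<open>p\<close> with each
row and column removed. After removing half of them it has more than \<open>p ^ (n div 2)\<close> elements, which is impossible.\<close>
lemma singular_cases:
  assumes "singular n r" "0 < n"
  shows "\<not> singular (n - 1) r \<or> (\<exists>m\<in>{n div 2..<n}. stuck m r)"
proof (rule ccontr)
  assume contra: "\<not> ?thesis"
  have "n - d < n \<longrightarrow> singular (n - d) r" "2 * p ^ d \<le> card (kernel (n - d) r)" if "d \<le> n - n div 2" for d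
    using that
  proof (induction d)
    case 0
    { case 1 then show ?case by simp }
    { case 2 then show ?case using two_le_card_kernel[OF assms(1)] by simp }
  next
    case (Suc d)
    let ?m = "n - Suc d"
    have m: "Suc ?m = n - d" "?m \<in> {n div 2..<n}" if "Suc d \<le> n - n div 2" using that by auto
    have sing: "singular ?m r" if le: "Suc d \<le> n - n div 2"
    proof (cases "d = 0")
      case True
      then show ?thesis using contra by simp
    next
      case False
      show ?thesis
      proof (rule ccontr)
        assume "\<not> singular ?m r"
        then have "card (kernel (n - d) r) \<le> p" using card_kernel_Suc_nonsingular[of ?m r] m(1)[OF le] by simp
        moreover have "2 * p ^ 1 \<le> 2 * p ^ d" using False p_pos by (intro mult_le_mono2 power_increasing) auto
        ultimately show False using Suc.IH(2) le p_pos by simp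
      qed
    qed
    { case 1 then show ?case using sing by simp }
    { case 2
      then have le: "Suc d \<le> n - n div 2" by simp
      have "\<not> stuck ?m r" using contra m(2)[OF le] by blast
      then obtain v where "v \<in> kernel ?m r" "\<not> [(\<Sum>i<?m. r (i, ?m) * v i) = 0] (mod int p)"
        using sing[OF le] by (auto simp: stuck_def)
      from card_kernel_Suc_le[OF this] have "card (kernel (n - d) r) * p \<le> card (kernel ?m r)"
        using m(1)[OF le] by simp
      moreover have "2 * p ^ d * p \<le> card (kernel (n - d) r) * p"
        using Suc.IH(2) le by (intro mult_le_mono1) simp
      ultimately have "2 * p ^ d * p \<le> card (kernel ?m r)" by linarith
      then show ?case by (simp only: power_Suc mult_ac) }
  qed
  from this(2)[of "n - n div 2"] have "2 * p ^ (n - n div 2) \<le> card (kernel (n div 2) r)" by simp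
  also have "\<dots> \<le> card (residue_vecs (n div 2))" by (intro card_mono finite_residue_vecs) (auto simp: kernel_def)
  also have "\<dots> = p ^ (n div 2)" by (rule card_residue_vecs)
  also have "\<dots> \<le> p ^ (n - n div 2)" using p_pos by (intro power_increasing) auto
  finally show False using p_pos by simp
qed

end

section \<open>The probability that a border keeps or creates a kernel\<close>

context odd_prime
begin

lemma minor_cong:
  assumes "\<And>x. x \<notin> UNIV \<times> {m} \<Longrightarrow> r x = r' x"
  shows "i < m \<Longrightarrow> rowsum r m z i = rowsum r' m z i" "kernel m r = kernel m r'" "singular m r = singular m r'"
    "structured_sol l m w r = structured_sol l m w r'"
proof -
  have row: "rowsum r m z i = rowsum r' m z i" if "i < m" for i z
    unfolding rowsum_def entry_def using that
    by (intro sum.cong refl arg_cong2[of _ _ _ _ "(*)"] assms) auto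
  then show "i < m \<Longrightarrow> rowsum r m z i = rowsum r' m z i" .
  show kernel: "kernel m r = kernel m r'" by (simp add: kernel_def row)
  show "singular m r = singular m r'" by (simp add: singular_def kernel)
  show "structured_sol l m w r = structured_sol l m w r'" by (simp add: structured_sol_def row)
qed

lemma signs_column: "D \<subseteq> UNIV \<times> {m} \<Longrightarrow> x \<notin> UNIV \<times> {m} \<Longrightarrow> signs D S r x = r x"
  by (auto simp: signs_def)

text \<open>The new column is independent of the old minor. Either the minor has a structured kernel vector, or the column is orthogonal
to a fixed unstructured one.\<close>
lemma rprob_stuck:
  assumes U: "finite U" "pairs (Suc m) \<subseteq> U"
    and structured_sol: "rprob U (structured_sol l m (\<lambda>_. 0)) r \<le> \<gamma>"
  shows "rprob U (stuck m) r \<le> \<gamma> + 2 / p"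
proof -
  let ?e = "\<lambda>j. (j, m)"
  let ?D = "?e ` {..<m}"
  let ?structured_sol = "structured_sol l m (\<lambda>_. 0)"
  let ?G = "\<lambda>r. singular m r \<and> \<not> ?structured_sol r"
  let ?E = "\<lambda>r. \<forall>v\<in>kernel m r. [(\<Sum>i<m. r (i, m) * v i) = 0] (mod int p)"
  have D: "?D \<subseteq> UNIV \<times> {m}" by auto
  have "?D \<subseteq> pairs (Suc m)" by (auto simp: pairs_def)
  then have DU: "?D \<subseteq> U" using U(2) by (rule subset_trans)
  have ign: "ignores ?D ?G"
    unfolding ignores_def
  proof (intro allI impI)
    fix r r' :: "nat \<times> nat \<Rightarrow> int" assume "\<forall>i. i \<notin> ?D \<longrightarrow> r i = r' i"
    then have "r x = r' x" if "x \<notin> UNIV \<times> {m}" for x using that D by blast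
    from minor_cong(3)[OF this] minor_cong(4)[OF this] show "?G r = ?G r'" by simp
  qed
  have step: "rprob ?D ?E r \<le> 2 / p" if G: "?G r" for r
  proof -
    from G obtain v where v: "v \<in> kernel m r" "\<exists>i<m. v i \<noteq> 0" by (auto simp: singular_def)
    have "v \<in> residue_vecs m" "\<forall>i<m. [rowsum r m v i = 0] (mod int p)" using v(1) by (auto simp: kernel_def)
    then have small: "lazy_prob {l..<m} v 0 < 2 / p"
      using G v(2) unfolding structured_sol_def by (meson not_le)
    have "rprob ?D ?E r \<le> rprob ?D (\<lambda>r. [(\<Sum>j\<in>{..<m}. r (?e j) * v j) + 0 = 0] (mod int p)) r"
    proof (rule ravg_mono)
      fix S
      have "kernel m (signs ?D S r) = kernel m r"
        by (rule minor_cong(2)) (rule signs_column[OF D])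
      then show "of_bool (?E (signs ?D S r)) \<le> (of_bool [(\<Sum>j\<in>{..<m}. signs ?D S r (?e j) * v j) + 0 = 0] (mod int p) :: real)"
        using v(1) by simp
    qed
    also have "\<dots> \<le> lazy_prob {..<m} v 0"
      by (rule rprob_walk_le_lazy_prob) (auto simp: inj_on_def ignores_def)
    also have "\<dots> \<le> lazy_prob {l..<m} v 0" by (intro lazy_prob_0_antimono) auto
    finally show ?thesis using small by simp
  qed
  have "rprob U (stuck m) r \<le> rprob U (\<lambda>r. ?structured_sol r \<or> (?G r \<and> ?E r)) r"
    by (rule rprob_mono) (auto simp: stuck_def)
  also have "\<dots> \<le> rprob U ?structured_sol r + rprob U (\<lambda>r. ?G r \<and> ?E r) r" by (rule rprob_disj)
  also have "\<dots> \<le> \<gamma> + 2 / p * rprob U ?G r"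
    by (intro add_mono structured_sol rprob_conj_le[OF U(1) DU ign step])
  also have "\<dots> \<le> \<gamma> + 2 / p * 1"
    by (intro add_left_mono mult_left_mono rprob_le_1 U(1)) simp
  finally show ?thesis by simp
qed

text \<open>In a kernel vector of the bordered matrix the last coordinate is nonzero, as otherwise the rest would be a kernel vector
of the minor. Scale it to \<open>- 1\<close>.\<close>
lemma border_solution:
  assumes ns: "\<not> singular m r" and sing: "singular (Suc m) r"
  obtains a where "\<forall>i<m. [rowsum r m a i = r (i, m)] (mod int p)"
    "[(\<Sum>j<m. r (j, m) * a j) = r (m, m)] (mod int p)"
proof -
  from sing obtain z i where z: "z \<in> kernel (Suc m) r" "i < Suc m" "z i \<noteq> 0" by (auto simp: singular_def)
  have zv: "z \<in> residue_vecs (Suc m)" and rows: "\<And>i. i < Suc m \<Longrightarrow> int p dvd rowsum r (Suc m) z i"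
    using z(1) by (auto simp: kernel_def cong_0_iff)
  have nd: "\<not> int p dvd z k" if "k < Suc m" "z k \<noteq> 0" for k
    using residue_vecs_range[OF zv that(1)] that(2) zdvd_not_zless[of "z k" "int p"] by auto
  have "\<not> int p dvd z m"
  proof
    assume "int p dvd z m"
    then have zm: "z m = 0" using nd[of m] by auto
    then have "i < m" using z(2,3) by (metis less_Suc_eq)
    moreover have "[rowsum r m z k = 0] (mod int p)" if "k < m" for k
      using rows[of k] that zm by (simp add: rowsum_Suc cong_0_iff)
    ultimately have "singular m r" using nd[OF z(2,3)] by (intro singularI)
    with ns show False by simp
  qed
  then have "coprime (z m) (int p)" using prime_int_p by (metis coprime_commute prime_imp_coprime)
  then obtain c where "[z m * c = 1] (mod int p)" using cong_solve_coprime_int by blast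
  then have c: "int p dvd z m * c - 1" by (simp add: cong_iff_dvd_diff)
  \<comment> \<open>\<open>c\<close> inverts \<open>z m\<close>, so the factor \<open>- c\<close> scales the last coordinate to \<open>- 1\<close>\<close>
  have norm: "[- c * x = y] (mod int p)" if "int p dvd x + y * z m" for x y
  proof -
    have "int p dvd - c * (x + y * z m) + y * (z m * c - 1)"
      by (rule dvd_add[OF dvd_mult[OF that] dvd_mult[OF c]])
    also have "- c * (x + y * z m) + y * (z m * c - 1) = - c * x - y"
      by (simp add: algebra_simps)
    finally show ?thesis by (simp add: cong_iff_dvd_diff)
  qed
  show ?thesis
  proof (rule that[of "\<lambda>j. - c * z j"])
    show "\<forall>i<m. [rowsum r m (\<lambda>j. - c * z j) i = r (i, m)] (mod int p)"
    proof (intro allI impI)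
      fix i assume "i < m"
      then show "[rowsum r m (\<lambda>j. - c * z j) i = r (i, m)] (mod int p)"
        using rows[of i] unfolding rowsum_cmult by (intro norm) (simp add: rowsum_Suc)
    qed
  next
    have "(\<Sum>j<m. r (j, m) * (- c * z j)) = - c * (\<Sum>j<m. r (j, m) * z j)"
      by (simp add: sum_distrib_left sum_negf mult_ac)
    then show "[(\<Sum>j<m. r (j, m) * (- c * z j)) = r (m, m)] (mod int p)"
      using norm[of "\<Sum>j<m. r (j, m) * z j" "r (m, m)"] rows[of m] by (simp add: rowsum_last)
  qed
qed

text \<open>With \<open>B\<close> the inverse of the matrix this is the identity
\<open>x\<^sup>T B x - y\<^sup>T B y = (x + y)\<^sup>T B (x - y)\<close>, where \<open>a = B x\<close> and \<open>b = B y\<close>.\<close>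
lemma difference_of_solutions:
  assumes a: "\<And>i. i < m \<Longrightarrow> [rowsum r m a i = x i] (mod int p)" "[(\<Sum>j<m. x j * a j) = d] (mod int p)"
    and b: "\<And>i. i < m \<Longrightarrow> [rowsum r m b i = y i] (mod int p)" "[(\<Sum>j<m. y j * b j) = d] (mod int p)"
  shows "[(\<Sum>j<m. (x j + y j) * (a j - b j)) = 0] (mod int p)"
proof -
  have "[(\<Sum>j<m. b j * x j) = (\<Sum>j<m. b j * rowsum r m a j)] (mod int p)"
    using a(1) by (intro cong_sum cong_scalar_left) (auto intro: cong_sym)
  also have "(\<Sum>j<m. b j * rowsum r m a j) = (\<Sum>j<m. a j * rowsum r m b j)" by (rule rowsum_symmetric)
  also have "[(\<Sum>j<m. a j * rowsum r m b j) = (\<Sum>j<m. a j * y j)] (mod int p)"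
    using b(1) by (intro cong_sum cong_scalar_left) auto
  finally have cross: "int p dvd (\<Sum>j<m. b j * x j) - (\<Sum>j<m. a j * y j)" by (simp add: cong_iff_dvd_diff)
  have "int p dvd (\<Sum>j<m. x j * a j) - (\<Sum>j<m. y j * b j)"
    using a(2) b(2) by (metis cong_iff_dvd_diff cong_sym cong_trans)
  then have "int p dvd ((\<Sum>j<m. x j * a j) - (\<Sum>j<m. y j * b j)) - ((\<Sum>j<m. b j * x j) - (\<Sum>j<m. a j * y j))"
    using cross by (rule dvd_diff)
  also have "\<dots> = (\<Sum>j<m. (x j + y j) * (a j - b j))"
    by (simp add: algebra_simps sum.distrib sum_subtractf)
  finally show ?thesis by (simp add: cong_0_iff)
qed

text \<open>Given a nonsingular minor, this is a quadratic equation for the new column.\<close>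
definition border :: "nat \<Rightarrow> (nat \<times> nat \<Rightarrow> int) \<Rightarrow> bool" where
  "border m r \<longleftrightarrow> \<not> singular m r \<and> singular (Suc m) r"

text \<open>The two sign patterns \<open>S\<close> and \<open>S'\<close> of the first \<open>l\<close> entries of the new column are fixed and different, so the
difference \<open>w\<close> of the two columns is a fixed nonzero vector. The difference \<open>z\<close> of the two solutions satisfies
\<open>M z = w\<close>, hence is determined by the minor, and is unstructured unless the minor is exceptional. By
\<open>difference_of_solutions\<close> the remaining entries of the column satisfy a linear equation with coefficients \<open>2 * z j\<close>.\<close>
lemma rprob_border_pair:
  assumes U: "finite U" "pairs (Suc m) \<subseteq> U" and l: "l \<le> m"
    and X: "X = (\<lambda>i. (i, m)) ` {..<l}" and S: "S \<subseteq> X" "S' \<subseteq> X" "S \<noteq> S'"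
    and structured_sol: "\<And>w r. rprob (U - X) (structured_sol l m w) r \<le> \<gamma>"
  shows "rprob (U - X) (\<lambda>r. border m (signs X S r) \<and> border m (signs X S' r)) r \<le> \<gamma> + 2 / p"
proof -
  let ?e = "\<lambda>j. (j, m)"
  let ?V = "U - X"
  let ?D = "?e ` {l..<m}"
  define s where "s = (\<lambda>T (x :: nat \<times> nat). if x \<in> T then 1 else - 1 :: int)"
  define w where "w = (\<lambda>i. if (i, m) \<in> X then s S (i, m) - s S' (i, m) else 0)"
  let ?rows = "\<lambda>r z. \<forall>i<m. [rowsum r m z i = w i] (mod int p)"
  let ?x = "\<lambda>T r j. signs X T r (j, m)"
  let ?E = "\<lambda>r. \<exists>z\<in>residue_vecs m. ?rows r z \<and> [(\<Sum>j<m. (?x S r j + ?x S' r j) * z j) = 0] (mod int p)"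
  let ?G = "\<lambda>r. \<not> singular m r \<and> \<not> structured_sol l m w r"
  have Xm: "X \<subseteq> UNIV \<times> {m}" and Dm: "?D \<subseteq> UNIV \<times> {m}" by (auto simp: X)
  have DV: "?D \<subseteq> ?V"
  proof -
    have "?D \<subseteq> pairs (Suc m)" by (auto simp: pairs_def)
    moreover have "?D \<inter> X = {}" by (auto simp: X)
    ultimately show ?thesis using U(2) by blast
  qed
  have fV: "finite ?V" using U(1) by simp
  \<comment> \<open>both borderings share the minor and the corner entry; subtract their solutions\<close>
  have reduce: "\<not> singular m r \<and> ?E r" if B: "border m (signs X S r)" "border m (signs X S' r)" for r
  proof -
    have same: "rowsum (signs X T r) m z i = rowsum r m z i" if "i < m" for T z i
      using minor_cong(1)[of m "signs X T r" r, OF signs_column[OF Xm] that] .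
    have ns: "\<not> singular m r"
      using B(1) minor_cong(3)[of m "signs X S r" r, OF signs_column[OF Xm]] by (simp add: border_def)
    obtain a where a: "\<forall>i<m. [rowsum (signs X S r) m a i = ?x S r i] (mod int p)"
        "[(\<Sum>j<m. ?x S r j * a j) = signs X S r (m, m)] (mod int p)"
      using border_solution[of m "signs X S r"] B(1) unfolding border_def by blast
    obtain b where b: "\<forall>i<m. [rowsum (signs X S' r) m b i = ?x S' r i] (mod int p)"
        "[(\<Sum>j<m. ?x S' r j * b j) = signs X S' r (m, m)] (mod int p)"
      using border_solution[of m "signs X S' r"] B(2) unfolding border_def by blast
    have mm: "signs X T r (m, m) = r (m, m)" for T
      using l by (intro signs_outside) (auto simp: X)
    let ?c = "\<lambda>j. a j - b j"
    let ?z = "reduce_vec m ?c"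
    have "[rowsum r m ?z i = w i] (mod int p)" if i: "i < m" for i
    proof -
      have "[rowsum r m a i - rowsum r m b i = ?x S r i - ?x S' r i] (mod int p)"
        using a(1) b(1) i by (intro cong_diff) (simp_all add: same)
      moreover have "?x S r i - ?x S' r i = w i" by (simp add: w_def s_def signs_def)
      ultimately have "[rowsum r m ?c i = w i] (mod int p)" by (simp add: rowsum_diff)
      with rowsum_reduce_vec show ?thesis by (rule cong_trans)
    qed
    moreover have "[(\<Sum>j<m. (?x S r j + ?x S' r j) * ?z j) = 0] (mod int p)"
    proof -
      have "[(\<Sum>j<m. (?x S r j + ?x S' r j) * ?z j) = (\<Sum>j<m. (?x S r j + ?x S' r j) * ?c j)] (mod int p)"
        by (intro cong_sum cong_scalar_left reduce_vec_cong) simp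
      also have "[(\<Sum>j<m. (?x S r j + ?x S' r j) * ?c j) = 0] (mod int p)"
        by (rule difference_of_solutions[of m r a _ "r (m, m)" b]) (use a b same mm in auto)
      finally show ?thesis .
    qed
    ultimately show ?thesis using ns reduce_vec_in_residue_vecs by blast
  qed
  have ign: "ignores ?D ?G"
    unfolding ignores_def
  proof (intro allI impI)
    fix r r' :: "nat \<times> nat \<Rightarrow> int" assume "\<forall>i. i \<notin> ?D \<longrightarrow> r i = r' i"
    then have "r x = r' x" if "x \<notin> UNIV \<times> {m}" for x using that Dm by blast
    from minor_cong(3)[OF this] minor_cong(4)[OF this] show "?G r = ?G r'" by simp
  qed
  obtain i0 where i0: "i0 < m" "\<not> int p dvd w i0"
  proof -
    obtain x where x: "x \<in> X" "x \<in> S \<longleftrightarrow> x \<notin> S'" using S by blast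
    then obtain i where i: "i < l" "x = (i, m)" by (auto simp: X)
    have "\<not> int p dvd 2" using p_gt_2 zdvd_not_zless[of 2 "int p"] by simp
    moreover have "w i = 2 \<or> w i = - 2" using x i by (auto simp: w_def s_def)
    ultimately have "\<not> int p dvd w i" by auto
    then show ?thesis using that[of i] i l by simp
  qed
  have step: "rprob ?D ?E r \<le> 2 / p" if G: "?G r" for r
  proof (cases "\<exists>z\<in>residue_vecs m. ?rows r z")
    case False
    have "\<not> ?E (signs ?D T r)" for T
    proof
      assume "?E (signs ?D T r)"
      then obtain z where "z \<in> residue_vecs m" "?rows (signs ?D T r) z" by blast
      then show False using False minor_cong(1)[of m "signs ?D T r" r, OF signs_column[OF Dm]] by auto
    qed
    then have "rprob ?D ?E r = 0" by (intro ravg_eq_const) auto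
    then show ?thesis by simp
  next
    case True
    then obtain z where z: "z \<in> residue_vecs m" "?rows r z" by blast
    have "\<exists>i<m. z i \<noteq> 0"
    proof (rule ccontr)
      assume "\<not> (\<exists>i<m. z i \<noteq> 0)"
      then have "rowsum r m z i0 = 0" by (simp add: rowsum_def)
      then show False using z(2) i0 by (metis cong_0_iff cong_sym)
    qed
    then have small: "lazy_prob {l..<m} z 0 < 2 / p"
      using G z unfolding structured_sol_def by (meson not_le)
    let ?c = "\<Sum>j<l. (s S (j, m) + s S' (j, m)) * z j"
    have "rprob ?D ?E r \<le> rprob ?D (\<lambda>r. [(\<Sum>j\<in>{l..<m}. r (?e j) * (z j * 2)) + ?c = 0] (mod int p)) r"
    proof (rule ravg_mono)
      fix T
      let ?r = "signs ?D T r"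
      have same: "rowsum ?r m u i = rowsum r m u i" if "i < m" for u i
        using minor_cong(1)[of m ?r r, OF signs_column[OF Dm] that] .
      have "[(\<Sum>j\<in>{l..<m}. ?r (?e j) * (z j * 2)) + ?c = 0] (mod int p)" if "?E ?r"
      proof -
        from that obtain u where u: "u \<in> residue_vecs m" "?rows ?r u" "[(\<Sum>j<m. (?x S ?r j + ?x S' ?r j) * u j) = 0] (mod int p)"
          by blast
        \<comment> \<open>the solution depends on the minor alone, so it survives the resampling of the column\<close>
        have "u = z"
        proof (rule residue_vecs_eqI[OF u(1) z(1)])
          have rows: "[rowsum r m u i = rowsum r m z i] (mod int p)" if i: "i < m" for i
            using u(2) z(2) i same[OF i] by (auto simp: cong_def)
          fix i assume "i < m"
          then show "[u i = z i] (mod int p)"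
            using nonsingular_unique[of m r u z i] G rows by blast
        qed
        have "(\<Sum>j<m. (?x S ?r j + ?x S' ?r j) * z j)
            = (\<Sum>j<l. (?x S ?r j + ?x S' ?r j) * z j) + (\<Sum>j\<in>{l..<m}. (?x S ?r j + ?x S' ?r j) * z j)"
          unfolding lessThan_atLeast0 using l by (intro sum.atLeastLessThan_concat[symmetric]) simp_all
        also have "(\<Sum>j<l. (?x S ?r j + ?x S' ?r j) * z j) = ?c"
          by (intro sum.cong refl) (auto simp: signs_def X s_def)
        also have "(\<Sum>j\<in>{l..<m}. (?x S ?r j + ?x S' ?r j) * z j) = (\<Sum>j\<in>{l..<m}. ?r (?e j) * (z j * 2))"
        proof (intro sum.cong refl)
          fix j assume "j \<in> {l..<m}"
          then have "(j, m) \<notin> X" by (auto simp: X)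
          then show "(?x S ?r j + ?x S' ?r j) * z j = ?r (?e j) * (z j * 2)" by simp
        qed
        finally show ?thesis using u(3) unfolding \<open>u = z\<close> by (simp only: add.commute)
      qed
      then show "of_bool (?E ?r) \<le> (of_bool [(\<Sum>j\<in>{l..<m}. ?r (?e j) * (z j * 2)) + ?c = 0] (mod int p) :: real)"
        by (cases "?E ?r") auto
    qed
    also have "\<dots> \<le> lazy_prob {l..<m} (\<lambda>j. z j * 2) 0"
      by (rule rprob_walk_le_lazy_prob) (auto simp: inj_on_def ignores_def)
    also have "\<dots> \<le> 2 / p" using small by (simp only: lazy_prob_double less_imp_le)
    finally show ?thesis .
  qed
  have "rprob ?V (\<lambda>r. border m (signs X S r) \<and> border m (signs X S' r)) r
      \<le> rprob ?V (\<lambda>r. structured_sol l m w r \<or> (?G r \<and> ?E r)) r"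
    by (rule rprob_mono) (use reduce in blast)
  also have "\<dots> \<le> rprob ?V (structured_sol l m w) r + rprob ?V (\<lambda>r. ?G r \<and> ?E r) r" by (rule rprob_disj)
  also have "\<dots> \<le> \<gamma> + 2 / p * rprob ?V ?G r"
    by (intro add_mono structured_sol rprob_conj_le[OF fV DV ign step])
  also have "\<dots> \<le> \<gamma> + 2 / p * 1"
    by (intro add_left_mono mult_left_mono rprob_le_1 fV) simp
  finally show ?thesis by simp
qed

text \<open>Cauchy-Schwarz over the entries outside \<open>X\<close> bounds the square of the probability by the average over pairs of sign
patterns on \<open>X\<close>; the pairs with equal patterns contribute \<open>1 / 2 ^ l\<close>.\<close>
lemma rprob_border:
  assumes U: "finite U" "pairs (Suc m) \<subseteq> U" and l: "l \<le> m"
    and structured_sol: "\<And>V w r. finite V \<Longrightarrow> pairs m \<subseteq> V \<Longrightarrow> rprob V (structured_sol l m w) r \<le> \<gamma>"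
  shows "rprob U (border m) r \<le> sqrt (1 / 2 ^ l + 2 / p + \<gamma>)"
proof -
  define X where "X = (\<lambda>i. (i, m)) ` {..<l}"
  let ?V = "U - X" and ?N = "2 ^ card X :: real"
  have cX: "card X = l" by (simp add: X_def card_image inj_on_def)
  have fX: "finite X" by (simp add: X_def)
  have XU: "X \<subseteq> U"
  proof -
    have "X \<subseteq> pairs (Suc m)" using l by (auto simp: X_def pairs_def)
    then show ?thesis using U(2) by blast
  qed
  have fV: "finite ?V" using U(1) by simp
  have pV: "pairs m \<subseteq> ?V"
  proof -
    have "pairs m \<subseteq> U" using pairs_mono[of m "Suc m"] U(2) by auto
    moreover have "pairs m \<inter> X = {}" by (auto simp: X_def pairs_def)
    ultimately show ?thesis by blast
  qed
  have \<gamma>0: "0 \<le> \<gamma> + 2 / p"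
    using order_trans[OF rprob_nonneg structured_sol[OF fV pV]] by simp
  let ?B = "\<lambda>S S' r. of_bool (border m (signs X S r)) * of_bool (border m (signs X S' r)) :: real"
  have "(rprob U (border m) r)\<^sup>2 = (ravg ?V (rprob X (border m)) r)\<^sup>2"
    using ravg_split[OF U(1) XU] by simp
  also have "\<dots> \<le> ravg ?V (\<lambda>r. (rprob X (border m) r)\<^sup>2) r" by (rule ravg_square_le[OF fV])
  also have "(\<lambda>r. (rprob X (border m) r)\<^sup>2) = (\<lambda>r. 1 / ?N\<^sup>2 * (\<Sum>S\<in>Pow X. \<Sum>S'\<in>Pow X. ?B S S' r))"
    unfolding ravg_def power_divide power2_eq_square[of "sum _ _"] sum_product by simp
  also have "ravg ?V (\<lambda>r. 1 / ?N\<^sup>2 * (\<Sum>S\<in>Pow X. \<Sum>S'\<in>Pow X. ?B S S' r)) r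
      = 1 / ?N\<^sup>2 * (\<Sum>S\<in>Pow X. \<Sum>S'\<in>Pow X. ravg ?V (?B S S') r)"
    by (simp only: ravg_cmult ravg_sum)
  also have "\<dots> \<le> 1 / ?N\<^sup>2 * (\<Sum>S\<in>Pow X. \<Sum>S'\<in>Pow X. (if S = S' then 1 else 0) + (\<gamma> + 2 / p))"
  proof (intro mult_left_mono sum_mono)
    fix S S' assume S: "S \<in> Pow X" "S' \<in> Pow X"
    show "ravg ?V (?B S S') r \<le> (if S = S' then 1 else 0) + (\<gamma> + 2 / p)"
    proof (cases "S = S'")
      case True
      have "ravg ?V (?B S S') r \<le> 1" by (rule ravg_bounds(2)[OF fV]) auto
      then show ?thesis using True \<gamma>0 by simp
    next
      case False
      have "rprob ?V (\<lambda>r. border m (signs X S r) \<and> border m (signs X S' r)) r \<le> \<gamma> + 2 / p"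
        by (rule rprob_border_pair[OF U l X_def _ _ False structured_sol[OF fV pV]]) (use S in auto)
      then show ?thesis using False by (simp add: of_bool_conj)
    qed
  qed simp
  also have "\<dots> = 1 / 2 ^ l + 2 / p + \<gamma>"
  proof -
    have "(\<Sum>S'\<in>Pow X. (if S = S' then 1 else 0) + (\<gamma> + 2 / p)) = 1 + ?N * (\<gamma> + 2 / p)" if "S \<in> Pow X" for S
      using that fX by (simp add: sum.distrib card_Pow)
    then have "(\<Sum>S\<in>Pow X. \<Sum>S'\<in>Pow X. (if S = S' then 1 else 0) + (\<gamma> + 2 / p)) = ?N * (1 + ?N * (\<gamma> + 2 / p))"
      using fX by (simp add: card_Pow)
    moreover have "1 / ?N\<^sup>2 * (?N * (1 + ?N * (\<gamma> + 2 / p))) = 1 / ?N + (\<gamma> + 2 / p)"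
      by (simp add: power2_eq_square field_simps)
    ultimately show ?thesis unfolding cX by simp
  qed
  finally show ?thesis by (rule real_le_rsqrt)
qed

lemma rprob_singular:
  assumes n: "0 < n" and l: "l \<le> n div 2" "l \<le> n - 1"
    and structured_sol: "\<And>m V w r. n div 2 \<le> m \<Longrightarrow> m < n \<Longrightarrow> finite V \<Longrightarrow> pairs m \<subseteq> V \<Longrightarrow> rprob V (structured_sol l m w) r \<le> \<gamma>"
    and \<gamma>: "0 \<le> \<gamma>"
  shows "rprob (pairs n) (singular n) r \<le> n * (\<gamma> + 2 / p) + sqrt (1 / 2 ^ l + 2 / p + \<gamma>)"
proof -
  let ?U = "pairs n"
  have U: "finite ?U" by (rule finite_pairs)
  have "rprob ?U (singular n) r \<le> rprob ?U (\<lambda>r. (\<exists>m\<in>{n div 2..<n}. stuck m r) \<or> border (n - 1) r) r"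
  proof (rule rprob_mono)
    fix r assume "singular n r"
    with singular_cases[OF this n] n show "(\<exists>m\<in>{n div 2..<n}. stuck m r) \<or> border (n - 1) r"
      by (auto simp: border_def)
  qed
  also have "\<dots> \<le> rprob ?U (\<lambda>r. \<exists>m\<in>{n div 2..<n}. stuck m r) r + rprob ?U (border (n - 1)) r"
    by (rule rprob_disj)
  also have "rprob ?U (\<lambda>r. \<exists>m\<in>{n div 2..<n}. stuck m r) r \<le> real (card {n div 2..<n}) * (\<gamma> + 2 / p)"
  proof (rule rprob_union_bound[where E' = stuck])
    fix m assume m: "m \<in> {n div 2..<n}"
    have sub: "pairs m \<subseteq> ?U" "pairs (Suc m) \<subseteq> ?U" using m by (auto intro!: pairs_mono)
    show "rprob ?U (stuck m) r \<le> \<gamma> + 2 / p"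
      by (rule rprob_stuck[OF U sub(2) structured_sol]) (use m sub U in auto)
  qed auto
  also have "\<dots> \<le> n * (\<gamma> + 2 / p)" using \<gamma> by (intro mult_right_mono) auto
  also have "rprob ?U (border (n - 1)) r \<le> sqrt (1 / 2 ^ l + 2 / p + \<gamma>)"
  proof (rule rprob_border[OF U _ l(2)])
    show "pairs (Suc (n - 1)) \<subseteq> ?U" using n by simp
    fix V w r assume "finite V" "pairs (n - 1) \<subseteq> V"
    then show "rprob V (structured_sol l (n - 1) w) r \<le> \<gamma>" using n by (intro structured_sol) auto
  qed
  finally show ?thesis by simp
qed

end

section \<open>A prime between the square root of a number and the number\<close>

text \<open>The numbers \<open>1 / (k * (N choose k))\<close> form the harmonic triangle of Leibniz, in which each entry is a difference of two
entries with smaller \<open>k\<close>. So multiplying by the least common multiple of the first column, which consists of the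
reciprocals \<open>1 / i\<close>, makes all of them integers.\<close>
lemma leibniz_dvd_Lcm: "k < N \<Longrightarrow> Suc k * (N choose Suc k) dvd Lcm {1..N}"
proof (induction k arbitrary: N)
  case 0
  then show ?case by (simp add: dvd_Lcm)
next
  case (Suc k)
  then obtain M where M: "N = Suc M" by (cases N) auto
  define L where "L = Lcm {1..N}"
  let ?k = "Suc k"
  have a: "?k * (M choose ?k) dvd L"
  proof -
    have "?k * (M choose ?k) dvd Lcm {1..M}" using Suc.prems M by (intro Suc.IH) simp
    also have "Lcm {1..M} dvd L" unfolding L_def M by (intro Lcm_subset) auto
    finally show ?thesis .
  qed
  have b: "?k * (N choose ?k) dvd L" unfolding L_def using Suc.prems by (intro Suc.IH) simp
  obtain x where x: "L = ?k * (M choose ?k) * x" using a by (rule dvdE)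
  obtain y where y: "L = ?k * (N choose ?k) * y" using b by (rule dvdE)
  define A where "A = real (M choose ?k)"
  define C where "C = real (N choose ?k)"
  define E where "E = Suc ?k * (N choose Suc ?k)"
  have k: "real ?k > 0" "real N - real ?k > 0" using Suc.prems by auto
  have CN: "real E = real N * A"
  proof -
    have "E = N * (M choose ?k)"
      unfolding E_def M using Suc_times_binomial_eq[of M ?k] by (simp only: mult.commute)
    then show ?thesis by (simp only: A_def of_nat_mult)
  qed
  have CA: "(real N - real ?k) * C = real N * A"
  proof -
    have "(N - ?k) * (N choose ?k) = N * (M choose ?k)"
      unfolding M using binomial_absorb_comp[of "Suc M" ?k] by simp
    then have "real ((N - ?k) * (N choose ?k)) = real (N * (M choose ?k))" by (simp only:)
    moreover have "real (N - ?k) = real N - real ?k" using Suc.prems by (intro of_nat_diff) simp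
    ultimately show ?thesis by (simp only: A_def C_def of_nat_mult)
  qed
  \<comment> \<open>the recurrence \<open>1 / E = 1 / (?k * A) - 1 / (?k * C)\<close> of the harmonic triangle, cleared of denominators\<close>
  have "real L = real E * (real x - real y)"
  proof -
    have Lx: "real L = real ?k * A * real x" unfolding A_def by (subst x) (simp only: of_nat_mult)
    have Ly: "real L = real ?k * C * real y" unfolding C_def by (subst y) (simp only: of_nat_mult)
    have "real ?k * (real E * real x) = real N * real L" unfolding CN Lx by (simp only: mult_ac)
    moreover have "real ?k * (real E * real y) = (real N - real ?k) * real L"
      unfolding CN CA[symmetric] Ly by (simp only: mult_ac)
    ultimately have "real ?k * (real E * (real x - real y)) = real N * real L - (real N - real ?k) * real L"
      by (simp only: right_diff_distrib)
    also have "\<dots> = real ?k * real L" by (simp add: left_diff_distrib)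
    finally show ?thesis using k by simp
  qed
  then have "real_of_int (int L) = real_of_int (int E * (int x - int y))" by simp
  then have "int L = int E * (int x - int y)" by (simp only: of_int_eq_iff)
  then have "int E dvd int L" by (rule dvdI)
  then show ?case unfolding E_def L_def by (simp only: int_dvd_int_iff)
qed

lemma Lcm_pos: "0 < Lcm {1..N::nat}"
  by (simp add: Lcm_0_iff_nat neq0_conv[symmetric])

text \<open>Each binomial coefficient in row \<open>N\<close> is at most the least common multiple, and they add up to \<open>2 ^ N\<close>.\<close>
lemma power_le_Lcm: "2 ^ N \<le> (N + 1) * Lcm {1..N}"
proof -
  have "N choose k \<le> Lcm {1..N}" if "k \<le> N" for k
  proof (cases k)
    case 0
    then show ?thesis using Lcm_pos[of N] by simp
  next
    case (Suc i)
    have "Suc i * (N choose Suc i) \<le> Lcm {1..N}"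
      using that Suc Lcm_pos by (intro dvd_imp_le leibniz_dvd_Lcm) auto
    moreover have "1 * (N choose Suc i) \<le> Suc i * (N choose Suc i)" by (intro mult_le_mono1) simp
    ultimately show ?thesis using Suc by simp
  qed
  then have "(\<Sum>k\<le>N. N choose k) \<le> (\<Sum>k\<le>N. Lcm {1..N})" by (intro sum_mono) auto
  then show ?thesis by (simp add: choose_row_sum)
qed

text \<open>Each prime power that divides the least common multiple exactly already divides some number up to \<open>N\<close>.\<close>
lemma Lcm_le_power: "Lcm {1..N} \<le> N ^ card {p. prime p \<and> p \<le> (N::nat)}"
proof (cases "N = 0")
  case False
  let ?P = "{p::nat. prime p \<and> p \<le> N}"
  let ?g = "\<lambda>p. Max ((\<lambda>i. multiplicity p i) ` {1..N})"
  have fP: "finite ?P" by (rule finite_subset[of _ "{..N}"]) auto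
  have "Lcm {1..N} dvd (\<Prod>p\<in>?P. p ^ ?g p)"
  proof (rule Lcm_least)
    fix i assume i: "i \<in> {1..N}"
    have "i = (\<Prod>p\<in>prime_factors i. p ^ multiplicity p i)"
      using i by (intro prime_factorization_nat) simp
    also have "\<dots> dvd (\<Prod>p\<in>?P. p ^ ?g p)"
    proof (rule prod_dvd_prod_subset2[OF fP])
      show "prime_factors i \<subseteq> ?P"
      proof
        fix q assume "q \<in> prime_factors i"
        then have "prime q" "q dvd i" by auto
        then show "q \<in> ?P" using i dvd_imp_le[of q i] by auto
      qed
      fix q assume "q \<in> prime_factors i"
      show "q ^ multiplicity q i dvd q ^ ?g q"
        using i by (intro le_imp_power_dvd Max_ge) auto
    qed
    finally show "i dvd (\<Prod>p\<in>?P. p ^ ?g p)" .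
  qed
  moreover have "0 < (\<Prod>p\<in>?P. p ^ ?g p)" by (intro prod_pos) (auto simp: prime_gt_0_nat)
  ultimately have "Lcm {1..N} \<le> (\<Prod>p\<in>?P. p ^ ?g p)" by (intro dvd_imp_le)
  also have "\<dots> \<le> (\<Prod>p\<in>?P. N)"
  proof (intro prod_mono conjI)
    fix q assume "q \<in> ?P"
    have "?g q \<in> (\<lambda>i. multiplicity q i) ` {1..N}" using False by (intro Max_in) auto
    then obtain i where i: "i \<in> {1..N}" "?g q = multiplicity q i" by auto
    have "q ^ multiplicity q i \<le> i" using i by (intro dvd_imp_le multiplicity_dvd) auto
    then show "q ^ ?g q \<le> N" using i by simp
  qed simp
  finally show ?thesis by simp
next
  case True
  then have "{p. prime p \<and> p \<le> N} = {}" by auto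
  then show ?thesis using True by (simp only: card.empty) simp
qed

text \<open>Without such a prime there are at most \<open>sqrt X\<close> primes up to \<open>X\<close>, and the least common multiple of the numbers up to \<open>X\<close>
would be at most \<open>X powr sqrt X\<close>, far less than \<open>2 powr X\<close>.\<close>
lemma prime_between_sqrt:
  "eventually (\<lambda>X. \<exists>p. prime p \<and> sqrt X < real p \<and> real p \<le> X) at_top"
proof -
  have "eventually (\<lambda>X::real. X \<ge> 1 \<and> ln (X + 1) + sqrt X * ln X < (X - 1) * ln 2) at_top"
    by (intro eventually_conj) real_asymp+
  then show ?thesis
  proof eventually_elim
    case (elim X)
    define N where "N = nat \<lfloor>X\<rfloor>"
    have N: "real N \<le> X" "X - 1 < real N" "1 \<le> real N"
    proof -
      have "1 \<le> \<lfloor>X\<rfloor>" using elim by simp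
      then have "real N = of_int \<lfloor>X\<rfloor>" "1 \<le> real_of_int \<lfloor>X\<rfloor>" by (auto simp: N_def)
      then show "real N \<le> X" "X - 1 < real N" "1 \<le> real N" by linarith+
    qed
    show ?case
    proof (rule ccontr)
      assume no: "\<nexists>p. prime p \<and> sqrt X < real p \<and> real p \<le> X"
      have "{p. prime p \<and> p \<le> N} \<subseteq> {1..nat \<lfloor>sqrt X\<rfloor>}"
      proof
        fix q assume "q \<in> {p. prime p \<and> p \<le> N}"
        then have q: "prime q" "real q \<le> X" using N by auto
        then have "real q \<le> sqrt X" using no by (meson not_le)
        then show "q \<in> {1..nat \<lfloor>sqrt X\<rfloor>}" using prime_gt_0_nat[OF q(1)] by (simp add: le_nat_floor)
      qed
      then have "card {p. prime p \<and> p \<le> N} \<le> card {1..nat \<lfloor>sqrt X\<rfloor>}" by (intro card_mono) auto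
      then have "real (card {p. prime p \<and> p \<le> N}) \<le> real (nat \<lfloor>sqrt X\<rfloor>)" by simp
      also have "\<dots> \<le> sqrt X" using elim by (intro of_nat_floor) simp
      finally have c: "real (card {p. prime p \<and> p \<le> N}) \<le> sqrt X" .
      have "2 ^ N \<le> (N + 1) * N ^ card {p. prime p \<and> p \<le> N}"
        using power_le_Lcm[of N] Lcm_le_power[of N] by (meson le_trans mult_le_mono2)
      then have "real (2 ^ N) \<le> real ((N + 1) * N ^ card {p. prime p \<and> p \<le> N})" by (simp only: of_nat_le_iff)
      then have "2 ^ N \<le> (real N + 1) * real N ^ card {p. prime p \<and> p \<le> N}"
        by (simp only: of_nat_mult of_nat_power of_nat_add of_nat_numeral of_nat_1)
      then have "ln (2 ^ N) \<le> ln ((real N + 1) * real N ^ card {p. prime p \<and> p \<le> N})"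
        using N by (intro ln_mono) auto
      then have "N * ln 2 \<le> ln (real N + 1) + card {p. prime p \<and> p \<le> N} * ln N"
        using N by (simp add: ln_mult ln_realpow)
      also have "\<dots> \<le> ln (X + 1) + sqrt X * ln X"
        using N c by (intro add_mono mult_mono ln_mono) auto
      also have "\<dots> < (X - 1) * ln 2" using elim by simp
      also have "\<dots> \<le> N * ln 2" using N by (intro mult_right_mono) auto
      finally show False by simp
    qed
  qed
qed

section \<open>From real determinants to kernels modulo a prime\<close>

definition sign_mat :: "nat \<Rightarrow> (nat \<times> nat \<Rightarrow> int) \<Rightarrow> real mat" where
  "sign_mat n r = mat n n (\<lambda>(i, j). real_of_int (entry r i j))"

text \<open>Dividing an integer kernel vector by the gcd of its entries leaves an entry that is not divisible by \<open>p\<close>.\<close>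
lemma (in odd_prime) det_zero_imp_singular:
  assumes "Determinant.det (sign_mat n r) = 0"
  shows "singular n r"
proof -
  let ?B = "mat n n (\<lambda>(i, j). entry r i j)"
  have "sign_mat n r = map_mat real_of_int ?B" by (auto simp: sign_mat_def)
  then have "Determinant.det ?B = 0" using assms by (simp add: of_int_hom.hom_det)
  then obtain v where v: "v \<in> carrier_vec n" "v \<noteq> 0\<^sub>v n" "?B *\<^sub>v v = 0\<^sub>v n"
    using det_0_iff_vec_prod_zero[of ?B n] by auto
  have rows: "rowsum r n (\<lambda>j. v $ j) i = 0" if "i < n" for i
  proof -
    have "(?B *\<^sub>v v) $ i = rowsum r n (\<lambda>j. v $ j) i"
      using that v(1) by (simp add: scalar_prod_def rowsum_def lessThan_atLeast0)
    then show ?thesis using v(3) that by simp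
  qed
  let ?V = "(\<lambda>i. v $ i) ` {..<n}"
  let ?g = "Gcd ?V"
  have g0: "?g \<noteq> 0"
  proof
    assume "?g = 0"
    then have "\<forall>i<n. v $ i = 0" by (auto simp: Gcd_0_iff)
    then show False using v(1,2) by (auto intro!: eq_vecI)
  qed
  let ?u = "\<lambda>i. v $ i div ?g"
  have gu: "v $ i = ?g * ?u i" if "i < n" for i
    using that by (simp add: Gcd_dvd)
  have "rowsum r n (\<lambda>j. v $ j) i = ?g * rowsum r n ?u i" for i
  proof -
    have "rowsum r n (\<lambda>j. v $ j) i = rowsum r n (\<lambda>j. ?g * ?u j) i"
      unfolding rowsum_def using gu by (intro sum.cong refl arg_cong2[of _ _ _ _ "(*)"]) auto
    then show ?thesis by (simp only: rowsum_cmult)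
  qed
  then have ur: "rowsum r n ?u i = 0" if "i < n" for i using rows[OF that] g0 by simp
  have "\<exists>i<n. \<not> int p dvd ?u i"
  proof (rule ccontr)
    assume "\<not> ?thesis"
    then have all: "int p dvd ?u i" if "i < n" for i using that by blast
    \<comment> \<open>otherwise \<open>p\<close> times the gcd would be a common divisor\<close>
    have "?g * int p dvd ?g"
    proof (rule Gcd_greatest)
      fix x assume "x \<in> ?V"
      then obtain i where i: "i < n" "x = v $ i" by auto
      show "?g * int p dvd x" unfolding i(2) using gu[OF i(1)] all[OF i(1)] by (metis dvd_refl mult_dvd_mono)
    qed
    then have "int p dvd 1" using g0 by (metis dvd_mult_cancel_left mult.right_neutral)
    then show False using p_gt_2 by simp
  qed
  then obtain i where "i < n" "\<not> int p dvd ?u i" by blast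
  then show ?thesis using ur by (intro singularI[of n r ?u]) auto
qed

lemma sign_mat_bij:
  "bij_betw (\<lambda>S. sign_mat n (signs (pairs n) S r)) (Pow (pairs n)) (sym_sign_mats n)"
proof -
  let ?M = "\<lambda>S. sign_mat n (signs (pairs n) S r)"
  have entry: "?M S $$ (i, j) = (if (min i j, max i j) \<in> S then 1 else - 1)" if "i < n" "j < n" for S i j
  proof -
    have "(min i j, max i j) \<in> pairs n" using that by (auto simp: pairs_def)
    then show ?thesis using that by (simp add: sign_mat_def entry_def signs_def)
  qed
  have inj: "inj_on ?M (Pow (pairs n))"
  proof (rule inj_onI)
    fix S T assume ST: "S \<in> Pow (pairs n)" "T \<in> Pow (pairs n)" "?M S = ?M T"
    have "x \<in> S \<longleftrightarrow> x \<in> T" if "x \<in> pairs n" for x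
    proof -
      obtain i j where x: "x = (i, j)" "i \<le> j" "j < n" using \<open>x \<in> pairs n\<close> by (auto simp: pairs_def)
      then have "?M S $$ (i, j) = ?M T $$ (i, j)" using ST(3) by simp
      then show ?thesis using x entry[of i j S] entry[of i j T] by (simp add: min_absorb1 max_absorb2 split: if_splits)
    qed
    then show "S = T" using ST(1,2) by blast
  qed
  have "?M ` Pow (pairs n) = sym_sign_mats n"
  proof
    show "?M ` Pow (pairs n) \<subseteq> sym_sign_mats n"
    proof clarify
      fix S assume "S \<subseteq> pairs n"
      have "transpose_mat (?M S) = ?M S"
        by (auto simp: sign_mat_def entry_def min.commute max.commute intro!: eq_matI)
      moreover have "?M S \<in> carrier_mat n n" by (simp add: sign_mat_def)
      ultimately show "?M S \<in> sym_sign_mats n" by (simp add: sym_sign_mats_def entry)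
    qed
    show "sym_sign_mats n \<subseteq> ?M ` Pow (pairs n)"
    proof
      fix A assume A: "A \<in> sym_sign_mats n"
      then have c: "A \<in> carrier_mat n n" and t: "transpose_mat A = A"
        and s: "\<And>i j. i < n \<Longrightarrow> j < n \<Longrightarrow> A $$ (i, j) \<in> {-1, 1}" by (auto simp: sym_sign_mats_def)
      have sym: "A $$ (j, i) = A $$ (i, j)" if "i < n" "j < n" for i j
        using that c by (metis t carrier_matD index_transpose_mat(1))
      let ?S = "{x \<in> pairs n. A $$ x = 1}"
      have "A = ?M ?S"
      proof (rule eq_matI)
        fix i j assume "i < dim_row (?M ?S)" "j < dim_col (?M ?S)"
        then have ij: "i < n" "j < n" by (auto simp: sign_mat_def)
        have "(min i j, max i j) \<in> pairs n" using ij by (auto simp: pairs_def)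
        then have "?M ?S $$ (i, j) = (if A $$ (min i j, max i j) = 1 then 1 else - 1)"
          using entry[OF ij] by simp
        also have "A $$ (min i j, max i j) = A $$ (i, j)"
          using sym[OF ij] by (simp add: min_def max_def)
        also have "(if A $$ (i, j) = 1 then 1 else - 1) = A $$ (i, j)" using s[OF ij] by auto
        finally show "A $$ (i, j) = ?M ?S $$ (i, j)" ..
      qed (use c in \<open>auto simp: sign_mat_def\<close>)
      then show "A \<in> ?M ` Pow (pairs n)" by blast
    qed
  qed
  with inj show ?thesis by (simp add: bij_betw_def)
qed

lemma (in odd_prime) prob_det_zero_le:
  "measure_pmf.prob (pmf_of_set (sym_sign_mats n)) {M. Determinant.det M = 0} \<le> rprob (pairs n) (singular n) r"
proof -
  let ?M = "\<lambda>S. sign_mat n (signs (pairs n) S r)"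
  let ?Z = "{S \<in> Pow (pairs n). Determinant.det (?M S) = 0}"
  note bij = sign_mat_bij[of n r]
  have img: "sym_sign_mats n = ?M ` Pow (pairs n)" and inj: "inj_on ?M (Pow (pairs n))"
    using bij by (simp_all add: bij_betw_def)
  have "sym_sign_mats n \<inter> {M. Determinant.det M = 0} = ?M ` ?Z"
    unfolding img by auto
  moreover have "inj_on ?M ?Z" by (rule inj_on_subset[OF inj]) auto
  ultimately have "card (sym_sign_mats n \<inter> {M. Determinant.det M = 0}) = card ?Z"
    by (simp only: card_image)
  moreover have "card (sym_sign_mats n) = 2 ^ card (pairs n)"
    using bij_betw_same_card[OF bij] finite_pairs by (simp add: card_Pow)
  ultimately have "measure_pmf.prob (pmf_of_set (sym_sign_mats n)) {M. Determinant.det M = 0}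
      = card ?Z / 2 ^ card (pairs n)"
    by (simp add: measure_pmf_of_set[OF sym_sign_mats_nonempty finite_sym_sign_mats])
  also have "real (card ?Z) = (\<Sum>S\<in>Pow (pairs n). of_bool (Determinant.det (?M S) = 0))"
    using finite_pairs by (simp add: Int_def of_bool_def sum.If_cases)
  also have "\<dots> \<le> (\<Sum>S\<in>Pow (pairs n). of_bool (singular n (signs (pairs n) S r)))"
    by (intro sum_mono) (auto dest: det_zero_imp_singular)
  finally show ?thesis by (simp add: ravg_def divide_right_mono)
qed

section \<open>Choice of parameters\<close>

text \<open>The logarithm of the upper bound for the prime modulus. The constant has to be small enough for \<open>18 * (log_modulus x)\<^sup>2\<close>
to lose against the gain of order \<open>x * ln x\<close> in \<open>dense_solutions\<close>, and large enough for the final bound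
\<open>exp (- log_modulus x / 8)\<close>, which is \<open>exp (- sqrt (x * ln x) / 2 ^ 13)\<close>.\<close>
definition log_modulus :: "real \<Rightarrow> real" where
  "log_modulus x = sqrt (x * ln x) / 1024"

text \<open>A bound for \<open>k * D + l\<close>, the number of coordinates outside the reach of the gain, where \<open>k \<le> x powr (1 / 4)\<close>,
\<open>D \<le> 8 * log_modulus x + 1\<close> and \<open>l \<le> 2 * log_modulus x + 1\<close>.\<close>
definition exceptional_size :: "real \<Rightarrow> real" where
  "exceptional_size x = x powr (1 / 4) * (8 * log_modulus x + 1) + 2 * log_modulus x + 1"

text \<open>The conditions on the size of the matrix: in this order they provide slack (two
conditions), bound \<open>k\<close>, keep exceptional
coordinates few, beat the sparse solutions, make the gain per row less than 1, beat the dense solutions, absorb the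
polynomial factors of the final bound, and make the prime odd.\<close>
lemma large_parameters:
  "eventually (\<lambda>x. 10 \<le> x \<and> 128 \<le> ln x \<and>
     1 + ln x / 2 * exp (ln 4 * (ln x / 16)) \<le> x powr (1 / 4) \<and>
     exceptional_size x \<le> x / 16 \<and>
     exceptional_size x * ln (4 * (x + 1)) + log_modulus x - (x / 2 - 1 - 2 * exceptional_size x) / 8 \<le> - ln 2 - log_modulus x \<and>
     ln 12 + 1 / 3 - ln x / 48 \<le> 0 \<and>
     x * ln 16 + (18 * log_modulus x + 3) * log_modulus x + x / 3 * (ln 12 + 1 / 3 - ln x / 48) \<le> - ln 2 - log_modulus x \<and>
     x * (3 * exp (- log_modulus x / 2)) + 2 * exp (- log_modulus x / 4) \<le> exp (- log_modulus x / 8) \<and>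
     2 \<le> exp (log_modulus x / 2)) at_top"
  unfolding log_modulus_def exceptional_size_def
  by (intro eventually_conj; real_asymp)

lemma power_le_exp: "0 \<le> (b::real) \<Longrightarrow> b \<le> exp c \<Longrightarrow> b ^ k \<le> exp (real k * c)"
  by (metis exp_of_nat_mult power_mono)

text \<open>The parameters are \<open>j\<close> about \<open>ln x / 16\<close>, so that \<open>k\<close> is a small power of \<open>x\<close>; \<open>D\<close> about \<open>8 * ln p\<close>, so that
\<open>(8/7) ^ D \<ge> p\<close>; and \<open>l\<close> about \<open>2 * ln p\<close>, so that \<open>2 ^ l \<ge> p\<close>.\<close>
lemma (in odd_prime) rprob_singular_le:
  assumes x: "x = real n" "10 \<le> x" "128 \<le> ln x"
    and k_bound: "1 + ln x / 2 * exp (ln 4 * (ln x / 16)) \<le> x powr (1 / 4)"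
    and e_small: "exceptional_size x \<le> x / 16"
    and sparse: "exceptional_size x * ln (4 * (x + 1)) + log_modulus x - (x / 2 - 1 - 2 * exceptional_size x) / 8 \<le> - ln 2 - log_modulus x"
    and q_small: "ln 12 + 1 / 3 - ln x / 48 \<le> 0"
    and dense: "x * ln 16 + (18 * log_modulus x + 3) * log_modulus x + x / 3 * (ln 12 + 1 / 3 - ln x / 48) \<le> - ln 2 - log_modulus x"
    and final: "x * (3 * exp (- log_modulus x / 2)) + 2 * exp (- log_modulus x / 4) \<le> exp (- log_modulus x / 8)"
    and p: "exp (log_modulus x / 2) < p" "p \<le> exp (log_modulus x)"
  shows "rprob (pairs n) (singular n) r \<le> exp (- log_modulus x / 8)"
proof -
  define P where "P = ln (real p)"
  define e where "e = exceptional_size x"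
  define G where "G = ln 12 + 1 / 3 - ln x / 48"
  have pP: "real p = exp P" using p_pos by (simp add: P_def)
  have P: "0 < P" "P \<le> log_modulus x"
  proof -
    show "0 < P" using p_gt_2 by (simp add: P_def)
    have "P \<le> ln (exp (log_modulus x))" unfolding P_def using p(2) p_pos by (intro ln_mono) auto
    then show "P \<le> log_modulus x" by simp
  qed
  define j where "j = nat \<lfloor>ln x / 16\<rfloor>"
  define D where "D = nat \<lceil>8 * P\<rceil>"
  define l where "l = nat \<lceil>2 * P\<rceil>"
  define k where "k = 1 + 8 * j * 4 ^ j"
  define s where "s = k * D + l"
  define q :: real where "q = 12 * (2 / 3) ^ j"
  have j: "real j \<le> ln x / 16" "ln x / 16 - 1 \<le> real j"
  proof -
    have "0 \<le> \<lfloor>ln x / 16\<rfloor>" using x by simp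
    then have "real j = of_int \<lfloor>ln x / 16\<rfloor>" by (simp add: j_def)
    then show "real j \<le> ln x / 16" "ln x / 16 - 1 \<le> real j" by linarith+
  qed
  have D: "8 * P \<le> real D" "real D \<le> 8 * log_modulus x + 1"
  proof -
    have "real D = of_int \<lceil>8 * P\<rceil>" using P by (simp add: D_def)
    then show "8 * P \<le> real D" "real D \<le> 8 * log_modulus x + 1" using P(2) by linarith+
  qed
  have l: "2 * P \<le> real l" "real l \<le> 2 * log_modulus x + 1"
  proof -
    have "real l = of_int \<lceil>2 * P\<rceil>" using P by (simp add: l_def)
    then show "2 * P \<le> real l" "real l \<le> 2 * log_modulus x + 1" using P(2) by linarith+
  qed
  have k: "real k \<le> x powr (1 / 4)"
  proof -
    have "real k = 1 + 8 * real j * 4 ^ j" by (simp add: k_def)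
    also have "\<dots> \<le> 1 + 8 * (ln x / 16) * exp (ln 4 * (ln x / 16))"
    proof (intro add_left_mono mult_mono)
      have "(4::real) ^ j \<le> exp (real j * ln 4)" by (rule power_le_exp) auto
      also have "\<dots> \<le> exp (ln 4 * (ln x / 16))"
        using j(1) mult_left_mono[OF j(1), of "ln 4"] by (simp add: mult.commute)
      finally show "(4::real) ^ j \<le> exp (ln 4 * (ln x / 16))" .
    qed (use j x in auto)
    finally show ?thesis using k_bound by simp
  qed
  have s: "real s \<le> e"
  proof -
    have "real s = real k * real D + real l" by (simp add: s_def)
    also have "\<dots> \<le> x powr (1 / 4) * (8 * log_modulus x + 1) + (2 * log_modulus x + 1)"
      using k D l by (intro add_mono mult_mono) auto
    finally show ?thesis by (simp add: e_def exceptional_size_def)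
  qed
  have e: "0 \<le> e" "e \<le> x / 16" using s e_small by (auto simp: e_def)
  have ls: "l \<le> s" by (simp add: s_def)
  have lx: "real l \<le> x / 16" using ls s e by linarith
  have D_large: "real p \<le> (8 / 7) ^ D"
  proof -
    have "ln (7 / 8 :: real) \<le> 7 / 8 - 1" by (rule ln_le_minus_one) simp
    moreover have "ln (8 / 7 :: real) = - ln (7 / 8)" by (simp add: ln_div)
    ultimately have "1 / 8 \<le> ln (8 / 7 :: real)" by simp
    then have "real D * (1 / 8) \<le> real D * ln (8 / 7)" by (intro mult_left_mono) auto
    then have "P \<le> real D * ln (8 / 7)" using D(1) by linarith
    then have "exp P \<le> exp (real D * ln (8 / 7))" by simp
    also have "\<dots> = (8 / 7) ^ D" by (simp add: exp_of_nat_mult)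
    finally show ?thesis by (simp add: pP)
  qed
  have q: "0 \<le> q" "q \<le> exp G"
  proof -
    show "0 \<le> q" by (simp add: q_def)
    have "(2 / 3 :: real) \<le> exp (- 1 / 3)" using exp_ge_add_one_self[of "- 1 / 3"] by simp
    then have "(2 / 3 :: real) ^ j \<le> exp (real j * (- 1 / 3))" by (intro power_le_exp) auto
    also have "\<dots> \<le> exp (1 / 3 - ln x / 48)" using j(2) by simp
    finally have "q \<le> exp (ln 12) * exp (1 / 3 - ln x / 48)" by (simp add: q_def)
    also have "\<dots> = exp G" by (simp only: G_def exp_add[symmetric] add_diff_eq)
    finally show "q \<le> exp G" .
  qed
  have q1: "q \<le> 1" using q(2) q_small by (simp add: G_def order_trans)
  have lazy_prob_structured_sol: "rprob V (structured_sol l m w) r \<le> exp (- log_modulus x)"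
    if m: "n div 2 \<le> m" "m < n" and V: "finite V" "pairs m \<subseteq> V" for m V w r
  proof -
    have mx: "x / 2 - 1 \<le> real m" "real m \<le> x" using m by (auto simp: x)
    have sm: "2 * real s \<le> real m" using s e mx x(2) by linarith
    then have sm': "2 * s \<le> m" by linarith
    have decay: "(7 / 8 :: real) ^ (m - 2 * s) \<le> exp (- (x / 2 - 1 - 2 * e) / 8)"
    proof -
      have "(7 / 8 :: real) \<le> exp (- 1 / 8)" using exp_ge_add_one_self[of "- 1 / 8"] by simp
      then have "(7 / 8 :: real) ^ (m - 2 * s) \<le> exp (real (m - 2 * s) * (- 1 / 8))" by (intro power_le_exp) auto
      also have "\<dots> \<le> exp (- (x / 2 - 1 - 2 * e) / 8)"
      proof -
        have "real (m - 2 * s) = real m - 2 * real s" using sm' by (simp add: of_nat_diff)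
        then have "x / 2 - 1 - 2 * e \<le> real (m - 2 * s)" using mx s by linarith
        moreover have "t * (- 1 / 8) \<le> - y / 8" if "y \<le> t" for t y :: real using that by simp
        ultimately show ?thesis unfolding exp_le_cancel_iff by blast
      qed
      finally show ?thesis .
    qed
    have pdecay: "p * (7 / 8) ^ (m - 2 * s) \<le> exp (log_modulus x - (x / 2 - 1 - 2 * e) / 8)"
    proof -
      have "p * (7 / 8) ^ (m - 2 * s) \<le> exp (log_modulus x) * exp (- (x / 2 - 1 - 2 * e) / 8)"
        using p(2) decay by (intro mult_mono) auto
      also have "\<dots> = exp (log_modulus x + - (x / 2 - 1 - 2 * e) / 8)" by (rule exp_add[symmetric])
      also have "log_modulus x + - (x / 2 - 1 - 2 * e) / 8 = log_modulus x - (x / 2 - 1 - 2 * e) / 8" by linarith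
      finally show ?thesis .
    qed
    have ln4: "0 \<le> ln (4 * (x + 1))" using x(2) by simp
    have small: "p * (7 / 8) ^ (m - 2 * s) \<le> (1 :: real)"
    proof -
      have "0 \<le> e * ln (4 * (x + 1))" using e ln4 by simp
      then have "log_modulus x - (x / 2 - 1 - 2 * e) / 8 \<le> 0" using sparse[folded e_def] P ln2_ge_two_thirds by linarith
      then have "exp (log_modulus x - (x / 2 - 1 - 2 * e) / 8) \<le> 1" by simp
      with pdecay show ?thesis by (rule order_trans)
    qed
    have sparse_m: "(4 * (real m + 1)) ^ s * (p * (7 / 8) ^ (m - 2 * s)) \<le> exp (- ln 2 - log_modulus x)"
    proof -
      have "(4 * (real m + 1)) ^ s \<le> exp (real s * ln (4 * (x + 1)))"
        using mx x(2) by (intro power_le_exp) auto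
      also have "\<dots> \<le> exp (e * ln (4 * (x + 1)))" using s ln4 by (simp add: mult_right_mono)
      finally have "(4 * (real m + 1)) ^ s * (p * (7 / 8) ^ (m - 2 * s))
          \<le> exp (e * ln (4 * (x + 1))) * exp (log_modulus x - (x / 2 - 1 - 2 * e) / 8)"
        using pdecay by (intro mult_mono) auto
      also have "\<dots> \<le> exp (- ln 2 - log_modulus x)"
        using sparse by (simp add: exp_add[symmetric] e_def)
      finally show ?thesis .
    qed
    have dense_m: "8 ^ m * (p ^ (l + 2 * D) * (2 ^ m * q ^ (m - s))) \<le> exp (- ln 2 - log_modulus x)"
    proof -
      have a: "(16::real) ^ m \<le> exp (x * ln 16)"
      proof -
        have "(16::real) ^ m \<le> exp (real m * ln 16)" by (rule power_le_exp) auto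
        also have "\<dots> \<le> exp (x * ln 16)" using mx by simp
        finally show ?thesis .
      qed
      have b: "real p ^ (l + 2 * D) \<le> exp ((18 * log_modulus x + 3) * log_modulus x)"
      proof -
        have "real p ^ (l + 2 * D) \<le> exp (real (l + 2 * D) * P)" by (rule power_le_exp) (auto simp: pP)
        also have "real (l + 2 * D) * P \<le> (18 * log_modulus x + 3) * log_modulus x"
          using l D P by (intro mult_mono) auto
        finally show ?thesis by simp
      qed
      have c: "q ^ (m - s) \<le> exp (x / 3 * G)"
      proof -
        have "q ^ (m - s) \<le> exp (real (m - s) * G)" using q by (rule power_le_exp)
        also have "real (m - s) * G \<le> x / 3 * G"
        proof (rule mult_right_mono_neg)
          have "real (m - s) = real m - real s" using sm' by (simp add: of_nat_diff)
          then show "x / 3 \<le> real (m - s)" using mx s e x(2) by linarith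
        qed (use q_small in \<open>simp add: G_def\<close>)
        finally show ?thesis by simp
      qed
      have "8 ^ m * (p ^ (l + 2 * D) * (2 ^ m * q ^ (m - s))) = 16 ^ m * real p ^ (l + 2 * D) * q ^ (m - s)"
      proof -
        have "(16::real) ^ m = 8 ^ m * 2 ^ m" by (simp add: power_mult_distrib[symmetric])
        then show ?thesis by (simp only: mult_ac of_nat_power)
      qed
      also have "\<dots> \<le> exp (x * ln 16) * exp ((18 * log_modulus x + 3) * log_modulus x) * exp (x / 3 * G)"
        using a b c q(1) by (intro mult_mono) auto
      also have "\<dots> \<le> exp (- ln 2 - log_modulus x)"
        using dense by (simp add: exp_add[symmetric] G_def)
      finally show ?thesis .
    qed
    have "rprob V (structured_sol l m w) r \<le> (4 * (real m + 1)) ^ s * (p * (7 / 8) ^ (m - 2 * s))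
        + 8 ^ m * (p ^ (l + 2 * D) * (2 ^ m * q ^ (m - s)))"
      unfolding q_def
      by (rule rprob_structured_sol[OF V D_large _ _ _ sm' small])
        (use q1 ls sm' in \<open>auto simp: q_def s_def k_def\<close>)
    also have "\<dots> \<le> exp (- ln 2 - log_modulus x) + exp (- ln 2 - log_modulus x)"
      by (rule add_mono[OF sparse_m dense_m])
    also have "\<dots> = exp (- log_modulus x)" by (simp add: exp_diff exp_minus field_simps)
    finally show ?thesis .
  qed
  have n: "0 < n" "l \<le> n div 2" "l \<le> n - 1"
  proof -
    show "0 < n" using x by simp
    have "16 * real l \<le> real n" using lx x(1) by simp
    then have "16 * l \<le> n" by linarith
    then show "l \<le> n div 2" "l \<le> n - 1" using \<open>0 < n\<close> by linarith+
  qed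
  let ?h = "exp (- log_modulus x / 2)"
  have inv_p: "1 / real p \<le> ?h"
  proof -
    have "1 / real p \<le> 1 / exp (log_modulus x / 2)" using p p_pos by (intro divide_left_mono) auto
    then show ?thesis by (simp add: exp_minus inverse_eq_divide)
  qed
  have inv_2l: "1 / 2 ^ l \<le> ?h"
  proof -
    have "1 / 2 * real l \<le> ln 2 * real l" using ln2_ge_two_thirds by (intro mult_right_mono) auto
    then have "P \<le> real l * ln 2" using l(1) by (simp add: mult.commute)
    then have "exp P \<le> exp (real l * ln 2)" by simp
    then have "real p \<le> 2 ^ l" by (simp add: pP exp_of_nat_mult)
    then have "1 / 2 ^ l \<le> 1 / real p" using p_pos by (intro divide_left_mono) auto
    with inv_p show ?thesis by simp
  qed
  have gam: "exp (- log_modulus x) \<le> ?h" using P by simp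
  have "rprob (pairs n) (singular n) r
      \<le> n * (exp (- log_modulus x) + 2 / p) + sqrt (1 / 2 ^ l + 2 / p + exp (- log_modulus x))"
    by (rule rprob_singular[OF n lazy_prob_structured_sol]) simp_all
  also have "\<dots> \<le> x * (3 * ?h) + sqrt (4 * ?h)"
  proof (intro add_mono mult_mono real_sqrt_le_mono)
    have "2 / real p = 2 * (1 / real p)" by simp
    then show "exp (- log_modulus x) + 2 / p \<le> 3 * ?h" "1 / 2 ^ l + 2 / p + exp (- log_modulus x) \<le> 4 * ?h"
      using inv_p inv_2l gam by linarith+
  qed (use x in auto)
  also have "sqrt (4 * ?h) = 2 * exp (- log_modulus x / 4)"
  proof -
    have "4 * ?h = (2 * exp (- log_modulus x / 4))\<^sup>2" by (simp add: power_mult_distrib exp_double[symmetric])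
    then show ?thesis by (intro real_sqrt_unique) simp_all
  qed
  also note final
  finally show ?thesis .
qed

theorem theorem1:
  fixes c :: real
  assumes "c = 1 / 2 ^ 13"
  shows "\<exists>n\<^sub>0 :: nat. \<forall>n \<ge> n\<^sub>0.
    measure_pmf.prob (pmf_of_set (sym_sign_mats n)) {M. Determinant.det M = 0}
      \<le> exp (- c * sqrt (real n * ln (real n)))"
proof -
  have "filterlim (\<lambda>x. exp (log_modulus x)) at_top at_top"
    unfolding log_modulus_def by real_asymp
  then have primes: "eventually (\<lambda>x. \<exists>p. prime p \<and> sqrt (exp (log_modulus x)) < real p \<and> real p \<le> exp (log_modulus x)) at_top"
    by (rule eventually_compose_filterlim[OF prime_between_sqrt])
  have "eventually (\<lambda>n. measure_pmf.prob (pmf_of_set (sym_sign_mats n)) {M. Determinant.det M = 0}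
      \<le> exp (- c * sqrt (real n * ln (real n)))) sequentially"
    using filterlim_real_sequentially[THEN eventually_compose_filterlim[OF eventually_conj[OF large_parameters primes]]]
  proof eventually_elim
    case (elim n)
    let ?x = "real n"
    obtain p where p: "prime p" "sqrt (exp (log_modulus ?x)) < real p" "real p \<le> exp (log_modulus ?x)"
      using elim by blast
    have half: "sqrt (exp (log_modulus ?x)) = exp (log_modulus ?x / 2)"
    proof -
      have "exp (log_modulus ?x) = (exp (log_modulus ?x / 2))\<^sup>2" by (simp add: exp_double[symmetric])
      then show ?thesis by simp
    qed
    have "2 \<le> exp (log_modulus ?x / 2)" using elim by blast
    then have "2 < p" using p(2) unfolding half by linarith
    then interpret odd_prime p using p(1) by unfold_locales
    \<comment> \<open>the base point is arbitrary, as all entries of the matrix are resampled\<close>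
    have "measure_pmf.prob (pmf_of_set (sym_sign_mats n)) {M. Determinant.det M = 0}
        \<le> rprob (pairs n) (singular n) (\<lambda>_. 1)"
      by (rule prob_det_zero_le)
    also have "\<dots> \<le> exp (- log_modulus ?x / 8)"
      by (rule rprob_singular_le) (use elim p(2,3) in \<open>simp_all only: half\<close>)
    also have "- log_modulus ?x / 8 = - c * sqrt (real n * ln (real n))"
      by (simp add: log_modulus_def assms)
    finally show ?case .
  qed
  then show ?thesis by (simp only: eventually_sequentially)
qed

end
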